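(* Let $(A,\mathfrak m)$ be a one-dimensional Cohen-Macaulay local ring with infinite residue field and $I$ an $\mathfrak m$-primary ideal such that $e_0(I)\ge3$ and $e_1(I)=\binom{e_0(I)}{2}+1-\ell(A/I)$. Then: (i) $\widetilde I=\mathfrak m$, $I^2=\mathfrak mI$ and $\mu(I)=2$; (ii) $\mu(\mathfrak m)\in\{2,3\}$; (iii) if $\mu(\mathfrak m)=2$, then $I=\mathfrak m$ and $G(\mathfrak m)$ is a Cohen-Macaulay ring; (iv) if $\mu(\mathfrak m)=3$, then $I^n=\mathfrak m^n$ for all $n\ge2$ and $\ell(A/I)=2$; in this case $\operatorname{depth}G(I)=0$.
   Context: $\ell$ denotes length and $\mu$ the minimal number of generators. For an $\mathfrak m$-primary ideal $I$ of a one-dimensional Noetherian local ring $A$, $e_0(I),e_1(I)$ are the integers with $\ell(A/I^{n+1})=e_0(I)(n+1)-e_1(I)$ for all $n\gg0$. $G(I)=\bigoplus_{n\ge0}I^n/I^{n+1}$ is the associated graded ring; its depth is taken with respect to its homogeneous maximal ideal. $\widetilde I=\bigcup_{k\ge1}(I^{k+1}:I^k)$ is the Ratliff-Rush closure of $I$. *)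

theory Defs
  imports "HOL-Algebra.Algebra" "HOL-Library.Extended_Nat" Complex_Main
begin

section \<open>Local rings, primary ideals and operations on ideals\<close>

locale local_ring = cring R for R (structure) and m +
  assumes maximal: "maximalideal m R"
    and unique_maximal: "maximalideal J R \<Longrightarrow> J = m"

definition radical :: "('a, 'b) ring_scheme \<Rightarrow> 'a set \<Rightarrow> 'a set"
  where "radical R J = {a \<in> carrier R. \<exists>n::nat. a [^]\<^bsub>R\<^esub> n \<in> J}"

locale primaryideal = ideal Q R + cring R for Q and R (structure) +
  assumes Q_notcarr: "carrier R \<noteq> Q"
    and Q_primary: "\<lbrakk>a \<in> carrier R; b \<in> carrier R; a \<otimes> b \<in> Q\<rbrakk> \<Longrightarrow> a \<in> Q \<or> b \<in> radical R Q"

text \<open>Ideal powers are powers in the library's multiplicative monoid of ideals, so the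
  zeroth power is the whole ring.\<close>

definition ideal_pow :: "('a, 'b) ring_scheme \<Rightarrow> 'a set \<Rightarrow> nat \<Rightarrow> 'a set"
  where "ideal_pow R J n = J [^]\<^bsub>ideals_set R\<^esub> n"

definition ideal_colon :: "('a, 'b) ring_scheme \<Rightarrow> 'a set \<Rightarrow> 'a set \<Rightarrow> 'a set"
  where "ideal_colon R J K = {a \<in> carrier R. \<forall>k\<in>K. a \<otimes>\<^bsub>R\<^esub> k \<in> J}"

definition ratliff_rush :: "('a, 'b) ring_scheme \<Rightarrow> 'a set \<Rightarrow> 'a set"
  where "ratliff_rush R J = (\<Union>k\<in>{1..}. ideal_colon R (ideal_pow R J (k + 1)) (ideal_pow R J k))"

text \<open>Only meaningful for finitely generated ideals.\<close>

definition min_gens :: "('a, 'b) ring_scheme \<Rightarrow> 'a set \<Rightarrow> nat"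
  where "min_gens R J = (LEAST n. \<exists>S \<subseteq> carrier R. finite S \<and> card S = n \<and> genideal R S = J)"


section \<open>Length and Hilbert coefficients\<close>

definition module_length :: "('a, 'c) ring_scheme \<Rightarrow> ('a, 'b, 'd) module_scheme \<Rightarrow> enat"
  where "module_length R M =
    Sup {enat n | n. \<exists>N :: nat \<Rightarrow> 'b set.
          (\<forall>i\<le>n. submodule (N i) R M) \<and> (\<forall>i<n. N i \<subset> N (Suc i))}"

text \<open>The quotient of a ring by an ideal, as a module over that ring.\<close>

definition quot_module :: "('a, 'b) ring_scheme \<Rightarrow> 'a set \<Rightarrow> ('a, 'a set) module"
  where "quot_module R J =
    ring.extend (R Quot J) \<lparr>smult = (\<lambda>a c. (J +>\<^bsub>R\<^esub> a) \<otimes>\<^bsub>R Quot J\<^esub> c)\<rparr>"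

definition quot_length :: "('a, 'b) ring_scheme \<Rightarrow> 'a set \<Rightarrow> enat"
  where "quot_length R J = module_length R (quot_module R J)"

text \<open>Hilbert coefficients of a primary ideal belonging to the maximal ideal of a
  one-dimensional Noetherian local ring; all lengths involved are then finite.\<close>

definition hilbert_coeffs :: "('a, 'b) ring_scheme \<Rightarrow> 'a set \<Rightarrow> int \<times> int"
  where "hilbert_coeffs R J = (THE (e\<^sub>0, e\<^sub>1).
    \<forall>\<^sub>F n in sequentially.
      int (the_enat (quot_length R (ideal_pow R J (n + 1)))) = e\<^sub>0 * (int n + 1) - e\<^sub>1)"

definition hilbert_e0 :: "('a, 'b) ring_scheme \<Rightarrow> 'a set \<Rightarrow> int"
  where "hilbert_e0 R J = fst (hilbert_coeffs R J)"

definition hilbert_e1 :: "('a, 'b) ring_scheme \<Rightarrow> 'a set \<Rightarrow> int"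
  where "hilbert_e1 R J = snd (hilbert_coeffs R J)"


section \<open>Dimension, depth and Cohen--Macaulay rings\<close>

definition krull_dim :: "('a, 'b) ring_scheme \<Rightarrow> enat"
  where "krull_dim R =
    Sup {enat n | n. \<exists>P :: nat \<Rightarrow> 'a set.
          (\<forall>i\<le>n. primeideal (P i) R) \<and> (\<forall>i<n. P i \<subset> P (Suc i))}"

definition height :: "('a, 'b) ring_scheme \<Rightarrow> 'a set \<Rightarrow> enat"
  where "height R Q =
    Sup {enat n | n. \<exists>P :: nat \<Rightarrow> 'a set.
          (\<forall>i\<le>n. primeideal (P i) R) \<and> (\<forall>i<n. P i \<subset> P (Suc i)) \<and> P n = Q}"

text \<open>The first condition says that each entry is a nonzerodivisor modulo the ideal generated by
  its predecessors.\<close>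

definition regular_sequence :: "('a, 'b) ring_scheme \<Rightarrow> 'a list \<Rightarrow> bool"
  where "regular_sequence R xs \<longleftrightarrow> set xs \<subseteq> carrier R \<and>
    (\<forall>i<length xs. \<forall>r\<in>carrier R.
       xs ! i \<otimes>\<^bsub>R\<^esub> r \<in> genideal R (set (take i xs)) \<longrightarrow> r \<in> genideal R (set (take i xs))) \<and>
    genideal R (set xs) \<noteq> carrier R"

definition depth :: "('a, 'b) ring_scheme \<Rightarrow> 'a set \<Rightarrow> enat"
  where "depth R J = Sup {enat (length xs) | xs. set xs \<subseteq> J \<and> regular_sequence R xs}"

text \<open>The usual definition for not necessarily local rings. For a local ring only its maximal
  ideal is involved, and the height of that ideal is the Krull dimension.\<close>

locale cohen_macaulay_ring = cring R + noetherian_ring R for R (structure) +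
  assumes depth_eq_height: "maximalideal P R \<Longrightarrow> depth R P = height R P"


section \<open>The associated graded ring\<close>

text \<open>The component of degree \<open>n\<close> consists of the cosets of the \<open>(n+1)\<close>-st power of the ideal by
  elements of the \<open>n\<close>-th power; it lies in the quotient ring by the \<open>(n+1)\<close>-st power, where the sums
  in the product below are formed.\<close>

definition graded_piece :: "('a, 'b) ring_scheme \<Rightarrow> 'a set \<Rightarrow> nat \<Rightarrow> 'a set set"
  where "graded_piece R J n = (\<lambda>x. ideal_pow R J (n + 1) +>\<^bsub>R\<^esub> x) ` ideal_pow R J n"

text \<open>Product of a coset \<open>U\<close> of degree \<open>i\<close> and a coset \<open>V\<close> of degree \<open>j\<close>, with \<open>n = i + j\<close>.
  The result does not depend on the representatives, so the union is that of a single coset.\<close>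

definition graded_mult :: "('a, 'b) ring_scheme \<Rightarrow> 'a set \<Rightarrow> nat \<Rightarrow> 'a set \<Rightarrow> 'a set \<Rightarrow> 'a set"
  where "graded_mult R J n U V =
    (\<Union>u\<in>U. \<Union>v\<in>V. ideal_pow R J (n + 1) +>\<^bsub>R\<^esub> (u \<otimes>\<^bsub>R\<^esub> v))"

definition assoc_graded :: "('a, 'b) ring_scheme \<Rightarrow> 'a set \<Rightarrow> (nat \<Rightarrow> 'a set) ring"
  where "assoc_graded R J =
    \<lparr>carrier = {f. (\<forall>n. f n \<in> graded_piece R J n) \<and> finite {n. f n \<noteq> ideal_pow R J (n + 1)}},
     monoid.mult = (\<lambda>f g n. finsum (R Quot (ideal_pow R J (n + 1)))
                       (\<lambda>i. graded_mult R J n (f i) (g (n - i))) {..n}),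
     one = (\<lambda>n. ideal_pow R J (n + 1) +>\<^bsub>R\<^esub> (if n = 0 then \<one>\<^bsub>R\<^esub> else \<zero>\<^bsub>R\<^esub>)),
     ring.zero = (\<lambda>n. ideal_pow R J (n + 1)),
     add = (\<lambda>f g n. f n <+>\<^bsub>R\<^esub> g n)\<rparr>"

text \<open>For a local ring with maximal ideal \<open>m\<close> containing \<open>J\<close>: the elements whose component of
  degree zero lies in \<open>m/J\<close>.\<close>

definition assoc_graded_max :: "('a, 'b) ring_scheme \<Rightarrow> 'a set \<Rightarrow> 'a set \<Rightarrow> (nat \<Rightarrow> 'a set) set"
  where "assoc_graded_max R m J = {f \<in> carrier (assoc_graded R J). f 0 \<subseteq> m}"

end

theory Submission
  imports Defs
begin

text \<open>
  Write \<open>H n\<close> for the length of \<open>I\<^sup>n/I\<^sup>n\<^sup>+\<^sup>1\<close> and \<open>e\<close> for \<open>e\<^sub>0(I)\<close>. If \<open>x\<close> generates a minimal reduction of \<open>I\<close>, then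
  \<open>e - H n\<close> is the length of \<open>I\<^sup>n\<^sup>+\<^sup>1/xI\<^sup>n\<close>, and \<open>e\<^sub>1(I)\<close> is the sum of all these numbers. By the theorem of Eakin
  and Sathaye \<open>I\<^sup>n\<close> needs at least \<open>n + 1\<close> generators unless \<open>I\<^sup>n = xI\<^sup>n\<^sup>-\<^sup>1\<close> for some \<open>x\<close>; hence \<open>H n\<close> is at least
  \<open>min (n + 1) e\<close> for \<open>n \<ge> 1\<close>, and the hypothesis on \<open>e\<^sub>1(I)\<close> forces equality. For \<open>n = 1\<close> this gives
  \<open>mI = I\<^sup>2\<close> and \<open>I = (x, y)\<close>. Multiplication by \<open>x\<close> embeds \<open>m/I\<close> into the uniserial module \<open>I\<^sup>2/xI\<close>, so
  \<open>m = I + (z)\<close>; by Cayley-Hamilton \<open>z\<^sup>2\<close> lies in \<open>I\<^sup>2\<close>, and therefore \<open>m\<^sup>2 = I\<^sup>2\<close> and \<open>m/I\<close> has length at most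
  one. If \<open>I \<noteq> m\<close>, then \<open>z\<close> gives a nonzero element of \<open>G(I)\<close> annihilated by the homogeneous maximal ideal. If
  \<open>I = m\<close>, then the initial form \<open>T\<close> of \<open>x\<close> is a nonzerodivisor, and \<open>G(m)\<close> is a finite module over the
  polynomial ring in \<open>T\<close> over the residue field.
\<close>

text \<open>The hypothesis states that an upper bound is attained. The term \<open>n = 0\<close>
  enters exactly, through \<open>H 0\<close>, the length of \<open>A/I\<close>; the other terms
  \<open>e - H n\<close> are at most \<open>e - 1 - n\<close> for \<open>n < e\<close> and vanish
  for larger \<open>n\<close>, so the sum is at most
  \<open>(e - H 0) + (binom(e, 2) - (e - 1)) = binom(e, 2) + 1 - H 0\<close>. Most of the work for
  claim (iii) comes from the meaning of Cohen-Macaulay: it is a condition at every maximal ideal of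
  \<open>G(m)\<close>, homogeneous or not, together with the noetherian property, so regularity of
  \<open>T\<close> alone is not enough. Finiteness over the polynomial ring is exploited without
  quotient modules. Chains of submodules of \<open>G(m)\<close> are compared through ideals of
  leading coefficients in the local ring, which are controlled in high degrees by
  \<open>m^(n+1) = x m^n\<close>. Stabilisation of such chains gives both the noetherian property
  and integral equations, and the latter bound all heights by one. Lengths are likewise measured on
  intervals in the lattice of ideals, where multiplication by a nonzerodivisor preserves
  length.\<close>

no_notation Sum_Type.Plus (infixr \<open><+>\<close> 65)

section \<open>Arithmetic of ideals\<close>

lemma (in ring) mem_ideal_add:
  "a \<in> J <+> K \<longleftrightarrow> (\<exists>j\<in>J. \<exists>k\<in>K. a = j \<oplus> k)"
  by (auto simp: set_add_def')

lemma (in ring) mem_ideal_addE: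
  assumes "a \<in> J <+> K" obtains j k where "j \<in> J" "k \<in> K" "a = j \<oplus> k"
  using assms by (auto simp: mem_ideal_add)

lemma (in ring) ideal_add_upper1:
  assumes "ideal J R" "ideal K R" shows "J \<subseteq> J <+> K"
proof
  fix a assume a: "a \<in> J"
  have "a = a \<oplus> \<zero>" using a assms ideal.Icarr by fastforce
  moreover have "\<zero> \<in> K" using additive_subgroup.zero_closed[OF ideal.axioms(1)] assms(2) by blast
  ultimately show "a \<in> J <+> K" using a unfolding mem_ideal_add by blast
qed

lemma (in ring) ideal_add_upper2:
  assumes "ideal J R" "ideal K R" shows "K \<subseteq> J <+> K"
proof
  fix a assume a: "a \<in> K"
  have "a = \<zero> \<oplus> a" using a assms ideal.Icarr by fastforce
  moreover have "\<zero> \<in> J" using additive_subgroup.zero_closed[OF ideal.axioms(1)] assms(1) by blast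
  ultimately show "a \<in> J <+> K" using a unfolding mem_ideal_add by blast
qed

lemma (in ring) ideal_add_least:
  assumes "ideal L R" "J \<subseteq> L" "K \<subseteq> L" shows "J <+> K \<subseteq> L"
  using assms additive_subgroup.a_closed[OF ideal.axioms(1)[OF assms(1)]]
  by (auto simp: mem_ideal_add subset_iff)

lemma (in ring) ideal_add_mono:
  assumes "J \<subseteq> J'" "K \<subseteq> K'" shows "J <+> K \<subseteq> J' <+> K'"
  using assms unfolding subset_iff mem_ideal_add by blast

lemma (in ring) ideal_add_absorb:
  assumes "ideal J R" "ideal K R" "J \<subseteq> K" shows "J <+> K = K"
  using ideal_add_least[of K J K] ideal_add_upper2[of J K] assms by blast

lemma (in ring) ideal_subset: "ideal J R \<Longrightarrow> J \<subseteq> carrier R"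
  using ideal.Icarr by fast

lemma (in ring) ideal_zero: "ideal J R \<Longrightarrow> \<zero> \<in> J"
  by (rule additive_subgroup.zero_closed[OF ideal.axioms(1)])

lemma (in ring) ideal_add_closed: "ideal J R \<Longrightarrow> a \<in> J \<Longrightarrow> b \<in> J \<Longrightarrow> a \<oplus> b \<in> J"
  by (rule additive_subgroup.a_closed[OF ideal.axioms(1)])

lemma (in ring) ideal_inv_closed: "ideal J R \<Longrightarrow> a \<in> J \<Longrightarrow> \<ominus> a \<in> J"
  by (rule additive_subgroup.a_inv_closed[OF ideal.axioms(1)])

lemma (in ring) ideal_diff_closed: "ideal J R \<Longrightarrow> a \<in> J \<Longrightarrow> b \<in> J \<Longrightarrow> a \<ominus> b \<in> J"
  by (simp add: a_minus_def ideal_add_closed ideal_inv_closed)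

lemma (in ring) ideal_eq_carrier: "ideal J R \<Longrightarrow> \<one> \<in> J \<Longrightarrow> J = carrier R"
  using ideal.one_imp_carrier by blast

lemma (in cring) idealI':
  assumes "J \<subseteq> carrier R" "\<zero> \<in> J"
    and "\<And>a b. a \<in> J \<Longrightarrow> b \<in> J \<Longrightarrow> a \<oplus> b \<in> J"
    and "\<And>a c. a \<in> J \<Longrightarrow> c \<in> carrier R \<Longrightarrow> c \<otimes> a \<in> J"
  shows "ideal J R"
proof (rule idealI)
  show "ring R" by (rule ring_axioms)
  have "\<ominus> a \<in> J" if "a \<in> J" for a
    using assms(4)[OF that, of "\<ominus> \<one>"] that assms(1) by (auto simp: l_minus)
  then show "subgroup J (add_monoid R)"
    by (intro subgroup.intro) (use assms in \<open>auto simp: a_inv_def\<close>)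
  show "\<And>a c. a \<in> J \<Longrightarrow> c \<in> carrier R \<Longrightarrow> c \<otimes> a \<in> J" by fact
  show "\<And>a c. a \<in> J \<Longrightarrow> c \<in> carrier R \<Longrightarrow> a \<otimes> c \<in> J"
    using assms(1,4) m_comm by (metis subsetD)
qed

lemma (in cring) mem_cgenideal: "b \<in> PIdl a \<longleftrightarrow> (\<exists>c\<in>carrier R. b = c \<otimes> a)"
  by (auto simp: cgenideal_def)

lemma (in cring) Idl_insert:
  assumes "a \<in> carrier R" "S \<subseteq> carrier R"
  shows "Idl (insert a S) = PIdl a <+> Idl S"
proof
  have I: "ideal (PIdl a) R" "ideal (Idl S) R" using assms cgenideal_ideal genideal_ideal by auto
  have "insert a S \<subseteq> PIdl a <+> Idl S"
    using ideal_add_upper1[OF I] ideal_add_upper2[OF I] cgenideal_self[OF assms(1)]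
      genideal_self[OF assms(2)] by auto
  then show "Idl (insert a S) \<subseteq> PIdl a <+> Idl S"
    using genideal_minimal add_ideals[OF I] by blast
  have "ideal (Idl (insert a S)) R" "insert a S \<subseteq> Idl (insert a S)"
    using assms genideal_ideal genideal_self[of "insert a S"] by auto
  then show "PIdl a <+> Idl S \<subseteq> Idl (insert a S)"
    by (intro ideal_add_least cgenideal_minimal genideal_minimal) auto
qed

lemma (in ring) Idl_empty: "Idl {} = {\<zero>}"
  using genideal_minimal[OF zeroideal, of "{}"] genideal_ideal[of "{}"] ideal_zero by blast

lemma (in ring) ideal_prod_least:
  assumes "ideal L R" "\<And>a b. a \<in> J \<Longrightarrow> b \<in> K \<Longrightarrow> a \<otimes> b \<in> L" shows "J \<cdot> K \<subseteq> L"
proof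
  fix s assume "s \<in> J \<cdot> K" then show "s \<in> L"
    by (induct s rule: ideal_prod.induct) (use assms ideal_add_closed in auto)
qed

lemma ideal_prod_mono:
  assumes "J \<subseteq> J'" "K \<subseteq> K'" shows "J \<cdot>\<^bsub>R\<^esub> K \<subseteq> J' \<cdot>\<^bsub>R\<^esub> K'"
proof
  fix s assume "s \<in> J \<cdot>\<^bsub>R\<^esub> K" then show "s \<in> J' \<cdot>\<^bsub>R\<^esub> K'"
    by (induct s rule: ideal_prod.induct)
      (use assms ideal_prod.prod ideal_prod.sum in \<open>metis subsetD\<close>)+
qed

lemma (in cring) ideal_pow_0 [simp]: "ideal_pow R J 0 = carrier R"
  by (simp add: ideal_pow_def ideals_set_def nat_pow_def)

lemma (in cring) ideal_pow_Suc: "ideal_pow R J (Suc n) = ideal_pow R J n \<cdot> J"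
  by (simp add: ideal_pow_def ideals_set_def nat_pow_def)

lemma (in cring) ideal_pow_ideal [simp, intro]: "ideal J R \<Longrightarrow> ideal (ideal_pow R J n) R"
  by (induct n) (auto simp: ideal_pow_Suc oneideal ideal_prod_is_ideal)

lemma (in cring) ideal_pow_Suc2: "ideal J R \<Longrightarrow> ideal_pow R J (Suc n) = J \<cdot> ideal_pow R J n"
  by (simp add: ideal_pow_Suc ideal_prod_commute)

lemma (in cring) ideal_pow_1 [simp]: "ideal J R \<Longrightarrow> ideal_pow R J (Suc 0) = J"
  using ideal_prod_one[of J] ideal_prod_commute[of J "carrier R"] oneideal
  by (simp add: ideal_pow_Suc)

lemma (in cring) ideal_pow_add:
  assumes "ideal J R" shows "ideal_pow R J (i + j) = ideal_pow R J i \<cdot> ideal_pow R J j"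
proof (induct j)
  case 0 then show ?case using ideal_prod_one assms by simp
next
  case (Suc j) then show ?case using assms by (simp add: ideal_pow_Suc ideal_prod_assoc)
qed

lemma (in cring) ideal_pow_mult:
  assumes "ideal J R" "a \<in> ideal_pow R J i" "b \<in> ideal_pow R J j"
  shows "a \<otimes> b \<in> ideal_pow R J (i + j)"
  using assms ideal_pow_add ideal_prod.prod by fastforce

lemma (in cring) ideal_pow_Suc_subset: "ideal J R \<Longrightarrow> ideal_pow R J (Suc n) \<subseteq> ideal_pow R J n"
  using ideal_prod_inter ideal_pow_Suc by auto

lemma (in cring) ideal_pow_antimono:
  assumes "ideal J R" "i \<le> j" shows "ideal_pow R J j \<subseteq> ideal_pow R J i"
  using assms(2,1) by (induct rule: dec_induct) (use ideal_pow_Suc_subset in auto)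

lemma (in cring) ideal_pow_pow_mem:
  "ideal J R \<Longrightarrow> a \<in> J \<Longrightarrow> a [^] (n::nat) \<in> ideal_pow R J n"
  by (induct n) (auto simp: ideal_pow_Suc ideal_prod.prod)

text \<open>The ideal \<open>xJ\<close> is kept as an image of sets rather than as a product with a
  principal ideal. Cancellation of a nonzerodivisor is then a statement about elements.\<close>

lemma (in cring) scale_ideal [intro]:
  assumes "ideal J R" "x \<in> carrier R" shows "ideal ((\<otimes>) x ` J) R"
proof (rule idealI')
  note J = ideal_subset[OF assms(1)]
  show "(\<otimes>) x ` J \<subseteq> carrier R" using J assms by auto
  show "\<zero> \<in> (\<otimes>) x ` J" using ideal_zero[OF assms(1)] assms(2) by (metis imageI r_null)
  show "a \<oplus> b \<in> (\<otimes>) x ` J" if "a \<in> (\<otimes>) x ` J" "b \<in> (\<otimes>) x ` J" for a b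
    using that J assms ideal_add_closed[OF assms(1)]
    by (auto simp: r_distr[symmetric] subset_iff image_iff)
  show "c \<otimes> a \<in> (\<otimes>) x ` J" if "a \<in> (\<otimes>) x ` J" "c \<in> carrier R" for a c
    using that J assms ideal.I_l_closed[OF assms(1)]
    by (auto simp: subset_iff image_iff m_lcomm[of c x])
qed

lemma (in cring) scale_carrier: "x \<in> carrier R \<Longrightarrow> (\<otimes>) x ` carrier R = PIdl x"
  by (auto simp: mem_cgenideal image_iff m_comm)

lemma (in cring) scale_subset: "ideal J R \<Longrightarrow> x \<in> carrier R \<Longrightarrow> (\<otimes>) x ` J \<subseteq> J"
  using ideal.I_l_closed by fast

lemma (in cring) scale_scale:
  assumes "J \<subseteq> carrier R" "x \<in> carrier R" "y \<in> carrier R"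
  shows "(\<otimes>) x ` (\<otimes>) y ` J = (\<otimes>) (x \<otimes> y) ` J"
  using assms by (auto simp: image_image m_assoc subset_iff intro!: image_cong)

lemma (in cring) scale_prod:
  assumes "ideal J R" "ideal K R" "x \<in> carrier R"
  shows "(\<otimes>) x ` (J \<cdot> K) = ((\<otimes>) x ` J) \<cdot> K"
proof
  note s = ideal_subset[OF assms(1)] ideal_subset[OF assms(2)]
  have i: "ideal (((\<otimes>) x ` J) \<cdot> K) R" using assms by (intro ideal_prod_is_ideal) auto
  have "x \<otimes> s \<in> ((\<otimes>) x ` J) \<cdot> K" if "s \<in> J \<cdot> K" for s using that
  proof (induct s rule: ideal_prod.induct)
    case (prod a b)
    then have "(x \<otimes> a) \<otimes> b \<in> ((\<otimes>) x ` J) \<cdot> K" by (intro ideal_prod.prod) auto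
    then show ?case using prod s assms by (simp add: m_assoc subset_iff)
  next
    case (sum a b)
    then have "a \<in> carrier R" "b \<in> carrier R" using ideal_prod_in_carrier[OF assms(1,2)] by auto
    then show ?case using sum assms by (simp add: r_distr ideal_prod.sum)
  qed
  then show "(\<otimes>) x ` (J \<cdot> K) \<subseteq> ((\<otimes>) x ` J) \<cdot> K" by auto
  show "((\<otimes>) x ` J) \<cdot> K \<subseteq> (\<otimes>) x ` (J \<cdot> K)"
  proof (rule ideal_prod_least)
    show "ideal ((\<otimes>) x ` (J \<cdot> K)) R" using assms ideal_prod_is_ideal by auto
    show "a \<otimes> b \<in> (\<otimes>) x ` (J \<cdot> K)" if "a \<in> (\<otimes>) x ` J" "b \<in> K" for a b
      using that s assms
      by (auto simp: m_assoc subset_iff intro!: imageI ideal_prod.prod)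
  qed
qed

section \<open>Nonzerodivisors and cancellation\<close>

definition nonzerodiv :: "('a, 'b) ring_scheme \<Rightarrow> 'a \<Rightarrow> bool"
  where "nonzerodiv R x \<longleftrightarrow> x \<in> carrier R \<and> (\<forall>r\<in>carrier R. x \<otimes>\<^bsub>R\<^esub> r = \<zero>\<^bsub>R\<^esub> \<longrightarrow> r = \<zero>\<^bsub>R\<^esub>)"

lemma nonzerodiv_carrier: "nonzerodiv R x \<Longrightarrow> x \<in> carrier R"
  by (simp add: nonzerodiv_def)

lemma (in cring) nonzerodiv_cancel:
  assumes "nonzerodiv R x" "a \<in> carrier R" "b \<in> carrier R" "x \<otimes> a = x \<otimes> b" shows "a = b"
proof -
  have x: "x \<in> carrier R" using assms(1) by (simp add: nonzerodiv_def)
  have "x \<otimes> (a \<ominus> b) = \<zero>" using assms x by (simp add: r_minus r_distr a_minus_def r_neg)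
  then have "a \<ominus> b = \<zero>" using assms by (simp add: nonzerodiv_def)
  then show ?thesis using assms by simp
qed

lemma (in cring) nonzerodiv_mult:
  assumes "nonzerodiv R x" "nonzerodiv R y" shows "nonzerodiv R (x \<otimes> y)"
  unfolding nonzerodiv_def
proof (intro conjI ballI impI)
  have c: "x \<in> carrier R" "y \<in> carrier R" using assms by (auto simp: nonzerodiv_def)
  then show "x \<otimes> y \<in> carrier R" by simp
  fix r assume r: "r \<in> carrier R" "x \<otimes> y \<otimes> r = \<zero>"
  then have "x \<otimes> (y \<otimes> r) = \<zero>" using c by (simp add: m_assoc)
  then have "y \<otimes> r = \<zero>" using assms(1) c r by (simp add: nonzerodiv_def)
  then show "r = \<zero>" using assms(2) r by (simp add: nonzerodiv_def)
qed

lemma (in cring) nonzerodiv_pow: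
  assumes "nonzerodiv R x" shows "nonzerodiv R (x [^] (n::nat))"
proof (induct n)
  case 0 show ?case by (simp add: nonzerodiv_def)
next
  case (Suc n) then show ?case using nonzerodiv_mult[OF Suc assms] by simp
qed

lemma (in cring) nonzerodiv_factor:
  assumes "nonzerodiv R (x \<otimes> c)" "x \<in> carrier R" "c \<in> carrier R" shows "nonzerodiv R x"
  unfolding nonzerodiv_def
proof (intro conjI ballI impI)
  fix r assume "r \<in> carrier R" "x \<otimes> r = \<zero>"
  then have "(x \<otimes> c) \<otimes> r = \<zero>" using assms by (metis m_assoc m_comm r_null)
  then show "r = \<zero>" using assms \<open>r \<in> carrier R\<close> by (auto simp: nonzerodiv_def)
qed fact

lemma (in cring) nonzerodiv_scale_mem_iff:
  assumes "nonzerodiv R x" "K \<subseteq> carrier R" "a \<in> carrier R"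
  shows "x \<otimes> a \<in> (\<otimes>) x ` K \<longleftrightarrow> a \<in> K"
  using nonzerodiv_cancel[OF assms(1)] assms(2,3) by (auto simp: subset_iff image_iff)

lemma (in cring) nonzerodiv_scale_subset_iff:
  assumes "nonzerodiv R x" "J \<subseteq> carrier R" "K \<subseteq> carrier R"
  shows "(\<otimes>) x ` J \<subseteq> (\<otimes>) x ` K \<longleftrightarrow> J \<subseteq> K"
  using nonzerodiv_scale_mem_iff[OF assms(1,3)] assms(2) unfolding image_subset_iff by blast



section \<open>Lengths of intervals of ideals\<close>

definition ideal_chain :: "('a, 'b) ring_scheme \<Rightarrow> 'a set \<Rightarrow> 'a set \<Rightarrow> nat \<Rightarrow> (nat \<Rightarrow> 'a set) \<Rightarrow> bool"
  where "ideal_chain R K L n N \<longleftrightarrow>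
    (\<forall>i\<le>n. ideal (N i) R \<and> K \<subseteq> N i \<and> N i \<subseteq> L) \<and> (\<forall>i<n. N i \<subset> N (Suc i))"

definition ideal_length :: "('a, 'b) ring_scheme \<Rightarrow> 'a set \<Rightarrow> 'a set \<Rightarrow> enat"
  where "ideal_length R K L = Sup {enat n | n. \<exists>N. ideal_chain R K L n N}"

text \<open>Reduces an inequality for a sum of two suprema to finite approximants, so that infinite
  lengths need no separate treatment in the additivity proof.\<close>

lemma enat_add_leI:
  assumes "\<And>a b. enat a \<le> x \<Longrightarrow> enat b \<le> y \<Longrightarrow> enat (a + b) \<le> z" shows "x + y \<le> z"
proof (cases "x = \<infinity> \<or> y = \<infinity>")
  case True
  have "enat n \<le> z" for n
    using True assms[of n 0] assms[of 0 n] by (auto simp: zero_enat_def[symmetric])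
  then have "z = \<infinity>" by (cases z) (auto, meson Suc_n_not_le_n)
  then show ?thesis by simp
next
  case False
  then obtain a b where "x = enat a" "y = enat b" by auto
  then show ?thesis using assms[of a b] by simp
qed

lemma ideal_chain_prefix: "ideal_chain R K L n N \<Longrightarrow> k \<le> n \<Longrightarrow> ideal_chain R K L k N"
  by (auto simp: ideal_chain_def)

text \<open>An initial segment of a chain is a chain, so the set under the supremum is closed
  downwards and every finite lower bound is witnessed by an actual chain.\<close>

lemma enat_le_ideal_length_iff:
  assumes "ideal K R" "K \<subseteq> L"
  shows "enat n \<le> ideal_length R K L \<longleftrightarrow> (\<exists>N. ideal_chain R K L n N)"
proof
  assume "\<exists>N. ideal_chain R K L n N"
  then show "enat n \<le> ideal_length R K L" unfolding ideal_length_def by (intro Sup_upper) auto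
next
  assume n: "enat n \<le> ideal_length R K L"
  show "\<exists>N. ideal_chain R K L n N"
  proof (rule ccontr)
    assume no: "\<not> ?thesis"
    have 0: "ideal_chain R K L 0 (\<lambda>_. K)" using assms by (auto simp: ideal_chain_def)
    then have "n \<noteq> 0" using no by metis
    have "k < n" if "ideal_chain R K L k N" for k N
      using ideal_chain_prefix[OF that, of n] no by (meson not_le)
    then have "ideal_length R K L \<le> enat (n - 1)"
      unfolding ideal_length_def by (intro Sup_least) fastforce
    with n have "enat n \<le> enat (n - 1)" by (rule order_trans)
    then show False using \<open>n \<noteq> 0\<close> by simp
  qed
qed

lemma ideal_length_leI:
  assumes "\<And>n N. ideal_chain R K L n N \<Longrightarrow> enat n \<le> b" shows "ideal_length R K L \<le> b"
  unfolding ideal_length_def by (intro Sup_least) (use assms in auto)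

lemma ideal_length_ge:
  assumes "ideal_chain R K L n N" shows "enat n \<le> ideal_length R K L"
  unfolding ideal_length_def by (intro Sup_upper) (use assms in auto)

lemma ideal_length_antimono:
  assumes "K \<subseteq> K'" "L' \<subseteq> L" shows "ideal_length R K' L' \<le> ideal_length R K L"
proof (intro ideal_length_leI ideal_length_ge)
  fix n N assume "ideal_chain R K' L' n N"
  then show "ideal_chain R K L n N" unfolding ideal_chain_def using assms by (meson order_trans)
qed

lemma ideal_length_le_map:
  assumes "\<And>J. ideal J R \<Longrightarrow> K \<subseteq> J \<Longrightarrow> J \<subseteq> L \<Longrightarrow> ideal (f J) R \<and> K' \<subseteq> f J \<and> f J \<subseteq> L'"
    and "\<And>J J'. ideal J R \<Longrightarrow> ideal J' R \<Longrightarrow> K \<subseteq> J \<Longrightarrow> J \<subset> J' \<Longrightarrow> J' \<subseteq> L \<Longrightarrow> f J \<subset> f J'"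
  shows "ideal_length R K L \<le> ideal_length R K' L'"
proof (intro ideal_length_leI ideal_length_ge)
  fix n N assume "ideal_chain R K L n N"
  then show "ideal_chain R K' L' n (\<lambda>i. f (N i))"
    unfolding ideal_chain_def by (simp add: assms(1)) (simp add: assms(2) Suc_leI)
qed

text \<open>Deleting repetitions leaves a strict chain. The induction also records that the thinned
  chain ends at \<open>N n\<close>, since the next member has to be attached there.\<close>

lemma weak_ideal_chain:
  assumes "\<And>i. i \<le> n \<Longrightarrow> ideal (N i) R \<and> K \<subseteq> N i \<and> N i \<subseteq> L" "\<And>i. i < n \<Longrightarrow> N i \<subseteq> N (Suc i)"
  shows "enat (card {i. i < n \<and> N i \<noteq> N (Suc i)}) \<le> ideal_length R K L"
proof -
  have "\<exists>M. ideal_chain R K L (card {i. i < n \<and> N i \<noteq> N (Suc i)}) M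
      \<and> M (card {i. i < n \<and> N i \<noteq> N (Suc i)}) = N n"
    using assms
  proof (induct n)
    case 0 then show ?case by (intro exI[of _ "\<lambda>_. N 0"]) (auto simp: ideal_chain_def)
  next
    case (Suc n)
    let ?c = "card {i. i < n \<and> N i \<noteq> N (Suc i)}"
    have "\<exists>M. ideal_chain R K L ?c M \<and> M ?c = N n"
      by (rule Suc(1)) (simp_all add: Suc(2,3))
    then obtain M where M: "ideal_chain R K L ?c M" "M ?c = N n" by blast
    show ?case
    proof (cases "N n = N (Suc n)")
      case True
      then have "{i. i < Suc n \<and> N i \<noteq> N (Suc i)} = {i. i < n \<and> N i \<noteq> N (Suc i)}"
        by (auto simp: less_Suc_eq)
      then show ?thesis using M True by auto
    next
      case False
      then have "{i. i < Suc n \<and> N i \<noteq> N (Suc i)} = insert n {i. i < n \<and> N i \<noteq> N (Suc i)}"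
        by (auto simp: less_Suc_eq)
      then have c: "card {i. i < Suc n \<and> N i \<noteq> N (Suc i)} = Suc ?c" by simp
      have "ideal_chain R K L (Suc ?c) (M(Suc ?c := N (Suc n)))"
        using M Suc(2)[of "Suc n"] Suc(3)[of n] False
        by (auto simp: ideal_chain_def le_Suc_eq less_Suc_eq)
      moreover have "(M(Suc ?c := N (Suc n))) (Suc ?c) = N (Suc n)" by simp
      ultimately show ?thesis unfolding c by blast
    qed
  qed
  then show ?thesis using ideal_length_ge by blast
qed

text \<open>The modular law. It makes length subadditive along \<open>L\<close>: a strict inclusion
  stays strict after intersecting with \<open>L\<close> or after adding \<open>L\<close>, so each
  step of a chain is counted in at least one of the two halves.\<close>

lemma (in ring) ideal_modular:
  assumes "ideal J R" "ideal J' R" "ideal L R" "J \<subseteq> J'" "J \<inter> L = J' \<inter> L" "J <+> L = J' <+> L"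
  shows "J = J'"
proof
  show "J' \<subseteq> J"
  proof
    fix a assume a: "a \<in> J'"
    then have "a \<in> J <+> L" using ideal_add_upper1[OF assms(2,3)] assms(6) by blast
    then obtain j l where jl: "j \<in> J" "l \<in> L" "a = j \<oplus> l" by (auto simp: mem_ideal_add)
    have c: "j \<in> carrier R" "l \<in> carrier R"
      using jl ideal.Icarr[OF assms(1)] ideal.Icarr[OF assms(3)] by auto
    then have "l = a \<ominus> j" using jl(3) by (simp add: a_minus_def a_comm[of j l] a_assoc r_neg)
    moreover have "j \<in> J'" using jl(1) assms(4) by blast
    ultimately have "l \<in> J' \<inter> L" using jl(2) ideal_diff_closed[OF assms(2) a] by simp
    then have "l \<in> J" using assms(5) by blast
    then show "a \<in> J" using jl ideal_add_closed[OF assms(1)] by simp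
  qed
qed fact

lemma (in ring) ideal_length_add:
  assumes "ideal K R" "ideal L R" "ideal M R" "K \<subseteq> L" "L \<subseteq> M"
  shows "ideal_length R K M = ideal_length R K L + ideal_length R L M"
proof (rule antisym)
  show "ideal_length R K M \<le> ideal_length R K L + ideal_length R L M"
  proof (rule ideal_length_leI)
    fix n N assume N: "ideal_chain R K M n N"
    let ?A = "{i. i < n \<and> N i \<inter> L \<noteq> N (Suc i) \<inter> L}"
    let ?B = "{i. i < n \<and> N i <+> L \<noteq> N (Suc i) <+> L}"
    have N': "ideal (N i) R" "K \<subseteq> N i" "N i \<subseteq> M" if "i \<le> n" for i
      using N that by (auto simp: ideal_chain_def)
    have A: "enat (card ?A) \<le> ideal_length R K L"
      by (rule weak_ideal_chain) (use N N' assms in \<open>auto simp: i_intersect ideal_chain_def\<close>)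
    have B: "enat (card ?B) \<le> ideal_length R L M"
    proof (rule weak_ideal_chain)
      fix i assume "i \<le> n"
      then show "ideal (N i <+> L) R \<and> L \<subseteq> N i <+> L \<and> N i <+> L \<subseteq> M"
        using N'[of i] assms add_ideals ideal_add_upper2 ideal_add_least by metis
    next
      fix i assume "i < n"
      then show "N i <+> L \<subseteq> N (Suc i) <+> L"
        using N by (intro ideal_add_mono) (auto simp: ideal_chain_def)
    qed
    have "{..<n} \<subseteq> ?A \<union> ?B"
    proof
      fix i assume i: "i \<in> {..<n}"
      then have "N i \<subset> N (Suc i)" using N by (auto simp: ideal_chain_def)
      then show "i \<in> ?A \<union> ?B"
        using i ideal_modular[of "N i" "N (Suc i)" L] N'[of i] N'[of "Suc i"] assms(2) by auto
    qed
    then have "card {..<n} \<le> card (?A \<union> ?B)" by (rule card_mono[rotated]) auto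
    then have "n \<le> card ?A + card ?B" using card_Un_le[of ?A ?B] by simp
    then have "enat n \<le> enat (card ?A) + enat (card ?B)" by simp
    also have "\<dots> \<le> ideal_length R K L + ideal_length R L M" using A B by (rule add_mono)
    finally show "enat n \<le> \<dots>" .
  qed
  show "ideal_length R K L + ideal_length R L M \<le> ideal_length R K M"
  proof (rule enat_add_leI)
    fix a b assume "enat a \<le> ideal_length R K L" "enat b \<le> ideal_length R L M"
    then obtain P Q where P: "ideal_chain R K L a P" and Q: "ideal_chain R L M b Q"
      using enat_le_ideal_length_iff assms by metis
    \<comment> \<open>The chains are glued with \<open>Q 0\<close> left out: \<open>P a\<close> and
      \<open>Q 0\<close> may both equal \<open>L\<close>, but \<open>P a\<close> lies in
      \<open>Q 0\<close>, which is strictly below \<open>Q 1\<close>.\<close>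
    let ?N = "\<lambda>i. if i \<le> a then P i else Q (i - a)"
    have "?N i \<subset> ?N (Suc i)" if "i < a + b" for i
    proof -
      consider "i < a" | "i = a" | "i > a" by linarith
      then show ?thesis
      proof cases
        case 1 then show ?thesis using P by (simp add: ideal_chain_def)
      next
        case 2
        have "P a \<subseteq> L" "L \<subseteq> Q 0" "Q 0 \<subset> Q (Suc 0)"
          using P Q that 2 by (simp_all add: ideal_chain_def)
        then show ?thesis using 2 by simp
      next
        case 3
        then have "Q (i - a) \<subset> Q (Suc (i - a))" using Q that by (simp add: ideal_chain_def)
        then show ?thesis using 3 by (simp add: Suc_diff_le)
      qed
    qed
    moreover have "ideal (?N i) R \<and> K \<subseteq> ?N i \<and> ?N i \<subseteq> M" if "i \<le> a + b" for i
    proof (cases "i \<le> a")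
      case True
      then have "ideal (P i) R" "K \<subseteq> P i" "P i \<subseteq> L" using P by (simp_all add: ideal_chain_def)
      then show ?thesis using True assms(5) by auto
    next
      case False
      then have "ideal (Q (i - a)) R" "L \<subseteq> Q (i - a)" "Q (i - a) \<subseteq> M"
        using Q that by (simp_all add: ideal_chain_def)
      then show ?thesis using False assms(4) by auto
    qed
    ultimately have "ideal_chain R K M (a + b) ?N" unfolding ideal_chain_def by blast
    then show "enat (a + b) \<le> ideal_length R K M" by (rule ideal_length_ge)
  qed
qed

lemma ideal_length_self [simp]: "ideal_length R K K = 0"
proof -
  have "ideal_length R K K \<le> enat 0"
  proof (rule ideal_length_leI)
    fix n N assume N: "ideal_chain R K K n N"
    have "\<not> 0 < n"
    proof
      assume "0 < n"
      then have "N 0 \<subset> N (Suc 0)" "N 0 = K" "N (Suc 0) = K"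
        using N unfolding ideal_chain_def by (blast, auto simp: Suc_leI subset_antisym)
      then show False by simp
    qed
    then show "enat n \<le> enat 0" by simp
  qed
  then show ?thesis unfolding zero_enat_def by (rule antisym) (simp add: zero_enat_def[symmetric])
qed

lemma ideal_length_pos:
  assumes "ideal K R" "ideal L R" "K \<subset> L" shows "1 \<le> ideal_length R K L"
proof -
  have "ideal_chain R K L 1 (\<lambda>i. if i = 0 then K else L)"
    using assms by (auto simp: ideal_chain_def)
  then show ?thesis using ideal_length_ge by (fastforce simp: one_enat_def)
qed

lemma (in ring) ideal_length_eq_imp:
  assumes "ideal K R" "ideal L R" "ideal M R" "K \<subseteq> L" "L \<subseteq> M"
    and "ideal_length R K M \<le> ideal_length R L M" "ideal_length R L M \<noteq> \<infinity>"
  shows "K = L"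
proof (rule ccontr)
  assume "K \<noteq> L"
  then have "1 \<le> ideal_length R K L" using assms ideal_length_pos by blast
  moreover have "ideal_length R K L + ideal_length R L M \<le> ideal_length R L M"
    using ideal_length_add[OF assms(1-5)] assms(6) by simp
  ultimately show False using assms(7)
    by (cases "ideal_length R L M"; cases "ideal_length R K L") (auto simp: one_enat_def)
qed

lemma (in ring) ideal_length_eq_imp':
  assumes "ideal K R" "ideal L R" "ideal M R" "K \<subseteq> L" "L \<subseteq> M"
    and "ideal_length R K M \<le> ideal_length R K L" "ideal_length R K L \<noteq> \<infinity>"
  shows "L = M"
proof (rule ccontr)
  assume "L \<noteq> M"
  then have "1 \<le> ideal_length R L M" using assms ideal_length_pos by blast
  moreover have "ideal_length R K L + ideal_length R L M \<le> ideal_length R K L"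
    using ideal_length_add[OF assms(1-5)] assms(6) by simp
  ultimately show False using assms(7)
    by (cases "ideal_length R L M"; cases "ideal_length R K L") (auto simp: one_enat_def)
qed

text \<open>Multiplication by \<open>x\<close> maps \<open>L\<close> onto \<open>(xL + K)/K\<close>,
  so taking preimages is strictly monotone on the ideals in between. Besides exact scaling by a
  nonzerodivisor, this serves to estimate the kernel of multiplication by the initial form of
  \<open>x\<close>.\<close>

lemma (in cring) ideal_length_vimage_le:
  assumes "ideal K R" "ideal L R" "x \<in> carrier R" "K \<subseteq> (\<otimes>) x ` L <+> K"
  shows "ideal_length R K ((\<otimes>) x ` L <+> K) \<le> ideal_length R {a \<in> L. x \<otimes> a \<in> K} L"
proof (rule ideal_length_le_map[where f = "\<lambda>J. {a \<in> L. x \<otimes> a \<in> J}"])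
  fix J assume J: "ideal J R" "K \<subseteq> J"
  have "ideal {a \<in> L. x \<otimes> a \<in> J} R"
  proof (rule idealI')
    show "{a \<in> L. x \<otimes> a \<in> J} \<subseteq> carrier R" using ideal_subset assms by auto
    show "\<zero> \<in> {a \<in> L. x \<otimes> a \<in> J}" using ideal_zero assms J by auto
    show "a \<oplus> b \<in> {a \<in> L. x \<otimes> a \<in> J}" if "a \<in> {a \<in> L. x \<otimes> a \<in> J}" "b \<in> {a \<in> L. x \<otimes> a \<in> J}" for a b
      using that ideal_add_closed assms J ideal_subset[OF assms(2)] by (auto simp: r_distr subset_iff)
    show "c \<otimes> a \<in> {a \<in> L. x \<otimes> a \<in> J}" if "a \<in> {a \<in> L. x \<otimes> a \<in> J}" "c \<in> carrier R" for a c
      using that assms J ideal.I_l_closed ideal_subset[OF assms(2)]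
      by (auto simp: m_lcomm[of x c] subset_iff)
  qed
  then show "ideal {a \<in> L. x \<otimes> a \<in> J} R \<and> {a \<in> L. x \<otimes> a \<in> K} \<subseteq> {a \<in> L. x \<otimes> a \<in> J}
      \<and> {a \<in> L. x \<otimes> a \<in> J} \<subseteq> L" using J by auto
next
  fix J J' assume J: "ideal J R" "ideal J' R" "K \<subseteq> J" "J \<subset> J'" "J' \<subseteq> (\<otimes>) x ` L <+> K"
  then obtain b where b: "b \<in> J'" "b \<notin> J" by blast
  then obtain a k where ak: "a \<in> L" "k \<in> K" "b = x \<otimes> a \<oplus> k"
    using J(5) unfolding mem_ideal_add subset_iff by blast
  have c: "a \<in> carrier R" "k \<in> carrier R"
    using ak ideal.Icarr[OF assms(2)] ideal.Icarr[OF assms(1)] by auto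
  then have "x \<otimes> a = b \<ominus> k" using ak assms(3) by (simp add: a_minus_def a_assoc r_neg)
  moreover have k: "k \<in> J" "k \<in> J'" using ak(2) J(3,4) by auto
  ultimately have "x \<otimes> a \<in> J'" using b(1) ideal_diff_closed[OF J(2)] by simp
  moreover have "x \<otimes> a \<notin> J" using ak(3) b(2) k ideal_add_closed[OF J(1)] by auto
  ultimately show "{a \<in> L. x \<otimes> a \<in> J} \<subset> {a \<in> L. x \<otimes> a \<in> J'}" using ak(1) J by blast
qed

lemma (in cring) ideal_length_scale:
  assumes "ideal K R" "ideal L R" "K \<subseteq> L" "nonzerodiv R x"
  shows "ideal_length R ((\<otimes>) x ` K) ((\<otimes>) x ` L) = ideal_length R K L"
proof (rule antisym)
  have x: "x \<in> carrier R" using assms by (simp add: nonzerodiv_def)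
  have i: "ideal ((\<otimes>) x ` K) R" "ideal ((\<otimes>) x ` L) R" using assms x by auto
  have s: "(\<otimes>) x ` K \<subseteq> (\<otimes>) x ` L" using assms by blast
  have "(\<otimes>) x ` L <+> (\<otimes>) x ` K = (\<otimes>) x ` L"
    using ideal_add_least[OF i(2) order_refl s] ideal_add_upper1[OF i(2,1)] by blast
  moreover have "{a \<in> L. x \<otimes> a \<in> (\<otimes>) x ` K} = K"
    using nonzerodiv_scale_mem_iff[OF assms(4) ideal_subset[OF assms(1)]] ideal_subset[OF assms(2)] assms(3)
    by (auto simp: subset_iff)
  ultimately show "ideal_length R ((\<otimes>) x ` K) ((\<otimes>) x ` L) \<le> ideal_length R K L"
    using ideal_length_vimage_le[OF i(1) assms(2) x] s by simp
  show "ideal_length R K L \<le> ideal_length R ((\<otimes>) x ` K) ((\<otimes>) x ` L)"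
  proof (rule ideal_length_le_map[where f = "\<lambda>J. (\<otimes>) x ` J"])
    fix J J' assume J: "ideal J R" "ideal J' R" "J \<subset> J'"
    note s = ideal_subset[OF J(1)] ideal_subset[OF J(2)]
    show "(\<otimes>) x ` J \<subset> (\<otimes>) x ` J'"
      using J(3) nonzerodiv_scale_subset_iff[OF assms(4) s] nonzerodiv_scale_subset_iff[OF assms(4) s(2,1)]
      unfolding psubset_eq by blast
  qed (use x in auto)
qed

text \<open>Every element of the factor ring is the class of a scalar, so submodules of
  \<open>quot_module\<close> are exactly the ideals of the factor ring; the correspondence theorem
  turns these into ideals above \<open>J\<close>.\<close>

lemma (in cring) quot_length_eq:
  assumes "ideal J R" shows "quot_length R J = ideal_length R J (carrier R)"
proof -
  let ?M = "quot_module R J"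
  interpret J: ideal J R by fact
  interpret Q: cring "R Quot J" by (rule J.quotient_is_cring[OF is_cring])
  have M: "carrier ?M = carrier (R Quot J)" "add ?M = add (R Quot J)" "\<zero>\<^bsub>?M\<^esub> = \<zero>\<^bsub>R Quot J\<^esub>"
    "\<And>a c. a \<odot>\<^bsub>?M\<^esub> c = (J +> a) \<otimes>\<^bsub>R Quot J\<^esub> c"
    by (simp_all add: quot_module_def ring.defs)
  have hc: "J +> a \<in> carrier (R Quot J)" if "a \<in> carrier R" for a
    using J.rcos_ring_hom that by (auto simp: ring_hom_def)
  have surj: "\<exists>a\<in>carrier R. c = J +> a" if "c \<in> carrier (R Quot J)" for c
    using that by (auto simp: FactRing_simps A_RCOSETS_def')
  have "m_inv (add_monoid ?M) = m_inv (add_monoid (R Quot J))"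
    by (simp add: m_inv_def fun_eq_iff M)
  then have sg: "subgroup N (add_monoid ?M) \<longleftrightarrow> subgroup N (add_monoid (R Quot J))" for N
    by (simp add: subgroup_def M)
  have sub: "submodule N R ?M \<longleftrightarrow> ideal N (R Quot J)" for N
  proof
    assume "submodule N R ?M"
    then have N: "subgroup N (add_monoid (R Quot J))"
      "\<And>a x. a \<in> carrier R \<Longrightarrow> x \<in> N \<Longrightarrow> (J +> a) \<otimes>\<^bsub>R Quot J\<^esub> x \<in> N"
      unfolding submodule_def submodule_axioms_def sg M(4) by blast+
    have "N \<subseteq> carrier (R Quot J)" using subgroup.subset[OF N(1)] by simp
    then show "ideal N (R Quot J)"
      using N surj Q.m_comm by (intro idealI Q.ring_axioms) (metis subsetD)+
  next
    assume N: "ideal N (R Quot J)"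
    then have "subgroup N (add_monoid (R Quot J))"
      by (rule additive_subgroup.a_subgroup[OF ideal.axioms(1)])
    then show "submodule N R ?M"
      unfolding submodule_def submodule_axioms_def sg M(4) using ideal.I_l_closed[OF N] hc by blast
  qed
  note bij = quot_ideal_correspondence[OF assms]
  have "(\<exists>N. (\<forall>i\<le>n. submodule (N i) R ?M) \<and> (\<forall>i<n. N i \<subset> N (Suc i)))
     \<longleftrightarrow> (\<exists>N. ideal_chain R J (carrier R) n N)" for n :: nat
  proof
    assume "\<exists>N. (\<forall>i\<le>n. submodule (N i) R ?M) \<and> (\<forall>i<n. N i \<subset> N (Suc i))"
    then obtain N where N: "\<And>i. i \<le> n \<Longrightarrow> ideal (N i) (R Quot J)" "\<And>i. i < n \<Longrightarrow> N i \<subset> N (Suc i)"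
      unfolding sub by blast
    have "ideal_chain R J (carrier R) n (\<lambda>i. \<Union> (N i))"
      unfolding ideal_chain_def
    proof (intro conjI allI impI)
      fix i assume i: "i \<le> n"
      show "ideal (\<Union> (N i)) R" using quot_ideal_imp_ring_ideal[OF assms N(1)[OF i]] .
      then show "\<Union> (N i) \<subseteq> carrier R" by (rule ideal_subset)
      have "J \<in> N i" using Q.ideal_zero[OF N(1)[OF i]] by (simp add: FactRing_def)
      then show "J \<subseteq> \<Union> (N i)" by blast
    next
      fix i assume i: "i < n"
      then have s: "N i \<subseteq> carrier (R Quot J)" "N (Suc i) \<subseteq> carrier (R Quot J)"
        using N(1) Q.ideal_subset by auto
      obtain c where c: "c \<in> N (Suc i)" "c \<notin> N i" using N(2)[OF i] by blast
      then obtain a where a: "a \<in> carrier R" "c = J +> a" using s surj by blast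
      have "a \<in> \<Union> (N (Suc i))" "a \<notin> \<Union> (N i)"
        using canonical_proj_vimage_mem_iff[OF assms _ a(1)] s c a by auto
      then show "\<Union> (N i) \<subset> \<Union> (N (Suc i))" using N(2)[OF i] by blast
    qed
    then show "\<exists>N. ideal_chain R J (carrier R) n N" by blast
  next
    assume "\<exists>N. ideal_chain R J (carrier R) n N"
    then obtain N where N: "ideal_chain R J (carrier R) n N" by blast
    let ?N = "\<lambda>i. (+>) J ` N i"
    have "submodule (?N i) R ?M" if "i \<le> n" for i
      unfolding sub using N that assms ring_ideal_imp_quot_ideal unfolding ideal_chain_def by blast
    moreover have "?N i \<subset> ?N (Suc i)" if i: "i < n" for i
    proof
      have Ni: "N i \<in> {K. ideal K R \<and> J \<subseteq> K}" "N (Suc i) \<in> {K. ideal K R \<and> J \<subseteq> K}" "N i \<subset> N (Suc i)"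
        using N i by (auto simp: ideal_chain_def)
      then show "?N i \<subseteq> ?N (Suc i)" by blast
      show "?N i \<noteq> ?N (Suc i)"
        using Ni inj_onD[OF bij_betw_imp_inj_on[OF bij] _ Ni(1,2)] by auto
    qed
    ultimately show "\<exists>N. (\<forall>i\<le>n. submodule (N i) R ?M) \<and> (\<forall>i<n. N i \<subset> N (Suc i))"
      by (intro exI[of _ ?N] conjI allI impI)
  qed
  then show ?thesis unfolding quot_length_def module_length_def ideal_length_def by simp
qed



section \<open>Prime ideals, depth and height\<close>

text \<open>One use of Zorn's lemma for two purposes: a multiplicative set \<open>S\<close> yields
  prime ideals, and \<open>S = {1}\<close> yields maximal ideals.\<close>

lemma (in cring) exists_ideal_maximal_avoiding:
  assumes "ideal J R" "J \<inter> S = {}"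
  shows "\<exists>P. ideal P R \<and> J \<subseteq> P \<and> P \<inter> S = {} \<and> (\<forall>Q. ideal Q R \<longrightarrow> P \<subseteq> Q \<longrightarrow> Q \<inter> S = {} \<longrightarrow> Q = P)"
proof -
  let ?A = "{K. ideal K R \<and> J \<subseteq> K \<and> K \<inter> S = {}}"
  have "\<exists>M\<in>?A. \<forall>N\<in>?A. M \<subseteq> N \<longrightarrow> N = M"
  proof (rule subset_Zorn)
    fix C assume C: "subset.chain ?A C"
    show "\<exists>U\<in>?A. \<forall>N\<in>C. N \<subseteq> U"
    proof (cases "C = {}")
      case True then show ?thesis using assms by auto
    next
      case False
      have CA: "C \<subseteq> ?A" using C unfolding pred_on.chain_def by (rule conjunct1)
      have "subset.chain {I. ideal I R} C" using C CA unfolding pred_on.chain_def by auto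
      then have "ideal (\<Union>C) R" using chain_Union_is_ideal[of C] False by simp
      moreover obtain K where "K \<in> C" using False by blast
      then have "J \<subseteq> \<Union>C" using CA by auto
      moreover have "\<Union>C \<inter> S = {}" using CA by auto
      ultimately show ?thesis by (intro bexI[of _ "\<Union>C"]) auto
    qed
  qed
  then obtain M where M: "M \<in> ?A" "\<forall>N\<in>?A. M \<subseteq> N \<longrightarrow> N = M" by (rule bexE)
  have "Q = M" if "ideal Q R" "M \<subseteq> Q" "Q \<inter> S = {}" for Q
    using M(2)[rule_format, of Q] M(1) that by auto
  then show ?thesis using M(1) by (intro exI[of _ M]) simp
qed

lemma (in cring) exists_prime_avoiding:
  assumes "ideal J R" "J \<inter> S = {}" "\<one> \<in> S" "S \<subseteq> carrier R"
    and S: "\<And>s t. s \<in> S \<Longrightarrow> t \<in> S \<Longrightarrow> s \<otimes> t \<in> S"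
  shows "\<exists>P. primeideal P R \<and> J \<subseteq> P \<and> P \<inter> S = {}"
proof -
  obtain P where P: "ideal P R" "J \<subseteq> P" "P \<inter> S = {}"
    and max: "\<And>Q. ideal Q R \<Longrightarrow> P \<subseteq> Q \<Longrightarrow> Q \<inter> S = {} \<Longrightarrow> Q = P"
    using exists_ideal_maximal_avoiding[OF assms(1,2)] by blast
  \<comment> \<open>By maximality of \<open>P\<close>, the ideal \<open>P + (a)\<close> meets
    \<open>S\<close> as soon as \<open>a\<close> is outside \<open>P\<close>.\<close>
  have hit: "\<exists>p\<in>P. \<exists>r\<in>carrier R. p \<oplus> r \<otimes> a \<in> S" if a: "a \<in> carrier R" "a \<notin> P" for a
  proof -
    have I: "ideal (P <+> PIdl a) R" using add_ideals P(1) cgenideal_ideal[OF a(1)] by blast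
    have "P \<subseteq> P <+> PIdl a" "a \<in> P <+> PIdl a"
      using ideal_add_upper1[OF P(1) cgenideal_ideal[OF a(1)]]
        ideal_add_upper2[OF P(1) cgenideal_ideal[OF a(1)]] cgenideal_self[OF a(1)] by auto
    then have "(P <+> PIdl a) \<inter> S \<noteq> {}" using max[OF I] a(2) by auto
    then obtain s where "s \<in> S" "s \<in> P <+> PIdl a" by blast
    then obtain p q where pq: "p \<in> P" "q \<in> PIdl a" "s = p \<oplus> q" by (auto simp: mem_ideal_add)
    then obtain r where "r \<in> carrier R" "q = r \<otimes> a" by (auto simp: mem_cgenideal)
    then show ?thesis using pq \<open>s \<in> S\<close> by auto
  qed
  have "primeideal P R"
  proof (rule primeidealI[OF P(1) is_cring])
    show "carrier R \<noteq> P" using P(3) assms(3,4) by auto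
    fix a b assume a: "a \<in> carrier R" "b \<in> carrier R" "a \<otimes> b \<in> P"
    show "a \<in> P \<or> b \<in> P"
    proof (rule ccontr)
      assume "\<not> ?thesis"
      then obtain p r q t where pr: "p \<in> P" "r \<in> carrier R" "p \<oplus> r \<otimes> a \<in> S"
        "q \<in> P" "t \<in> carrier R" "q \<oplus> t \<otimes> b \<in> S" using hit[OF a(1)] hit[OF a(2)] by blast
      have pc: "p \<in> carrier R" "q \<in> carrier R" using pr ideal.Icarr[OF P(1)] by auto
      \<comment> \<open>The product of the two elements of \<open>S\<close> differs from a multiple
        of \<open>a b\<close> by elements of \<open>P\<close>; if \<open>a b\<close> were in
        \<open>P\<close>, this product would be a common element of \<open>P\<close> and
        \<open>S\<close>.\<close>
      have "(p \<oplus> r \<otimes> a) \<otimes> (q \<oplus> t \<otimes> b)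
          = (q \<oplus> t \<otimes> b) \<otimes> p \<oplus> ((r \<otimes> a) \<otimes> q \<oplus> (r \<otimes> t) \<otimes> (a \<otimes> b))"
        using pc pr(2,5) a(1,2) by algebra
      also have "\<dots> \<in> P"
      proof (intro ideal_add_closed[OF P(1)])
        show "(q \<oplus> t \<otimes> b) \<otimes> p \<in> P" using ideal.I_l_closed[OF P(1) pr(1)] pc pr a by simp
        show "(r \<otimes> a) \<otimes> q \<in> P" using ideal.I_l_closed[OF P(1) pr(4)] pr a by simp
        show "(r \<otimes> t) \<otimes> (a \<otimes> b) \<in> P" using ideal.I_l_closed[OF P(1) a(3)] pr by simp
      qed
      finally show False using S[OF pr(3,6)] P(3) by blast
    qed
  qed
  then show ?thesis using P by blast
qed

lemma (in cring) exists_maximalideal: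
  assumes "ideal J R" "J \<noteq> carrier R"
  shows "\<exists>M. maximalideal M R \<and> J \<subseteq> M"
proof -
  have "\<one> \<notin> J" using assms ideal_eq_carrier by blast
  then obtain P where P: "ideal P R" "J \<subseteq> P" "P \<inter> {\<one>} = {}"
    and max: "\<And>Q. ideal Q R \<Longrightarrow> P \<subseteq> Q \<Longrightarrow> Q \<inter> {\<one>} = {} \<Longrightarrow> Q = P"
    using exists_ideal_maximal_avoiding[OF assms(1), of "{\<one>}"] by blast
  have "maximalideal P R"
  proof (rule maximalidealI[OF P(1)])
    show "carrier R \<noteq> P" using P(3) by auto
    show "K = P \<or> K = carrier R" if "ideal K R" "P \<subseteq> K" for K
      using max[OF that] ideal_eq_carrier[OF that(1)] by auto
  qed
  then show ?thesis using P(2) by blast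
qed

text \<open>A prime minimal over \<open>J\<close> contains no nonzerodivisor modulo
  \<open>J\<close>. Instead of localising, a prime is chosen that avoids all \<open>x^n t\<close>
  with \<open>t\<close> outside \<open>P\<close>: the elements with \<open>n = 0\<close> force it
  into \<open>P\<close>, and \<open>x\<close> itself, with \<open>n = 1\<close> and
  \<open>t = 1\<close>, is omitted.\<close>

lemma (in cring) exists_prime_strictly_below:
  assumes P: "primeideal P R" and J: "ideal J R" "J \<subseteq> P" and x: "x \<in> P"
    and reg: "\<And>r. r \<in> carrier R \<Longrightarrow> x \<otimes> r \<in> J \<Longrightarrow> r \<in> J"
  shows "\<exists>Q. primeideal Q R \<and> J \<subseteq> Q \<and> Q \<subset> P"
proof -
  interpret P: primeideal P R by fact
  have xc: "x \<in> carrier R" using x by (rule P.Icarr)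
  let ?S = "{x [^] n \<otimes> t | (n::nat) t. t \<in> carrier R - P}"
  have powreg: "x [^] (n::nat) \<otimes> r \<in> J \<Longrightarrow> r \<in> carrier R \<Longrightarrow> r \<in> J" for n r
  proof (induct n)
    case (Suc n)
    have "x \<otimes> (x [^] n \<otimes> r) \<in> J" using Suc(2,3) xc by (simp add: m_assoc m_lcomm)
    then show ?case using reg[of "x [^] n \<otimes> r"] Suc xc by simp
  qed simp
  have one: "\<one> \<notin> P" using ideal_eq_carrier[OF P.is_ideal] P.I_notcarr by auto
  have "\<exists>Q. primeideal Q R \<and> J \<subseteq> Q \<and> Q \<inter> ?S = {}"
  proof (rule exists_prime_avoiding[OF J(1)])
    show "J \<inter> ?S = {}" using powreg J(2) by blast
    show "\<one> \<in> ?S" using one by (auto intro!: exI[of _ "0::nat"] exI[of _ \<one>])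
    show "?S \<subseteq> carrier R" using xc by auto
    fix s t assume "s \<in> ?S" "t \<in> ?S"
    then obtain i j u v where "s = x [^] (i::nat) \<otimes> u" "t = x [^] (j::nat) \<otimes> v"
      and uv: "u \<in> carrier R - P" "v \<in> carrier R - P" by blast
    then have "s \<otimes> t = x [^] (i + j) \<otimes> (u \<otimes> v)"
      using xc by (simp add: nat_pow_mult[symmetric] m_ac)
    moreover have "u \<otimes> v \<in> carrier R - P" using uv P.I_prime[of u v] by auto
    ultimately show "s \<otimes> t \<in> ?S" by blast
  qed
  then obtain Q where Q: "primeideal Q R" "J \<subseteq> Q" "Q \<inter> ?S = {}" by blast
  interpret Q: primeideal Q R by fact
  have "Q \<subseteq> P"
  proof
    fix t assume t: "t \<in> Q"
    then have tc: "t \<in> carrier R" by (rule Q.Icarr)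
    have "t = x [^] (0::nat) \<otimes> t" using tc by simp
    then show "t \<in> P" using Q(3) t tc by blast
  qed
  moreover have "x = x [^] (1::nat) \<otimes> \<one>" using xc by simp
  then have "x \<in> ?S" using one by blast
  then have "x \<notin> Q" using Q(3) by blast
  ultimately show ?thesis using Q x by blast
qed

lemma (in cring) regular_sequence_height:
  assumes P: "primeideal P R" and xs: "regular_sequence R xs" "set xs \<subseteq> P"
  shows "enat (length xs) \<le> height R P"
proof -
  let ?n = "length xs" and ?J = "\<lambda>i. Idl (set (take i xs))"
  have sub: "set (take i xs) \<subseteq> carrier R" for i
    using xs(1) set_take_subset[of i xs] unfolding regular_sequence_def by blast
  have J: "ideal (?J i) R" for i using genideal_ideal sub by simp
  \<comment> \<open>The chain of primes is built downwards from \<open>P\<close>. After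
    \<open>k\<close> steps its lowest member contains the first \<open>length xs - k\<close>
    entries, the last of which is regular modulo its predecessors and forces one more strict step
    down.\<close>
  have "k \<le> ?n \<Longrightarrow> \<exists>Q. (\<forall>i\<le>k. primeideal (Q i) R) \<and> (\<forall>i<k. Q i \<subset> Q (Suc i)) \<and> Q k = P
      \<and> ?J (?n - k) \<subseteq> Q 0" for k
  proof (induct k)
    case 0
    have "Idl (set xs) \<subseteq> P" using genideal_minimal primeideal.axioms(1)[OF P] xs(2) by blast
    then show ?case using P by (intro exI[of _ "\<lambda>_. P"]) simp
  next
    case (Suc k)
    then obtain Q where Q: "\<And>i. i \<le> k \<Longrightarrow> primeideal (Q i) R" "\<And>i. i < k \<Longrightarrow> Q i \<subset> Q (Suc i)" "Q k = P"
      "?J (?n - k) \<subseteq> Q 0" by auto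
    let ?i = "?n - Suc k"
    have i: "?i < ?n" "?n - k = Suc ?i" using Suc by auto
    have t: "set (take (Suc ?i) xs) = insert (xs ! ?i) (set (take ?i xs))"
      using i by (simp add: take_Suc_conv_app_nth)
    have "?J ?i \<subseteq> ?J (Suc ?i)"
      using subset_Idl_subset[OF sub[of "Suc ?i"], of "set (take ?i xs)"] t by auto
    then have 1: "?J ?i \<subseteq> Q 0" using Q(4) i by simp
    have 2: "xs ! ?i \<in> Q 0" using genideal_self[OF sub[of "Suc ?i"]] t Q(4) i by auto
    have 3: "r \<in> ?J ?i" if "r \<in> carrier R" "xs ! ?i \<otimes> r \<in> ?J ?i" for r
      using xs(1) i that unfolding regular_sequence_def by blast
    obtain Q' where Q': "primeideal Q' R" "?J ?i \<subseteq> Q'" "Q' \<subset> Q 0"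
      using exists_prime_strictly_below[OF Q(1)[of 0] J 1 2 3] by blast
    show ?case
    proof (intro exI[of _ "case_nat Q' Q"] conjI allI impI)
      show "primeideal (case_nat Q' Q i) R" if "i \<le> Suc k" for i
        using that Q(1) Q'(1) by (cases i) auto
      show "case_nat Q' Q i \<subset> case_nat Q' Q (Suc i)" if "i < Suc k" for i
        using that Q(2) Q'(3) by (cases i) auto
    qed (use Q(3) Q'(2) in auto)
  qed
  from this[of ?n] show ?thesis unfolding height_def by (intro Sup_upper) auto
qed

section \<open>Bounds for depth\<close>

lemma (in cring) depth_le_height:
  assumes "primeideal P R" shows "depth R P \<le> height R P"
  unfolding depth_def by (intro Sup_least) (use regular_sequence_height[OF assms] in auto)

lemma regular_sequence_hd:
  assumes "cring R" "regular_sequence R (x # xs)" shows "nonzerodiv R x"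
proof -
  interpret cring R by fact
  from assms(2) show ?thesis unfolding regular_sequence_def nonzerodiv_def
    by (auto simp: Idl_empty dest: spec[of _ 0])
qed

lemma (in cring) nonzerodiv_depth:
  assumes "nonzerodiv R x" "x \<in> P" "ideal P R" "P \<noteq> carrier R" shows "1 \<le> depth R P"
proof -
  have "Idl {x} \<subseteq> P" using genideal_minimal assms by auto
  then have "Idl {x} \<noteq> carrier R" using assms(4) ideal_subset[OF assms(3)] by blast
  then have "regular_sequence R [x]"
    using assms(1) by (auto simp: regular_sequence_def nonzerodiv_def Idl_empty)
  then show ?thesis
    unfolding depth_def one_enat_def using assms(2) by (intro Sup_upper) (auto intro!: exI[of _ "[x]"])
qed

lemma (in cring) depth_eq_0:
  assumes "z \<in> carrier R" "z \<noteq> \<zero>" "\<And>f. f \<in> P \<Longrightarrow> f \<otimes> z = \<zero>" shows "depth R P = 0"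
proof -
  have "depth R P \<le> 0"
    unfolding depth_def
  proof (rule Sup_least)
    fix e assume "e \<in> {enat (length xs) |xs. set xs \<subseteq> P \<and> regular_sequence R xs}"
    then obtain xs where xs: "e = enat (length xs)" "set xs \<subseteq> P" "regular_sequence R xs" by blast
    have "xs = []"
    proof (cases xs)
      case (Cons x ys)
      then have "nonzerodiv R x" using regular_sequence_hd[OF is_cring] xs(3) by simp
      moreover have "x \<otimes> z = \<zero>" using assms(3) xs(2) Cons by simp
      ultimately show ?thesis using assms(1,2) unfolding nonzerodiv_def by blast
    qed
    then show "e \<le> 0" using xs(1) by (simp add: zero_enat_def)
  qed
  then show ?thesis by simp
qed

section \<open>Powers of sums of ideals, and ideals nilpotent modulo another\<close>

lemma (in cring) ideal_add_pow_subset: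
  assumes "ideal J R" "ideal K R"
  shows "ideal_pow R (J <+> K) (p + q) \<subseteq> ideal_pow R J p <+> ideal_pow R K q"
proof (induct "p + q" arbitrary: p q)
  case 0
  then show ?case using ideal_add_upper1[OF oneideal oneideal] by simp
next
  case (Suc n)
  have I: "ideal (ideal_pow R J p) R" "ideal (ideal_pow R K q) R"
    "ideal (ideal_pow R J p <+> ideal_pow R K q) R" for p q
    using assms add_ideals by auto
  have JK: "ideal (ideal_pow R (J <+> K) n) R" "ideal (J <+> K) R" using assms add_ideals by auto
  show ?case
  proof (cases "p = 0 \<or> q = 0")
    case True
    then have "ideal_pow R J p <+> ideal_pow R K q = carrier R"
      using ideal_add_upper1[OF I(1)[of p] I(2)[of q]] ideal_add_upper2[OF I(1)[of p] I(2)[of q]]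
        ideal_subset[OF I(3)[of p q]] by auto
    then show ?thesis using ideal_subset[of "ideal_pow R (J <+> K) (p + q)"] JK by simp
  next
    case False
    then obtain p' q' where pq: "p = Suc p'" "q = Suc q'" by (metis not0_implies_Suc)
    have 1: "ideal_pow R (J <+> K) n \<subseteq> ideal_pow R J p' <+> ideal_pow R K q"
      "ideal_pow R (J <+> K) n \<subseteq> ideal_pow R J p <+> ideal_pow R K q'"
      using Suc(1)[of p' q] Suc(1)[of p q'] Suc(2) pq by auto
    have "(J <+> K) \<cdot> ideal_pow R (J <+> K) n \<subseteq> ideal_pow R J p <+> ideal_pow R K q"
    proof (rule ideal_prod_least[OF I(3)])
      fix a b assume a: "a \<in> J <+> K" and b: "b \<in> ideal_pow R (J <+> K) n"
      from a obtain j k where jk: "j \<in> J" "k \<in> K" "a = j \<oplus> k" by (auto simp: mem_ideal_add)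
      \<comment> \<open>The remaining factor \<open>b\<close> is decomposed in two ways: one for the
        product with \<open>j\<close>, where a power of \<open>J\<close> is missing, and one for the
        product with \<open>k\<close>, where a power of \<open>K\<close> is missing.\<close>
      have "b \<in> ideal_pow R J p' <+> ideal_pow R K q" using b 1 by blast
      then obtain u v where uv: "u \<in> ideal_pow R J p'" "v \<in> ideal_pow R K q" "b = u \<oplus> v"
        unfolding mem_ideal_add by blast
      have "b \<in> ideal_pow R J p <+> ideal_pow R K q'" using b 1 by blast
      then obtain u' v' where uv': "u' \<in> ideal_pow R J p" "v' \<in> ideal_pow R K q'" "b = u' \<oplus> v'"
        unfolding mem_ideal_add by blast
      have c: "j \<in> carrier R" "k \<in> carrier R" "u \<in> carrier R" "v \<in> carrier R" "u' \<in> carrier R" "v' \<in> carrier R"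
        using jk(1,2) uv(1,2) uv'(1,2) ideal.Icarr[OF assms(1)] ideal.Icarr[OF assms(2)]
          ideal.Icarr[OF I(1)] ideal.Icarr[OF I(2)] by auto
      have "a \<otimes> b = j \<otimes> (u \<oplus> v) \<oplus> k \<otimes> (u' \<oplus> v')"
        unfolding jk(3) uv(3)[symmetric] uv'(3)[symmetric] using c uv(3) by (simp add: l_distr)
      also have "\<dots> = (j \<otimes> u \<oplus> k \<otimes> u') \<oplus> (j \<otimes> v \<oplus> k \<otimes> v')" using c by algebra
      finally have ab: "a \<otimes> b = (j \<otimes> u \<oplus> k \<otimes> u') \<oplus> (j \<otimes> v \<oplus> k \<otimes> v')" .
      have "j \<otimes> u \<in> ideal_pow R J p" "k \<otimes> v' \<in> ideal_pow R K q"
        unfolding pq ideal_pow_Suc2[OF assms(1)] ideal_pow_Suc2[OF assms(2)]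
        using jk(1,2) uv(1) uv'(2) by (auto intro: ideal_prod.prod)
      moreover have "k \<otimes> u' \<in> ideal_pow R J p" "j \<otimes> v \<in> ideal_pow R K q"
        using c uv(2) uv'(1) by (auto intro: ideal.I_l_closed[OF I(1)] ideal.I_l_closed[OF I(2)])
      ultimately show "a \<otimes> b \<in> ideal_pow R J p <+> ideal_pow R K q"
        unfolding ab mem_ideal_add
        using ideal_add_closed[OF I(1)] ideal_add_closed[OF I(2)] by blast
    qed
    then show ?thesis using ideal_pow_Suc2[OF JK(2), of n] Suc(2) by simp
  qed
qed

lemma (in cring) cgenideal_pow_subset:
  assumes "a \<in> carrier R" shows "ideal_pow R (PIdl a) n \<subseteq> PIdl (a [^] n)"
proof (induct n)
  case 0 show ?case using cgenideal_self[of \<one>] ideal_eq_carrier[OF cgenideal_ideal[of \<one>]] by simp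
next
  case (Suc n)
  show ?case unfolding ideal_pow_Suc
  proof (rule ideal_prod_least)
    show "ideal (PIdl (a [^] Suc n)) R" using cgenideal_ideal assms by simp
    fix b c assume "b \<in> ideal_pow R (PIdl a) n" "c \<in> PIdl a"
    then obtain u v where "u \<in> carrier R" "v \<in> carrier R" "b = u \<otimes> a [^] n" "c = v \<otimes> a"
      using Suc unfolding mem_cgenideal subset_iff by blast
    then have "b \<otimes> c = (u \<otimes> v) \<otimes> a [^] Suc n" using assms by (simp add: m_ac)
    then show "b \<otimes> c \<in> PIdl (a [^] Suc n)"
      unfolding mem_cgenideal using \<open>u \<in> _\<close> \<open>v \<in> _\<close> by blast
  qed
qed

lemma (in cring) ideal_pow_subset_of_radical:
  assumes "finite S" "S \<subseteq> carrier R" "ideal J R" "\<And>a. a \<in> S \<Longrightarrow> \<exists>n::nat. a [^] n \<in> J"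
  shows "\<exists>n. ideal_pow R (Idl S) n \<subseteq> J"
  using assms(1,2,4)
proof (induct S)
  case empty
  have "ideal_pow R (Idl {}) 1 \<subseteq> J" using ideal_zero[OF assms(3)] zeroideal by (simp add: Idl_empty)
  then show ?case by blast
next
  case (insert a S)
  have c: "a \<in> carrier R" "S \<subseteq> carrier R" using insert by auto
  have I: "ideal (PIdl a) R" "ideal (Idl S) R" using cgenideal_ideal c genideal_ideal by auto
  obtain q where q: "ideal_pow R (Idl S) q \<subseteq> J" using insert by auto
  obtain p :: nat where p: "a [^] p \<in> J" using insert(5)[of a] by blast
  have "ideal_pow R (PIdl a) p \<subseteq> J"
    using cgenideal_pow_subset[OF c(1), of p] cgenideal_minimal[OF assms(3) p] by blast
  then have "ideal_pow R (PIdl a) p <+> ideal_pow R (Idl S) q \<subseteq> J"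
    using ideal_add_least[OF assms(3)] q by blast
  then have "ideal_pow R (Idl (insert a S)) (p + q) \<subseteq> J"
    using ideal_add_pow_subset[OF I, of p q] Idl_insert[OF c] by simp
  then show ?case by blast
qed



section \<open>Noetherian local rings\<close>

lemma enat_finite_le: "x \<le> y \<Longrightarrow> y \<noteq> \<infinity> \<Longrightarrow> x \<noteq> (\<infinity>::enat)"
  by (cases x; cases y) auto

context local_ring
begin

sublocale max: maximalideal m R by (rule maximal)

lemma m_ideal [simp, intro]: "ideal m R" by (rule max.is_ideal)

lemma ideal_subset_m:
  assumes "ideal J R" "J \<noteq> carrier R" shows "J \<subseteq> m"
  using exists_maximalideal[OF assms] unique_maximal by blast

lemma one_notin_m: "\<one> \<notin> m"
  using ideal_eq_carrier[OF m_ideal] max.I_notcarr by auto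

lemma unit_if_notin_m:
  assumes "a \<in> carrier R" "a \<notin> m" shows "\<exists>b\<in>carrier R. b \<otimes> a = \<one>"
proof -
  have "PIdl a = carrier R"
    using ideal_subset_m[OF cgenideal_ideal[OF assms(1)]] cgenideal_self[OF assms(1)] assms(2) by blast
  then have "\<one> \<in> PIdl a" by simp
  then show ?thesis by (auto simp: mem_cgenideal)
qed

lemma mem_if_unit_mult_mem:
  assumes "ideal J R" "c \<in> carrier R" "c \<notin> m" "a \<in> carrier R" "c \<otimes> a \<in> J" shows "a \<in> J"
proof -
  obtain b where b: "b \<in> carrier R" "b \<otimes> c = \<one>" using unit_if_notin_m assms by blast
  have "b \<otimes> (c \<otimes> a) \<in> J" using ideal.I_l_closed[OF assms(1,5) b(1)] .
  moreover have "b \<otimes> (c \<otimes> a) = a" using b assms by (simp add: m_assoc[symmetric])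
  ultimately show ?thesis by simp
qed

lemma primeideal_subset_m: "primeideal P R \<Longrightarrow> P \<subseteq> m"
  by (metis ideal_subset_m primeideal.I_notcarr primeideal.axioms(1))

lemma one_minus_notin_m:
  assumes "u \<in> m" shows "\<one> \<ominus> u \<notin> m"
proof
  have u: "u \<in> carrier R" using ideal.Icarr[OF m_ideal assms] .
  assume "\<one> \<ominus> u \<in> m"
  then have "(\<one> \<ominus> u) \<oplus> u \<in> m" using ideal_add_closed[OF m_ideal] assms by blast
  then show False using one_notin_m u by (simp add: a_minus_def a_assoc l_neg)
qed

text \<open>One generator \<open>s\<close> is eliminated at a time. Its coefficient \<open>w\<close>
  on the right lies in \<open>m\<close>, so \<open>1 - w\<close> is a unit and \<open>s\<close> is
  expressed through \<open>K\<close> and \<open>m\<close> times the other generators, which then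
  satisfy the same hypothesis.\<close>

lemma nakayama:
  assumes "finite S" "S \<subseteq> carrier R" "ideal K R" "Idl S \<subseteq> K <+> m \<cdot> (Idl S)"
  shows "Idl S \<subseteq> K"
  using assms(1,2,4)
proof (induct S)
  case empty
  then show ?case using ideal_zero[OF assms(3)] by (simp add: Idl_empty)
next
  case (insert s S)
  have c: "s \<in> carrier R" "S \<subseteq> carrier R" using insert by auto
  have I: "ideal (PIdl s) R" "ideal (Idl S) R" "ideal (m \<cdot> (PIdl s)) R" "ideal (m \<cdot> (Idl S)) R"
    using c cgenideal_ideal genideal_ideal ideal_prod_is_ideal by auto
  have KI: "ideal (K <+> m \<cdot> (Idl S)) R" using add_ideals assms(3) I(4) by blast
  have prod: "m \<cdot> (Idl (insert s S)) = m \<cdot> (PIdl s) <+> m \<cdot> (Idl S)"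
    unfolding Idl_insert[OF c] using ideal_prod_r_distr[OF m_ideal I(1,2)] .
  have up: "K \<subseteq> K <+> m \<cdot> (Idl S)" "m \<cdot> (Idl S) \<subseteq> K <+> m \<cdot> (Idl S)"
    using ideal_add_upper1[OF assms(3) I(4)] ideal_add_upper2[OF assms(3) I(4)] .
  have s: "s \<in> K <+> m \<cdot> (Idl S)"
  proof -
    have "s \<in> K <+> (m \<cdot> (PIdl s) <+> m \<cdot> (Idl S))"
      using insert(5) genideal_self[of "insert s S"] c unfolding prod by auto
    then obtain k w where kw: "k \<in> K" "w \<in> m \<cdot> (PIdl s) <+> m \<cdot> (Idl S)" "s = k \<oplus> w"
      by (rule mem_ideal_addE)
    from kw(2) obtain u v where "u \<in> m \<cdot> (PIdl s)" "v \<in> m \<cdot> (Idl S)" "w = u \<oplus> v"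
      by (rule mem_ideal_addE)
    with kw have kuv: "k \<in> K" "u \<in> m \<cdot> (PIdl s)" "v \<in> m \<cdot> (Idl S)" "s = k \<oplus> (u \<oplus> v)"
      by simp_all
    have "m \<cdot> (PIdl s) \<subseteq> (\<otimes>) s ` m"
    proof (rule ideal_prod_least)
      show "ideal ((\<otimes>) s ` m) R" using c(1) by auto
      fix a b assume a: "a \<in> m" and "b \<in> PIdl s"
      then obtain r where r: "r \<in> carrier R" "b = r \<otimes> s" by (auto simp: mem_cgenideal)
      have "a \<otimes> b = s \<otimes> (r \<otimes> a)" using r c(1) ideal.Icarr[OF m_ideal a] by (simp add: m_ac)
      then show "a \<otimes> b \<in> (\<otimes>) s ` m" using ideal.I_l_closed[OF m_ideal a r(1)] by blast
    qed
    then obtain w where w: "w \<in> m" "u = s \<otimes> w" using kuv(2) by blast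
    have cc: "k \<in> carrier R" "v \<in> carrier R" "w \<in> carrier R" "u \<in> carrier R"
      using ideal.Icarr[OF assms(3) kuv(1)] ideal.Icarr[OF I(4) kuv(3)] ideal.Icarr[OF m_ideal w(1)]
        ideal.Icarr[OF I(3) kuv(2)] .
    have "(\<one> \<ominus> w) \<otimes> s = s \<ominus> s \<otimes> w" using cc c(1) by algebra
    also have "\<dots> = s \<ominus> u" by (simp only: w(2))
    also have "\<dots> = (k \<oplus> (u \<oplus> v)) \<ominus> u" by (simp only: kuv(4))
    also have "\<dots> = k \<oplus> v" using cc by algebra
    also have "\<dots> \<in> K <+> m \<cdot> (Idl S)" unfolding mem_ideal_add using kuv(1,3) by blast
    finally show ?thesis using mem_if_unit_mult_mem[OF KI _ one_minus_notin_m[OF w(1)] c(1)] cc by simp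
  qed
  then have sp: "PIdl s \<subseteq> K <+> m \<cdot> (Idl S)" using cgenideal_minimal[OF KI] by blast
  have "m \<cdot> (PIdl s) \<subseteq> PIdl s" using ideal_prod_inter[OF m_ideal I(1)] by blast
  then have "K <+> (m \<cdot> (PIdl s) <+> m \<cdot> (Idl S)) \<subseteq> K <+> m \<cdot> (Idl S)"
    using sp up by (intro ideal_add_least[OF KI]) auto
  then have all: "Idl (insert s S) \<subseteq> K <+> m \<cdot> (Idl S)" using insert(5) unfolding prod by blast
  moreover have "Idl S \<subseteq> Idl (insert s S)"
    unfolding Idl_insert[OF c] by (rule ideal_add_upper2[OF I(1,2)])
  ultimately have "Idl S \<subseteq> K" using insert by blast
  then have "m \<cdot> (Idl S) \<subseteq> K" using ideal_prod_inter[OF m_ideal I(2)] by blast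
  then have "K <+> m \<cdot> (Idl S) \<subseteq> K" by (intro ideal_add_least[OF assms(3)]) auto
  then show ?case using all by blast
qed

text \<open>\<open>(K + (a))/K\<close> is cyclic and killed by \<open>m\<close>, hence a quotient of
  the residue field. Concretely, an intermediate ideal larger than \<open>K\<close> contains an
  element whose coefficient at \<open>a\<close> is a unit, and therefore \<open>a\<close>
  itself.\<close>

lemma ideal_length_insert_le:
  assumes "ideal K R" "a \<in> carrier R" "(\<otimes>) a ` m \<subseteq> K"
  shows "ideal_length R K (K <+> PIdl a) \<le> 1"
proof (rule ideal_length_leI)
  have I: "ideal (PIdl a) R" "ideal (K <+> PIdl a) R" using assms cgenideal_ideal add_ideals by auto
  fix n N assume N: "ideal_chain R K (K <+> PIdl a) n N"
  have "\<not> 1 < n"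
  proof
    assume "1 < n"
    then have n: "ideal (N 1) R" "K \<subseteq> N 0" "N 0 \<subset> N 1" "N 1 \<subset> N 2" "N 1 \<subseteq> K <+> PIdl a" "N 2 \<subseteq> K <+> PIdl a"
      using N unfolding ideal_chain_def by (auto simp: numeral_2_eq_2 Suc_leI)
    then obtain b where b: "b \<in> N 1" "b \<notin> K" by blast
    have "b \<in> K <+> PIdl a" using b(1) n(5) by (rule subsetD[rotated])
    then obtain k d where kd: "k \<in> K" "d \<in> PIdl a" "b = k \<oplus> d" by (rule mem_ideal_addE)
    from kd(2) obtain c where c: "c \<in> carrier R" "d = c \<otimes> a" by (auto simp: mem_cgenideal)
    have kc: "k \<in> K" "c \<in> carrier R" "b = k \<oplus> c \<otimes> a" using kd c by simp_all
    have k: "k \<in> carrier R" using ideal.Icarr[OF assms(1) kc(1)] .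
    have "c \<notin> m"
    proof
      assume "c \<in> m"
      then have "c \<otimes> a \<in> K" using assms(3) m_comm[OF kc(2) assms(2)] by auto
      then show False using b(2) kc(3) ideal_add_closed[OF assms(1) kc(1)] by simp
    qed
    moreover have "c \<otimes> a = b \<ominus> k" unfolding kc(3) using kc(2) k assms(2) by algebra
    then have "c \<otimes> a \<in> N 1" using ideal_diff_closed[OF n(1) b(1), of k] kc(1) n(2,3) by auto
    ultimately have "a \<in> N 1" using mem_if_unit_mult_mem[OF n(1) kc(2) _ assms(2)] by blast
    then have "PIdl a \<subseteq> N 1" by (rule cgenideal_minimal[OF n(1)])
    then have "K <+> PIdl a \<subseteq> N 1" using n by (intro ideal_add_least[OF n(1)]) auto
    then show False using n(4,6) by blast
  qed
  then show "enat n \<le> 1" by (simp add: one_enat_def)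
qed

lemma ideal_length_gen_le:
  assumes "finite S" "S \<subseteq> carrier R" "ideal K R" "\<And>a. a \<in> S \<Longrightarrow> (\<otimes>) a ` m \<subseteq> K"
  shows "ideal_length R K (K <+> Idl S) \<le> enat (card S)"
  using assms(1,2,4)
proof (induct S)
  case empty
  have "K <+> Idl {} = K"
    using ideal_add_least[OF assms(3) order_refl, of "{\<zero>}"] ideal_add_upper1[OF assms(3) zeroideal]
      ideal_zero[OF assms(3)] by (auto simp: Idl_empty)
  then show ?case by (simp add: zero_enat_def[symmetric])
next
  case (insert s S)
  have c: "s \<in> carrier R" "S \<subseteq> carrier R" using insert by auto
  have I: "ideal (PIdl s) R" "ideal (Idl S) R" using c cgenideal_ideal genideal_ideal by auto
  let ?L = "K <+> Idl S"
  have L: "ideal ?L R" "K \<subseteq> ?L" using add_ideals[OF assms(3) I(2)] ideal_add_upper1[OF assms(3) I(2)] by auto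
  have LP: "ideal (?L <+> PIdl s) R" "?L \<subseteq> ?L <+> PIdl s"
    using add_ideals[OF L(1) I(1)] ideal_add_upper1[OF L(1) I(1)] by auto
  have "K <+> Idl (insert s S) \<subseteq> ?L <+> PIdl s"
    unfolding Idl_insert[OF c]
    using L LP ideal_add_upper2[OF L(1) I(1)] ideal_add_upper2[OF assms(3) I(2)]
    by (intro ideal_add_least[OF LP(1)] ) auto
  then have "ideal_length R K (K <+> Idl (insert s S)) \<le> ideal_length R K (?L <+> PIdl s)"
    by (rule ideal_length_antimono[OF order_refl])
  also have "\<dots> = ideal_length R K ?L + ideal_length R ?L (?L <+> PIdl s)"
    using ideal_length_add[OF assms(3) L(1) LP(1) L(2) LP(2)] .
  also have "\<dots> \<le> enat (card S) + 1"
  proof (rule add_mono)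
    show "ideal_length R K ?L \<le> enat (card S)" using insert by auto
    show "ideal_length R ?L (?L <+> PIdl s) \<le> 1"
      using ideal_length_insert_le[OF L(1) c(1)] insert(5)[of s] L(2) by auto
  qed
  finally show ?case using insert by (simp add: one_enat_def)
qed

end

locale noetherian_local_ring = local_ring + noetherian_ring
begin

lemma nakayama':
  assumes "ideal J R" "ideal K R" "J \<subseteq> K <+> m \<cdot> J" shows "J \<subseteq> K"
  using finetely_gen[OF assms(1)] nakayama[OF _ _ assms(2)] assms(3) by auto

section \<open>Finiteness of lengths and minimal numbers of generators\<close>

lemma ideal_length_mult_m_finite:
  assumes "ideal J R" shows "ideal_length R (m \<cdot> J) J \<noteq> \<infinity>"
proof -
  obtain S where S: "S \<subseteq> carrier R" "finite S" "J = Idl S" using finetely_gen[OF assms] by blast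
  have mJ: "ideal (m \<cdot> J) R" using ideal_prod_is_ideal assms by blast
  have "(\<otimes>) a ` m \<subseteq> m \<cdot> J" if "a \<in> S" for a
  proof -
    have "a \<in> J" using that S genideal_self by blast
    then show ?thesis
      using ideal_prod.prod[of _ m a J R] m_comm ideal.Icarr[OF m_ideal] ideal.Icarr[OF assms] by auto
  qed
  then have "ideal_length R (m \<cdot> J) (m \<cdot> J <+> J) \<le> enat (card S)"
    using ideal_length_gen_le[OF S(2,1) mJ] S(3) by simp
  moreover have "m \<cdot> J <+> J = J"
    using ideal_add_absorb[OF mJ assms] ideal_prod_inter[OF m_ideal assms] by blast
  ultimately show ?thesis using enat_finite_le[of _ "enat (card S)"] by simp
qed

lemma ideal_length_pow_finite: "ideal_length R (ideal_pow R m k) (carrier R) \<noteq> \<infinity>"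
proof (induct k)
  case (Suc k)
  have "ideal_length R (ideal_pow R m (Suc k)) (carrier R)
      = ideal_length R (ideal_pow R m (Suc k)) (ideal_pow R m k) + ideal_length R (ideal_pow R m k) (carrier R)"
    using ideal_length_add[of "ideal_pow R m (Suc k)" "ideal_pow R m k" "carrier R"]
      ideal_pow_Suc_subset[of m k] oneideal ideal_subset[of "ideal_pow R m k"] by auto
  moreover have "ideal_length R (ideal_pow R m (Suc k)) (ideal_pow R m k) \<noteq> \<infinity>"
    using ideal_length_mult_m_finite[of "ideal_pow R m k"] by (simp add: ideal_pow_Suc2)
  ultimately show ?case using Suc by (simp only: plus_eq_infty_iff_enat simp_thms)
qed simp

lemma ideal_length_finite:
  assumes "ideal_pow R m k \<subseteq> J" "L \<subseteq> carrier R" shows "ideal_length R J L \<noteq> \<infinity>"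
  using ideal_length_antimono[OF assms, of R] ideal_length_pow_finite[of k] by (rule enat_finite_le)

lemma min_gens_eq:
  assumes "ideal J R" shows "enat (min_gens R J) = ideal_length R (m \<cdot> J) J"
proof -
  let ?P = "\<lambda>n. \<exists>S\<subseteq>carrier R. finite S \<and> card S = n \<and> Idl S = J"
  have mJ: "ideal (m \<cdot> J) R" "m \<cdot> J \<subseteq> J" using ideal_prod_is_ideal ideal_prod_inter assms by auto
  have "\<exists>n. ?P n" using finetely_gen[OF assms] by blast
  then have "?P (min_gens R J)" unfolding min_gens_def by (rule LeastI_ex)
  then obtain S where S: "S \<subseteq> carrier R" "finite S" "card S = min_gens R J" "Idl S = J" by blast
  have least: "min_gens R J \<le> card T" if "T \<subseteq> carrier R" "finite T" "Idl T = J" for T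
    unfolding min_gens_def by (rule Least_le) (use that in blast)
  have SJ: "S \<subseteq> J" using S genideal_self by blast
  have "(\<otimes>) a ` m \<subseteq> m \<cdot> J" if "a \<in> S" for a
    using that SJ ideal_prod.prod[of _ m a J R] m_comm ideal.Icarr[OF m_ideal] ideal.Icarr[OF assms] by auto
  then have "ideal_length R (m \<cdot> J) (m \<cdot> J <+> J) \<le> enat (card S)"
    using ideal_length_gen_le[OF S(2,1) mJ(1)] S(4) by simp
  moreover have "m \<cdot> J <+> J = J" using ideal_add_absorb[OF mJ(1) assms mJ(2)] .
  ultimately have 1: "ideal_length R (m \<cdot> J) J \<le> enat (min_gens R J)" using S(3) by simp
  obtain xs where xs: "set xs = S" "distinct xs" using finite_distinct_list S(2) by blast
  have len: "length xs = min_gens R J" using xs S(3) distinct_card by fastforce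
  let ?N = "\<lambda>i. m \<cdot> J <+> Idl (set (take i xs))"
  have tc: "set (take i xs) \<subseteq> carrier R" for i using xs S(1) set_take_subset[of i xs] by auto
  have "ideal_chain R (m \<cdot> J) J (length xs) ?N"
    unfolding ideal_chain_def
  proof (intro conjI allI impI)
    fix i
    have I: "ideal (Idl (set (take i xs))) R" for i using genideal_ideal tc by simp
    show "ideal (?N i) R" "m \<cdot> J \<subseteq> ?N i"
      using add_ideals[OF mJ(1) I] ideal_add_upper1[OF mJ(1) I] by auto
    show "?N i \<subseteq> J"
      using mJ(2) SJ xs set_take_subset[of i xs]
      by (intro ideal_add_least[OF assms] genideal_minimal[OF assms]) auto
    assume i: "i < length xs"
    then have t: "set (take (Suc i) xs) = insert (xs ! i) (set (take i xs))"
      by (simp add: take_Suc_conv_app_nth)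
    have "Idl (set (take i xs)) \<subseteq> Idl (set (take (Suc i) xs))"
      by (rule subset_Idl_subset[OF tc]) (auto simp: t)
    then have le: "?N i \<subseteq> ?N (Suc i)" by (intro ideal_add_mono) auto
    have "xs ! i \<in> Idl (set (take (Suc i) xs))" using genideal_self[OF tc] t by blast
    then have mem: "xs ! i \<in> ?N (Suc i)" using ideal_add_upper2[OF mJ(1) I] by blast
    have "xs ! i \<notin> ?N i"
    proof
      assume x: "xs ! i \<in> ?N i"
      let ?T = "S - {xs ! i}"
      have T: "?T \<subseteq> carrier R" "finite ?T" using S by auto
      have IT: "ideal (Idl ?T) R" using genideal_ideal T by simp
      have "set (take i xs) \<subseteq> ?T"
        using xs i set_take_subset[of i xs] by (auto simp: in_set_conv_nth nth_eq_iff_index_eq)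
      then have "?N i \<subseteq> Idl ?T <+> m \<cdot> J"
        using subset_Idl_subset[OF T(1)] ideal_add_upper1[OF IT mJ(1)] ideal_add_upper2[OF IT mJ(1)]
        by (intro ideal_add_least[OF add_ideals[OF IT mJ(1)]]) auto
      then have "S \<subseteq> Idl ?T <+> m \<cdot> J"
        using x genideal_self[OF T(1)] ideal_add_upper1[OF IT mJ(1)] by blast
      then have "J \<subseteq> Idl ?T <+> m \<cdot> J"
        using genideal_minimal[OF add_ideals[OF IT mJ(1)]] S(4) by blast
      then have "J \<subseteq> Idl ?T" by (rule nakayama'[OF assms IT])
      moreover have "Idl ?T \<subseteq> J" using SJ by (intro genideal_minimal[OF assms]) auto
      ultimately have "min_gens R J \<le> card ?T" using least[OF T] by blast
      then show False using S(2,3) xs i by (metis card_Diff1_less nth_mem not_le)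
    qed
    then show "?N i \<subset> ?N (Suc i)" using le mem by blast
  qed
  then have "enat (min_gens R J) \<le> ideal_length R (m \<cdot> J) J"
    using ideal_length_ge len by metis
  then show ?thesis using 1 by (rule antisym)
qed

text \<open>Equality of depth and height supplies a nonzerodivisor \<open>x\<close> in
  \<open>m\<close>. If some \<open>a\<close> in \<open>m\<close> had no power in \<open>(x)\<close>,
  a prime over \<open>(x)\<close> avoiding the powers of \<open>a\<close> would lie strictly below
  \<open>m\<close>; since it contains the nonzerodivisor \<open>x\<close>, another prime lies
  strictly below it, against dimension one.\<close>

lemma exists_parameter:
  assumes "krull_dim R = 1" "depth R m = height R m"
  shows "\<exists>x k. x \<in> m \<and> nonzerodiv R x \<and> ideal_pow R m k \<subseteq> PIdl x"
proof -
  have noch: "\<not> (primeideal P R \<and> primeideal Q R \<and> primeideal T R \<and> P \<subset> Q \<and> Q \<subset> T)" for P Q T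
  proof
    assume *: "primeideal P R \<and> primeideal Q R \<and> primeideal T R \<and> P \<subset> Q \<and> Q \<subset> T"
    let ?N = "\<lambda>i::nat. if i = 0 then P else if i = 1 then Q else T"
    have "primeideal (?N i) R" for i using * by simp
    moreover have "?N i \<subset> ?N (Suc i)" if "i < 2" for i
      using * that by (cases "i = 0") simp_all
    ultimately have "enat 2 \<le> krull_dim R"
      unfolding krull_dim_def by (intro Sup_upper CollectI exI[of _ "2::nat"] conjI refl exI[of _ ?N] allI impI)
    then show False using assms(1) by (simp add: one_enat_def)
  qed
  have mp: "primeideal m R" using maximalideal_prime maximal by blast
  have "\<exists>P Q. primeideal P R \<and> primeideal Q R \<and> P \<subset> Q"
  proof (rule ccontr)
    assume no: "\<not> ?thesis"
    have "krull_dim R \<le> 0"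
      unfolding krull_dim_def
    proof (rule Sup_least)
      fix e assume "e \<in> {enat n |n. \<exists>P. (\<forall>i\<le>n. primeideal (P i) R) \<and> (\<forall>i<n. P i \<subset> P (Suc i))}"
      then obtain n P where P: "e = enat n" "\<forall>i\<le>n. primeideal (P i) R" "\<forall>i<n. P i \<subset> P (Suc i)" by blast
      have "n = 0"
      proof (rule ccontr)
        assume "n \<noteq> 0"
        then have "P 0 \<subset> P (Suc 0)" "primeideal (P 0) R" "primeideal (P (Suc 0)) R" using P by auto
        then show False using no by blast
      qed
      then show "e \<le> 0" using P(1) by (simp add: zero_enat_def)
    qed
    then show False using assms(1) by simp
  qed
  then obtain P Q where PQ: "primeideal P R" "primeideal Q R" "P \<subset> Q" by blast
  have "enat 1 \<le> height R m"
  proof -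
    let ?N = "\<lambda>i::nat. if i = 0 then P else m"
    have "P \<subset> m" using PQ primeideal_subset_m[OF PQ(2)] by blast
    then show ?thesis unfolding height_def
      by (intro Sup_upper CollectI exI[of _ "1::nat"] conjI refl exI[of _ ?N]) (use PQ mp in auto)
  qed
  then have d: "enat 1 \<le> depth R m" using assms(2) by simp
  have "\<exists>xs. set xs \<subseteq> m \<and> regular_sequence R xs \<and> xs \<noteq> []"
  proof (rule ccontr)
    assume no: "\<not> ?thesis"
    then have "depth R m \<le> 0" unfolding depth_def by (intro Sup_least) (auto simp: zero_enat_def)
    with d have "enat 1 \<le> 0" by (rule order_trans)
    then show False by (simp add: zero_enat_def)
  qed
  then obtain x xs where x: "set (x # xs) \<subseteq> m" "regular_sequence R (x # xs)" by (metis list.exhaust)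
  then have nz: "nonzerodiv R x" and xm: "x \<in> m" using regular_sequence_hd[OF is_cring] by auto
  then have xc: "x \<in> carrier R" by (simp add: nonzerodiv_def)
  have I: "ideal (PIdl x) R" using cgenideal_ideal xc .
  have rad: "\<exists>n::nat. a [^] n \<in> PIdl x" if a: "a \<in> m" for a
  proof (rule ccontr)
    assume no: "\<not> ?thesis"
    have ac: "a \<in> carrier R" using ideal.Icarr[OF m_ideal a] .
    have "\<exists>P. primeideal P R \<and> PIdl x \<subseteq> P \<and> P \<inter> range (\<lambda>n::nat. a [^] n) = {}"
    proof (rule exists_prime_avoiding[OF I])
      show "PIdl x \<inter> range (\<lambda>n::nat. a [^] n) = {}" using no by blast
      show "\<one> \<in> range (\<lambda>n::nat. a [^] n)" by (metis nat_pow_0 rangeI)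
      show "range (\<lambda>n::nat. a [^] n) \<subseteq> carrier R" using ac by auto
      show "s \<otimes> t \<in> range (\<lambda>n::nat. a [^] n)"
        if "s \<in> range (\<lambda>n::nat. a [^] n)" "t \<in> range (\<lambda>n::nat. a [^] n)" for s t
        using that ac by (auto simp: nat_pow_mult intro!: rangeI)
    qed
    then obtain P where P: "primeideal P R" "PIdl x \<subseteq> P" "P \<inter> range (\<lambda>n::nat. a [^] n) = {}" by blast
    have "a = a [^] (1::nat)" using ac by simp
    then have "a \<notin> P" using P(3) by blast
    then have "P \<subset> m" using primeideal_subset_m[OF P(1)] a by blast
    moreover have "x \<in> P" using cgenideal_self[OF xc] P(2) by blast
    then obtain Q where "primeideal Q R" "Q \<subset> P"
      using exists_prime_strictly_below[OF P(1) zeroideal] nz ideal_zero[OF primeideal.axioms(1)[OF P(1)]]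
      unfolding nonzerodiv_def by blast
    ultimately show False using noch P(1) mp by blast
  qed
  obtain S where S: "S \<subseteq> carrier R" "finite S" "m = Idl S" using finetely_gen[OF m_ideal] by blast
  have "S \<subseteq> m" using S genideal_self by blast
  then have "\<exists>k. ideal_pow R m k \<subseteq> PIdl x"
    using ideal_pow_subset_of_radical[OF S(2,1) I] rad S(3) by blast
  then show ?thesis using nz xm by blast
qed

lemma radical_pow:
  assumes "ideal J R" "radical R J = m" shows "\<exists>k. ideal_pow R m k \<subseteq> J"
proof -
  obtain S where S: "S \<subseteq> carrier R" "finite S" "m = Idl S" using finetely_gen[OF m_ideal] by blast
  have "S \<subseteq> radical R J" using S genideal_self assms(2) by blast
  then show ?thesis using ideal_pow_subset_of_radical[OF S(2,1) assms(1)] S(3) by (auto simp: radical_def)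
qed

end



section \<open>The theorem of Eakin and Sathaye\<close>

text \<open>Reductions are looked for on the curve with parametrisation
  \<open>t \<mapsto> y\<^sub>0 + t y\<^sub>1 + t\<^sup>2 y\<^sub>2 + \<dots>\<close>, where the \<open>y\<^sub>i\<close> generate the ideal: by a Vandermonde argument,
  any infinite set of its points (with parameters distinct in the residue field) generates the ideal.\<close>

fun curve :: "('a, 'b) ring_scheme \<Rightarrow> 'a list \<Rightarrow> 'a \<Rightarrow> 'a" where
  "curve R [] t = \<zero>\<^bsub>R\<^esub>"
| "curve R (y # ys) t = y \<oplus>\<^bsub>R\<^esub> t \<otimes>\<^bsub>R\<^esub> curve R ys t"

text \<open>Horner's scheme: the coefficients of the quotient of
  \<open>curve R ys t - curve R ys s\<close> by \<open>t - s\<close>, which are the proper nonempty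
  tails of \<open>ys\<close> evaluated at \<open>s\<close>.\<close>

fun divided_curve :: "('a, 'b) ring_scheme \<Rightarrow> 'a list \<Rightarrow> 'a \<Rightarrow> 'a list" where
  "divided_curve R (y # z # zs) s = curve R (z # zs) s # divided_curve R (z # zs) s"
| "divided_curve R _ s = []"

lemma (in cring) curve_mem:
  "ideal J R \<Longrightarrow> set ys \<subseteq> J \<Longrightarrow> t \<in> carrier R \<Longrightarrow> curve R ys t \<in> J"
  by (induct ys) (simp_all add: ideal_zero ideal_add_closed ideal.I_l_closed)

lemma (in cring) curve_carrier [simp]:
  "set ys \<subseteq> carrier R \<Longrightarrow> t \<in> carrier R \<Longrightarrow> curve R ys t \<in> carrier R"
  by (rule curve_mem[OF oneideal])

lemma (in cring) divided_curve_carrier: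
  "set ys \<subseteq> carrier R \<Longrightarrow> s \<in> carrier R \<Longrightarrow> set (divided_curve R ys s) \<subseteq> carrier R"
proof (induct ys)
  case (Cons y ys) then show ?case by (cases ys) simp_all
qed simp

lemma length_divided_curve: "length (divided_curve R ys s) = length ys - 1"
  by (induct R ys s rule: divided_curve.induct) simp_all

lemma (in cring) curve_diff:
  assumes "set ys \<subseteq> carrier R" "s \<in> carrier R" "t \<in> carrier R"
  shows "curve R ys t \<ominus> curve R ys s = (t \<ominus> s) \<otimes> curve R (divided_curve R ys s) t"
  using assms(1)
proof (induct ys)
  case Nil then show ?case using assms by (simp add: a_minus_def)
next
  case (Cons y ys)
  show ?case
  proof (cases ys)
    case Nil
    then show ?thesis using Cons assms by (simp add: a_minus_def r_neg)
  next
    case (Cons z zs)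
    let ?a = "curve R ys t" and ?b = "curve R ys s" and ?d = "curve R (divided_curve R ys s) t"
    have c: "?a \<in> carrier R" "?b \<in> carrier R" "?d \<in> carrier R" "y \<in> carrier R"
      using Cons.prems assms divided_curve_carrier by auto
    have IH: "?a \<ominus> ?b = (t \<ominus> s) \<otimes> ?d" using Cons.hyps Cons.prems by simp
    have "(y \<oplus> t \<otimes> ?a) \<ominus> (y \<oplus> s \<otimes> ?b) = t \<otimes> (?a \<ominus> ?b) \<oplus> (t \<ominus> s) \<otimes> ?b"
      using c assms(2,3) by algebra
    also have "\<dots> = t \<otimes> ((t \<ominus> s) \<otimes> ?d) \<oplus> (t \<ominus> s) \<otimes> ?b" by (simp only: IH)
    also have "\<dots> = (t \<ominus> s) \<otimes> (?b \<oplus> t \<otimes> ?d)" using c assms(2,3) by algebra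
    finally show ?thesis using local.Cons by simp
  qed
qed

text \<open>Horner's scheme run backwards: passing from the coefficients to the value at
  \<open>s\<close> and the divided coefficients is a unitriangular substitution, so both families
  generate the same ideal.\<close>

lemma (in cring) divided_curve_mem:
  assumes "ideal J R" "s \<in> carrier R" "set ys \<subseteq> carrier R"
    "set (divided_curve R ys s) \<subseteq> J" "curve R ys s \<in> J"
  shows "set ys \<subseteq> J"
  using assms(3-5)
proof (induct ys)
  case (Cons y ys)
  have yc: "y \<in> carrier R" "set ys \<subseteq> carrier R" using Cons by auto
  show ?case
  proof (cases ys)
    case Nil
    then show ?thesis using Cons yc assms(2) by simp
  next
    case (Cons z zs)
    have cs: "curve R ys s \<in> J" and "set (divided_curve R ys s) \<subseteq> J" using Cons.prems Cons by auto
    then have ys: "set ys \<subseteq> J" using Cons.hyps yc by blast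
    have c: "curve R ys s \<in> carrier R" using yc assms(2) by simp
    have "(y \<oplus> s \<otimes> curve R ys s) \<ominus> s \<otimes> curve R ys s \<in> J"
      using ideal_diff_closed[OF assms(1)] Cons.prems(3) ideal.I_l_closed[OF assms(1) cs assms(2)] by simp
    moreover have "(y \<oplus> s \<otimes> curve R ys s) \<ominus> s \<otimes> curve R ys s = y" using c yc(1) assms(2) by algebra
    ultimately show ?thesis using ys by simp
  qed
qed simp

context local_ring
begin

text \<open>No determinant is formed. One point \<open>s\<close> is spent on subtracting and
  dividing by the units \<open>t - s\<close>, which leaves a curve with one coefficient fewer and
  still infinitely many points in \<open>J\<close>.\<close>

lemma curve_points_generate:
  assumes "ideal J R" "set ys \<subseteq> carrier R" "T \<subseteq> carrier R" "infinite T"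
    and "\<And>s t. s \<in> T \<Longrightarrow> t \<in> T \<Longrightarrow> s \<noteq> t \<Longrightarrow> s \<ominus> t \<notin> m"
    and "\<And>t. t \<in> T \<Longrightarrow> curve R ys t \<in> J"
  shows "set ys \<subseteq> J"
  using assms(2-)
proof (induct "length ys" arbitrary: ys T)
  case 0 then show ?case by simp
next
  case (Suc n)
  have "T \<noteq> {}" using Suc by auto
  then obtain s where s: "s \<in> T" by blast
  then have sc: "s \<in> carrier R" using Suc by auto
  have "set (divided_curve R ys s) \<subseteq> J"
  proof (rule Suc(1)[of "divided_curve R ys s" "T - {s}"])
    show "n = length (divided_curve R ys s)" using Suc(2) by (simp add: length_divided_curve)
    show "set (divided_curve R ys s) \<subseteq> carrier R" using divided_curve_carrier Suc sc by blast
    show "T - {s} \<subseteq> carrier R" "infinite (T - {s})" using Suc by auto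
    show "a \<ominus> b \<notin> m" if "a \<in> T - {s}" "b \<in> T - {s}" "a \<noteq> b" for a b using that Suc(6) by blast
    fix t assume t: "t \<in> T - {s}"
    then have tc: "t \<in> carrier R" using Suc by auto
    have "curve R ys t \<ominus> curve R ys s \<in> J" using Suc(7) s t ideal_diff_closed[OF assms(1)] by blast
    then have "(t \<ominus> s) \<otimes> curve R (divided_curve R ys s) t \<in> J"
      using curve_diff[OF Suc(3) sc tc] by simp
    moreover have "t \<ominus> s \<notin> m" using Suc(6) s t by blast
    ultimately show "curve R (divided_curve R ys s) t \<in> J"
      using mem_if_unit_mult_mem[OF assms(1), of "t \<ominus> s"] sc tc divided_curve_carrier[OF Suc(3) sc]
      by simp
  qed
  then show ?case using divided_curve_mem[OF assms(1) sc Suc(3)] Suc(7) s by blast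
qed

lemma infinite_residues:
  assumes "infinite (carrier (R Quot m))"
  shows "\<exists>T\<subseteq>carrier R. infinite T \<and> (\<forall>s\<in>T. \<forall>t\<in>T. s \<noteq> t \<longrightarrow> s \<ominus> t \<notin> m)"
proof -
  have ex: "\<exists>a. a \<in> carrier R \<and> c = m +> a" if "c \<in> carrier (R Quot m)" for c
    using that by (auto simp: FactRing_simps A_RCOSETS_def')
  define f where "f c = (SOME a. a \<in> carrier R \<and> c = m +> a)" for c
  have f: "f c \<in> carrier R \<and> c = m +> f c" if "c \<in> carrier (R Quot m)" for c
    unfolding f_def by (rule someI_ex[OF ex[OF that]])
  have "inj_on f (carrier (R Quot m))" by (rule inj_onI) (metis f)
  then have "infinite (f ` carrier (R Quot m))" using assms finite_imageD by blast
  moreover have "s \<ominus> t \<notin> m" if st: "s \<in> f ` carrier (R Quot m)" "t \<in> f ` carrier (R Quot m)" "s \<noteq> t" for s t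
  proof
    assume "s \<ominus> t \<in> m"
    moreover obtain c d where cd: "c \<in> carrier (R Quot m)" "d \<in> carrier (R Quot m)" "s = f c" "t = f d"
      using st by blast
    ultimately have "m +> s = m +> t"
      using quotient_eq_iff_same_a_r_cos[OF m_ideal, of s t] f by simp
    then show False using f cd st(3) by metis
  qed
  ultimately show ?thesis using f by (intro exI[of _ "f ` carrier (R Quot m)"]) blast
qed

end

context noetherian_local_ring
begin

text \<open>The case of a single reduction element. For an induction the claim is widened from
  \<open>I^(n+1)\<close> to the ideals \<open>w I^(d+1)\<close>, taken modulo
  \<open>m I^(n+1)\<close>: lowering \<open>d\<close> is paid for by absorbing a point of the curve
  into \<open>w\<close>.\<close>

theorem eakin_sathaye:
  assumes inf: "infinite (carrier (R Quot m))" and I: "ideal I R"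
    and mu: "ideal_length R (m \<cdot> ideal_pow R I (Suc n)) (ideal_pow R I (Suc n)) \<le> enat (Suc n)"
  shows "\<exists>x\<in>I. ideal_pow R I (Suc n) = (\<otimes>) x ` ideal_pow R I n"
proof -
  let ?Q = "m \<cdot> ideal_pow R I (Suc n)"
  have P: "ideal (ideal_pow R I k) R" for k using I by simp
  have Q: "ideal ?Q R" "?Q \<subseteq> ideal_pow R I (Suc n)"
    using ideal_prod_is_ideal[OF m_ideal P] ideal_prod_inter[OF m_ideal P, of "Suc n"] by auto
  obtain T0 where T0: "T0 \<subseteq> carrier R" "infinite T0" "\<And>s t. s \<in> T0 \<Longrightarrow> t \<in> T0 \<Longrightarrow> s \<noteq> t \<Longrightarrow> s \<ominus> t \<notin> m"
    using infinite_residues[OF inf] by blast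
  obtain S where S: "S \<subseteq> carrier R" "finite S" "I = Idl S" using finetely_gen[OF I] by blast
  obtain ys where ys: "set ys = S" using finite_list S(2) by blast
  have ysI: "set ys \<subseteq> I" using ys S genideal_self by blast
  let ?y = "\<lambda>t. curve R ys t"
  have yI: "?y t \<in> I" if "t \<in> T0" for t using curve_mem[OF I ysI] that T0(1) by blast
  have yc: "?y t \<in> carrier R" if "t \<in> T0" for t using ideal.Icarr[OF I yI[OF that]] .
  have gen: "I \<subseteq> J" if "ideal J R" "T \<subseteq> T0" "infinite T" "\<And>t. t \<in> T \<Longrightarrow> ?y t \<in> J" for J T
  proof -
    have "set ys \<subseteq> J"
    proof (rule curve_points_generate[OF that(1) _ _ that(3) _ that(4)])
      show "set ys \<subseteq> carrier R" "T \<subseteq> carrier R" using ys S(1) that(2) T0(1) by auto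
      show "s \<ominus> t \<notin> m" if "s \<in> T" "t \<in> T" "s \<noteq> t" for s t
        using T0(3)[of s t] that subsetD[OF \<open>T \<subseteq> T0\<close>] by blast
    qed
    then show ?thesis using S(3) ys genideal_minimal[OF that(1)] by blast
  qed
  \<comment> \<open>\<open>W w d\<close> is \<open>w I^d\<close> enlarged by the fixed ideal
    \<open>?Q\<close>, so that all lengths are compared modulo \<open>?Q\<close>. A further factor
    \<open>y\<close> from \<open>I\<close> only shrinks: \<open>w y I^d\<close> lies in
    \<open>w I^(d+1)\<close>.\<close>
  define W where "W w d = (\<otimes>) w ` ideal_pow R I d <+> ?Q" for w d
  have Wi: "ideal (W w d) R" if "w \<in> carrier R" for w d
    unfolding W_def using add_ideals[OF _ Q(1)] scale_ideal[OF P] that by blast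
  have WQ: "?Q \<subseteq> W w d" if "w \<in> carrier R" for w d
    unfolding W_def using ideal_add_upper2[OF _ Q(1)] scale_ideal[OF P] that by blast
  have Wsub: "W (w \<otimes> y) d \<subseteq> W w (Suc d)" if "w \<in> carrier R" "y \<in> I" for w y d
  proof -
    have "(\<otimes>) (w \<otimes> y) ` ideal_pow R I d \<subseteq> (\<otimes>) w ` ideal_pow R I (Suc d)"
    proof
      fix b assume "b \<in> (\<otimes>) (w \<otimes> y) ` ideal_pow R I d"
      then obtain a where a: "a \<in> ideal_pow R I d" "b = w \<otimes> y \<otimes> a" by blast
      have "y \<otimes> a \<in> ideal_pow R I (Suc d)"
        unfolding ideal_pow_Suc2[OF I] using that(2) a(1) by (rule ideal_prod.prod)
      moreover have "b = w \<otimes> (y \<otimes> a)"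
        using a(2) that(1) ideal.Icarr[OF I that(2)] ideal.Icarr[OF P a(1)] by (simp add: m_assoc)
      ultimately show "b \<in> (\<otimes>) w ` ideal_pow R I (Suc d)" by blast
    qed
    then show ?thesis unfolding W_def by (rule ideal_add_mono) simp
  qed
  have W_commute: "W (w \<otimes> y \<otimes> z) d = W (w \<otimes> z \<otimes> y) d"
    if "w \<in> carrier R" "y \<in> carrier R" "z \<in> carrier R" for w y z d
    using that by (simp add: m_ac)
  \<comment> \<open>The set \<open>T\<close> of admissible parameters is arbitrary up to being
    infinite, because the induction hypothesis is applied to the parameters that violate a generic
    condition.\<close>
  have key: "\<exists>t\<in>T. W (w \<otimes> ?y t) d = W w (Suc d)"
    if "w \<in> carrier R" "T \<subseteq> T0" "infinite T" "ideal_length R ?Q (W w (Suc d)) \<le> enat (Suc d)" for w d T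
    using that
  proof (induct d arbitrary: w T)
    case (0 w T)
    show ?case
    proof (rule ccontr)
      assume no: "\<not> ?case"
      \<comment> \<open>With length at most one there is no room between \<open>?Q\<close> and the
        full ideal: if no \<open>t\<close> works, each \<open>w y_t\<close> falls into
        \<open>?Q\<close>. Infinitely many points generate \<open>I\<close>, so \<open>wI\<close>
        lies in \<open>?Q\<close> too, and then every \<open>t\<close> works after all.\<close>
      have triv: "W (w \<otimes> ?y t) 0 = ?Q" if t: "t \<in> T" for t
      proof (rule ccontr)
        assume ne: "W (w \<otimes> ?y t) 0 \<noteq> ?Q"
        have tc: "?y t \<in> I" "?y t \<in> carrier R" "w \<otimes> ?y t \<in> carrier R" using t 0 yI yc by auto
        have "?Q \<subset> W (w \<otimes> ?y t) 0" using ne WQ[OF tc(3), of 0] by blast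
        then have "1 \<le> ideal_length R ?Q (W (w \<otimes> ?y t) 0)"
          using ideal_length_pos[OF Q(1) Wi[OF tc(3)]] by blast
        then have le: "ideal_length R ?Q (W w (Suc 0)) \<le> ideal_length R ?Q (W (w \<otimes> ?y t) 0)"
          using 0(4) by (simp add: one_enat_def)
        have fin: "ideal_length R ?Q (W (w \<otimes> ?y t) 0) \<noteq> \<infinity>"
          using ideal_length_antimono[OF order_refl Wsub[OF 0(1) tc(1), of 0], of R ?Q] 0(4)
            enat_finite_le[of _ "enat (Suc 0)"] by (meson enat.distinct(1) order_trans)
        have "W (w \<otimes> ?y t) 0 = W w (Suc 0)"
          by (rule ideal_length_eq_imp'[OF Q(1) Wi[OF tc(3)] Wi[OF 0(1)] WQ[OF tc(3)] Wsub[OF 0(1) tc(1)] le fin])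
        then show False using no t by blast
      qed
      let ?J = "{a \<in> carrier R. w \<otimes> a \<in> ?Q}"
      have J: "ideal ?J R"
        using 0(1) ideal_zero[OF Q(1)] ideal_add_closed[OF Q(1)] ideal.I_l_closed[OF Q(1)]
        by (intro idealI') (auto simp: r_distr m_lcomm[of w])
      have "?y t \<in> ?J" if t: "t \<in> T" for t
      proof -
        have tc: "?y t \<in> carrier R" "w \<otimes> ?y t \<in> carrier R" using t 0 yc by auto
        have i: "ideal ((\<otimes>) (w \<otimes> ?y t) ` carrier R) R" using scale_ideal[OF oneideal tc(2)] .
        have "w \<otimes> ?y t = (w \<otimes> ?y t) \<otimes> \<one>" using tc by simp
        then have "w \<otimes> ?y t \<in> (\<otimes>) (w \<otimes> ?y t) ` carrier R" by blast
        then have "w \<otimes> ?y t \<in> W (w \<otimes> ?y t) 0"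
          using ideal_add_upper1[OF i Q(1)] unfolding W_def ideal_pow_0 by blast
        then show ?thesis using triv[OF t] tc by simp
      qed
      then have "I \<subseteq> ?J" using gen[OF J 0(2,3)] by blast
      then have "(\<otimes>) w ` I \<subseteq> ?Q" by auto
      then have "W w (Suc 0) \<subseteq> ?Q" unfolding W_def ideal_pow_1[OF I] by (intro ideal_add_least[OF Q(1)]) auto
      moreover obtain t where t: "t \<in> T" using 0(3) by fastforce
      ultimately have "W (w \<otimes> ?y t) 0 = W w (Suc 0)" using triv[OF t] WQ[OF 0(1), of "Suc 0"] by auto
      then show False using no t by blast
    qed
  next
    case (Suc d w T)
    show ?case
    proof (rule ccontr)
      assume no: "\<not> ?case"
      let ?M = "\<lambda>t. ideal_length R ?Q (W (w \<otimes> ?y t) (Suc d))"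
      have tc: "?y t \<in> I" "?y t \<in> carrier R" "w \<otimes> ?y t \<in> carrier R" if "t \<in> T" for t
        using that Suc(2,3) yI yc by auto
      \<comment> \<open>If no \<open>t\<close> works, every inclusion of
        \<open>w y_t I^(d+1)\<close> in \<open>w I^(d+2)\<close> is strict modulo \<open>?Q\<close>,
        which lowers the length bound by one and makes the induction hypothesis applicable to
        \<open>w y_t\<close>.\<close>
      have small: "?M t \<le> enat (Suc d)" if t: "t \<in> T" for t
      proof (rule ccontr)
        assume "\<not> ?M t \<le> enat (Suc d)"
        then have ge: "enat (Suc (Suc d)) \<le> ?M t" by (cases "?M t") auto
        have le: "ideal_length R ?Q (W w (Suc (Suc d))) \<le> ?M t" using Suc(5) ge by (rule order_trans)
        have "?M t \<le> ideal_length R ?Q (W w (Suc (Suc d)))"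
          by (rule ideal_length_antimono[OF order_refl Wsub[OF Suc(2) tc(1)[OF t]]])
        then have fin: "?M t \<noteq> \<infinity>" using Suc(5) enat_finite_le by (metis enat.distinct(1) order_trans)
        have "W (w \<otimes> ?y t) (Suc d) = W w (Suc (Suc d))"
          by (rule ideal_length_eq_imp'[OF Q(1) Wi[OF tc(3)[OF t]] Wi[OF Suc(2)] WQ[OF tc(3)[OF t]]
              Wsub[OF Suc(2) tc(1)[OF t]] le fin])
        then show False using no t by blast
      qed
      obtain t1 where t1: "t1 \<in> T" using Suc(4) by fastforce
      define g where "g t = the_enat (?M t)" for t
      have gM: "?M t = enat (g t)" if "t \<in> T" for t
        using small[OF that] unfolding g_def by (cases "?M t") auto
      have "\<forall>t. t \<in> T \<longrightarrow> g t < Suc (Suc d)" using small gM by (simp add: less_Suc_eq_le)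
      \<comment> \<open>The lengths are bounded, so a parameter \<open>t0\<close> of largest length
        exists; its ideal is the candidate for the common value of almost all of them.\<close>
      then have "\<exists>t0. t0 \<in> T \<and> (\<forall>t. t \<in> T \<longrightarrow> g t \<le> g t0)"
        by (rule ex_has_greatest_nat[of "\<lambda>t. t \<in> T", OF t1])
      then obtain t0 where t0: "t0 \<in> T" "\<And>t. t \<in> T \<Longrightarrow> g t \<le> g t0" by blast
      let ?w = "w \<otimes> ?y t0"
      let ?W = "W ?w (Suc d)"
      let ?T1 = "{t \<in> T. W (w \<otimes> ?y t) (Suc d) = ?W}"
      \<comment> \<open>Otherwise the induction hypothesis for \<open>w y_t0\<close> finds an
        exceptional \<open>t\<close> with \<open>w y_t0 y_t I^d = w y_t0 I^(d+1)\<close> modulo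
        \<open>?Q\<close>. Exchanging the two factors puts \<open>?W\<close> inside the ideal of
        \<open>t\<close>, and maximality of the length of \<open>?W\<close> gives equality.\<close>
      have "finite (T - ?T1)"
      proof (rule ccontr)
        assume inf: "infinite (T - ?T1)"
        have "\<exists>t\<in>T - ?T1. W (?w \<otimes> ?y t) d = ?W"
          using Suc(1)[OF tc(3)[OF t0(1)] _ inf small[OF t0(1)]] Suc(3) by blast
        then obtain t where t: "t \<in> T" "W (w \<otimes> ?y t) (Suc d) \<noteq> ?W" "W (?w \<otimes> ?y t) d = ?W" by blast
        have "W (?w \<otimes> ?y t) d = W (w \<otimes> ?y t \<otimes> ?y t0) d"
          by (rule W_commute[OF Suc(2) tc(2)[OF t0(1)] tc(2)[OF t(1)]])
        also have "\<dots> \<subseteq> W (w \<otimes> ?y t) (Suc d)" by (rule Wsub[OF tc(3)[OF t(1)] tc(1)[OF t0(1)]])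
        finally have sub: "?W \<subseteq> W (w \<otimes> ?y t) (Suc d)" using t(3) by simp
        have "?M t \<le> ?M t0" using gM t0 t(1) by simp
        moreover have "?M t0 \<noteq> \<infinity>" using gM t0(1) by simp
        ultimately have "?W = W (w \<otimes> ?y t) (Suc d)"
          using ideal_length_eq_imp'[OF Q(1) Wi[OF tc(3)[OF t0(1)]] Wi[OF tc(3)[OF t(1)]]
              WQ[OF tc(3)[OF t0(1)]] sub] by blast
        then show False using t(2) by simp
      qed
      moreover have "?T1 \<union> (T - ?T1) = T" by blast
      ultimately have inf: "infinite ?T1" using Suc(4) finite_UnI[of ?T1 "T - ?T1"] by argo
      \<comment> \<open>The elements multiplying \<open>w I^(d+1)\<close> into \<open>?W\<close>
        form an ideal. It contains infinitely many points of the curve, hence all of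
        \<open>I\<close>, so \<open>w I^(d+2)\<close> lies in \<open>?W\<close> and
        \<open>t0\<close> does work.\<close>
      let ?J = "{a \<in> carrier R. \<forall>b\<in>ideal_pow R I (Suc d). w \<otimes> a \<otimes> b \<in> ?W}"
      note Wi0 = Wi[OF tc(3)[OF t0(1)], of "Suc d"]
      have J: "ideal ?J R"
      proof (rule idealI')
        note bc = ideal.Icarr[OF P[of "Suc d"]]
        show "?J \<subseteq> carrier R" by blast
        show "\<zero> \<in> ?J" using ideal_zero[OF Wi0] Suc(2) bc by simp
        show "a \<oplus> a' \<in> ?J" if "a \<in> ?J" "a' \<in> ?J" for a a'
          using that Suc(2) bc ideal_add_closed[OF Wi0] by (simp add: r_distr l_distr)
        show "c \<otimes> a \<in> ?J" if "a \<in> ?J" "c \<in> carrier R" for a c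
        proof -
          have "w \<otimes> (c \<otimes> a) \<otimes> b \<in> ?W" if b: "b \<in> ideal_pow R I (Suc d)" for b
          proof -
            have "w \<otimes> (c \<otimes> a) \<otimes> b = c \<otimes> (w \<otimes> a \<otimes> b)"
              using \<open>a \<in> ?J\<close> \<open>c \<in> carrier R\<close> bc[OF b] Suc(2) by (simp add: m_ac)
            then show ?thesis using \<open>a \<in> ?J\<close> \<open>c \<in> carrier R\<close> b ideal.I_l_closed[OF Wi0] by simp
          qed
          then show ?thesis using that by simp
        qed
      qed
      have "?y t \<in> ?J" if t: "t \<in> ?T1" for t
      proof -
        have tT: "t \<in> T" using t by simp
        have i: "ideal ((\<otimes>) (w \<otimes> ?y t) ` ideal_pow R I (Suc d)) R" using scale_ideal[OF P tc(3)[OF tT]] .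
        have "(\<otimes>) (w \<otimes> ?y t) ` ideal_pow R I (Suc d) \<subseteq> W (w \<otimes> ?y t) (Suc d)"
          unfolding W_def by (rule ideal_add_upper1[OF i Q(1)])
        also have "\<dots> = ?W" using t by simp
        finally show ?thesis using tc(2)[OF tT] by auto
      qed
      moreover have "?T1 \<subseteq> T0" using Suc(3) by blast
      ultimately have IJ: "I \<subseteq> ?J" using gen[OF J _ inf] by blast
      have "(\<otimes>) w ` ideal_pow R I (Suc (Suc d)) \<subseteq> ?W"
      proof -
        have sub: "((\<otimes>) w ` I) \<cdot> ideal_pow R I (Suc d) \<subseteq> ?W"
          using IJ by (intro ideal_prod_least[OF Wi0]) auto
        show ?thesis
          unfolding ideal_pow_Suc2[OF I, of "Suc d"] scale_prod[OF I P Suc(2)] by (rule sub)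
      qed
      then have "W w (Suc (Suc d)) \<subseteq> ?W"
        unfolding W_def[of w "Suc (Suc d)"] by (rule ideal_add_least[OF Wi0 _ WQ[OF tc(3)[OF t0(1)]]])
      then have "W ?w (Suc d) = W w (Suc (Suc d))" using Wsub[OF Suc(2) tc(1)[OF t0(1)], of "Suc d"] by blast
      then show False using no t0(1) by blast
    qed
  qed
  have one: "(\<otimes>) \<one> ` ideal_pow R I k = ideal_pow R I k" for k
    using ideal_subset[OF P[of k]] by (force simp: image_iff subset_iff)
  have "W \<one> (Suc n) = ideal_pow R I (Suc n)"
    unfolding W_def one using ideal_add_least[OF P order_refl Q(2)] ideal_add_upper1[OF P Q(1), of "Suc n"] by blast
  \<comment> \<open>For \<open>w = 1\<close> and \<open>d = n\<close> the widened claim reads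
    \<open>y_t I^n + m I^(n+1) = I^(n+1)\<close>; Nakayama then removes the second summand.\<close>
  then obtain t where t: "t \<in> T0" "W (\<one> \<otimes> ?y t) n = ideal_pow R I (Suc n)"
    using key[of \<one> T0 n] T0(2) mu by auto
  have tc: "?y t \<in> I" "?y t \<in> carrier R" using yI yc t by auto
  have s: "ideal ((\<otimes>) (?y t) ` ideal_pow R I n) R" using scale_ideal[OF P tc(2)] .
  have "ideal_pow R I (Suc n) \<subseteq> (\<otimes>) (?y t) ` ideal_pow R I n"
    using nakayama'[OF P s, of "Suc n"] t(2) tc(2) unfolding W_def by simp
  moreover have "(\<otimes>) (?y t) ` ideal_pow R I n \<subseteq> ideal_pow R I (Suc n)"
    unfolding ideal_pow_Suc2[OF I] using tc(1) by (auto intro: ideal_prod.prod)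
  ultimately show ?thesis using tc(1) by blast
qed

end



section \<open>The Hilbert function of a primary ideal in dimension one\<close>

locale m_primary = noetherian_local_ring +
  fixes I
  assumes infinite_residue_field: "infinite (carrier (R Quot m))"
    and I_ideal [simp, intro]: "ideal I R" and I_subset_m: "I \<subseteq> m"
    and m_pow_subset_I: "\<exists>k. ideal_pow R m k \<subseteq> I"
    and parameter: "\<exists>x k. x \<in> m \<and> nonzerodiv R x \<and> ideal_pow R m k \<subseteq> PIdl x"
begin

abbreviation Ipow where "Ipow n \<equiv> ideal_pow R I n"

definition hilb where "hilb n = the_enat (ideal_length R (Ipow (Suc n)) (Ipow n))"

lemma Ipow_carrier: "Ipow n \<subseteq> carrier R"
  using ideal_subset[of "Ipow n"] by simp

lemma m_pow_subset_Ipow: "\<exists>j. ideal_pow R m j \<subseteq> Ipow n"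
proof (induct n)
  case 0 show ?case by (intro exI[of _ 0]) simp
next
  case (Suc n)
  then obtain j k where "ideal_pow R m j \<subseteq> Ipow n" "ideal_pow R m k \<subseteq> I" using m_pow_subset_I by blast
  then have "ideal_pow R m (j + k) \<subseteq> Ipow (Suc n)"
    by (simp add: ideal_pow_add ideal_pow_Suc ideal_prod_mono)
  then show ?case by blast
qed

lemma Ipow_length_finite: "L \<subseteq> carrier R \<Longrightarrow> ideal_length R (Ipow n) L \<noteq> \<infinity>"
  using m_pow_subset_Ipow[of n] ideal_length_finite by blast

lemma hilb_eq: "ideal_length R (Ipow (Suc n)) (Ipow n) = enat (hilb n)"
  using Ipow_length_finite[OF Ipow_carrier, of "Suc n" n] by (auto simp: hilb_def)

lemma Ipow_colength: "ideal_length R (Ipow (Suc n)) (carrier R) = enat (\<Sum>j\<le>n. hilb j)"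
proof (induct n)
  case 0 show ?case using hilb_eq[of 0] by simp
next
  case (Suc n)
  have "ideal_length R (Ipow (Suc (Suc n))) (carrier R)
      = ideal_length R (Ipow (Suc (Suc n))) (Ipow (Suc n)) + ideal_length R (Ipow (Suc n)) (carrier R)"
    by (rule ideal_length_add) (auto simp: oneideal Ipow_carrier intro: ideal_pow_Suc_subset[THEN subsetD])
  then show ?case using Suc hilb_eq[of "Suc n"] by (simp add: add.commute)
qed

text \<open>The interval from \<open>xJ\<close> to the whole ring is cut once at \<open>J\<close>
  and once at \<open>(x)\<close>. The pieces \<open>R/J\<close> and \<open>xR/xJ\<close> have the
  same length and cancel because it is finite.\<close>

lemma ideal_length_scale_self:
  assumes "ideal J R" "ideal_length R J (carrier R) \<noteq> \<infinity>" "nonzerodiv R x"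
  shows "ideal_length R ((\<otimes>) x ` J) J = ideal_length R (PIdl x) (carrier R)"
proof -
  have xc: "x \<in> carrier R" using assms(3) by (rule nonzerodiv_carrier)
  note c = scale_carrier[OF xc]
  have I: "ideal ((\<otimes>) x ` J) R" "ideal (PIdl x) R" using assms(1) xc cgenideal_ideal by auto
  have s: "(\<otimes>) x ` J \<subseteq> J" "(\<otimes>) x ` J \<subseteq> PIdl x"
    using scale_subset[OF assms(1) xc] ideal_subset[OF assms(1)] unfolding c[symmetric] by auto
  have "ideal_length R ((\<otimes>) x ` J) J + ideal_length R J (carrier R)
      = ideal_length R ((\<otimes>) x ` J) (PIdl x) + ideal_length R (PIdl x) (carrier R)"
    using ideal_length_add[OF I(1) assms(1) oneideal s(1) ideal_subset[OF assms(1)]]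
      ideal_length_add[OF I(1,2) oneideal s(2) ideal_subset[OF I(2)]] by simp
  also have "ideal_length R ((\<otimes>) x ` J) (PIdl x) = ideal_length R J (carrier R)"
    using ideal_length_scale[OF assms(1) oneideal ideal_subset[OF assms(1)] assms(3)] unfolding c .
  finally show ?thesis using assms(2) by (simp add: add.commute enat_add_left_cancel)
qed

section \<open>Reductions and the eventual value of the Hilbert function\<close>

definition reduction where "reduction x n \<longleftrightarrow> x \<in> I \<and> (\<otimes>) x ` Ipow n = Ipow (Suc n)"

lemma reduction_mono:
  assumes "reduction x n" "n \<le> k" shows "reduction x k"
  using assms(2)
proof (induct rule: dec_induct)
  case (step k)
  then have x: "x \<in> I" "(\<otimes>) x ` Ipow k = Ipow (Suc k)" by (auto simp: reduction_def)
  have "(\<otimes>) x ` Ipow (Suc k) = Ipow (Suc (Suc k))"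
    using scale_prod[OF _ I_ideal ideal.Icarr[OF I_ideal x(1)], of "Ipow k"] x(2)
    by (simp only: ideal_pow_Suc ideal_pow_ideal I_ideal)
  then show ?case using x(1) by (simp add: reduction_def)
qed (rule assms)

lemma reduction_if_small:
  assumes "ideal_length R (m \<cdot> Ipow (Suc n)) (Ipow (Suc n)) \<le> enat (Suc n)"
  shows "\<exists>x. reduction x n"
  using eakin_sathaye[OF infinite_residue_field I_ideal assms] by (auto simp: reduction_def)

text \<open>For a parameter \<open>x\<close>, not yet a reduction, the number of generators of every
  power of \<open>I\<close> is at most the length of \<open>R/(x)\<close>. This bound does not grow
  with the power, so Eakin-Sathaye applies once the exponent exceeds it.\<close>

lemma reduction_exists: "\<exists>x n. reduction x n"
proof -
  obtain x k where x: "x \<in> m" "nonzerodiv R x" "ideal_pow R m k \<subseteq> PIdl x" using parameter by blast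
  have "ideal_length R (PIdl x) (carrier R) \<noteq> \<infinity>" using ideal_length_finite[OF x(3)] by simp
  then obtain n where n: "ideal_length R (PIdl x) (carrier R) = enat n" by auto
  have "ideal_length R (m \<cdot> Ipow (Suc n)) (Ipow (Suc n)) \<le> ideal_length R ((\<otimes>) x ` Ipow (Suc n)) (Ipow (Suc n))"
    using x(1) by (intro ideal_length_antimono) (auto intro: ideal_prod.prod)
  also have "\<dots> = enat n"
    using ideal_length_scale_self[OF _ Ipow_length_finite[OF order_refl] x(2)] n by simp
  also have "\<dots> \<le> enat (Suc n)" by simp
  finally show ?thesis using reduction_if_small by blast
qed

text \<open>A power of a parameter lies in \<open>I^(n+1) = x I^n\<close>, so \<open>x\<close>
  divides a nonzerodivisor.\<close>

lemma reduction_nonzerodiv: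
  assumes "reduction x n" shows "nonzerodiv R x"
proof -
  obtain z where z: "z \<in> m" "nonzerodiv R z" using parameter by blast
  obtain j where j: "ideal_pow R m j \<subseteq> Ipow (Suc n)" using m_pow_subset_Ipow by blast
  have "z [^] j \<in> (\<otimes>) x ` Ipow n"
    using ideal_pow_pow_mem[OF m_ideal z(1)] j assms by (auto simp: reduction_def)
  then obtain c where c: "c \<in> Ipow n" "z [^] j = x \<otimes> c" by blast
  have "x \<in> carrier R" "c \<in> carrier R"
    using assms c(1) Ipow_carrier ideal.Icarr[OF I_ideal] by (auto simp: reduction_def)
  then show ?thesis using nonzerodiv_factor nonzerodiv_pow[OF z(2), of j] c(2) by simp
qed

lemma reduction_hilb:
  assumes "reduction x n" "n \<le> k"
  shows "ideal_length R (PIdl x) (carrier R) = enat (hilb k)"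
  using ideal_length_scale_self[of "Ipow k" x] Ipow_length_finite[OF order_refl, of k]
    reduction_nonzerodiv[OF assms(1)] reduction_mono[OF assms] hilb_eq[of k]
  by (simp add: reduction_def)

lemma hilb_stable:
  assumes "reduction x r" "reduction y n" "n \<le> k" shows "hilb k = hilb r"
  using reduction_hilb[OF assms(2,3)] reduction_hilb[OF assms(2), of "n + r"]
    reduction_hilb[OF assms(1), of "n + r"] reduction_hilb[OF assms(1), of r] by simp

lemma hilb_le:
  assumes "reduction x r" shows "hilb k \<le> hilb r"
proof -
  have x: "x \<in> I" using assms by (simp add: reduction_def)
  have "enat (hilb k) \<le> ideal_length R ((\<otimes>) x ` Ipow k) (Ipow k)"
    unfolding hilb_eq[symmetric]
    by (intro ideal_length_antimono) (use x in \<open>auto simp: ideal_pow_Suc2 intro: ideal_prod.prod\<close>)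
  also have "\<dots> = enat (hilb r)"
    using ideal_length_scale_self[of "Ipow k" x] Ipow_length_finite[OF order_refl, of k]
      reduction_nonzerodiv[OF assms] reduction_hilb[OF assms order_refl] by simp
  finally show ?thesis by simp
qed

text \<open>A reduction with exponent at most \<open>n\<close> would make \<open>hilb\<close>
  constant from \<open>n\<close> on. So a deviation at some \<open>k >= n\<close> excludes one, and
  Eakin-Sathaye read backwards bounds the number of generators of \<open>I^(n+1)\<close>. That
  number bounds \<open>hilb (n + 1)\<close> from below because \<open>I^(n+2)\<close> lies in
  \<open>m I^(n+1)\<close>; the sharper form is kept for the proof of
  \<open>mI = I^2\<close>.\<close>

lemma hilb_ge:
  assumes "reduction x r" "n \<le> k" "hilb k \<noteq> hilb r"
  shows "Suc (Suc n) \<le> hilb (Suc n)" and "enat (Suc (Suc n)) \<le> ideal_length R (m \<cdot> Ipow (Suc n)) (Ipow (Suc n))"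
proof -
  let ?l = "ideal_length R (m \<cdot> Ipow (Suc n)) (Ipow (Suc n))"
  have "\<not> ?l \<le> enat (Suc n)"
    using reduction_if_small[of n] hilb_stable[OF assms(1) _ assms(2)] assms(3) by blast
  then show l: "enat (Suc (Suc n)) \<le> ?l" by (cases ?l) auto
  have "Ipow (Suc (Suc n)) \<subseteq> m \<cdot> Ipow (Suc n)"
    unfolding ideal_pow_Suc2[OF I_ideal, of "Suc n"] by (rule ideal_prod_mono[OF I_subset_m order_refl])
  then have "?l \<le> enat (hilb (Suc n))"
    unfolding hilb_eq[symmetric] by (intro ideal_length_antimono) auto
  then show "Suc (Suc n) \<le> hilb (Suc n)" using l by (meson enat_ord_simps(1) order_trans)
qed

text \<open>Summation of the Hilbert function: each degree below \<open>r\<close> contributes its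
  defect \<open>e - hilb j\<close>. Two consecutive large arguments determine both coefficients,
  which gives the uniqueness required by \<open>THE\<close>.\<close>

lemma hilbert_coeffs_eq:
  assumes "\<And>k. k \<ge> r \<Longrightarrow> hilb k = e"
  shows "hilbert_e0 R I = int e" "hilbert_e1 R I = (\<Sum>j<r. int e - int (hilb j))"
proof -
  let ?s = "\<Sum>j<r. int e - int (hilb j)"
  let ?P = "\<lambda>e0 e1. \<forall>\<^sub>F n in sequentially.
      int (the_enat (quot_length R (ideal_pow R I (n + 1)))) = e0 * (int n + 1) - e1"
  have q: "int (the_enat (quot_length R (ideal_pow R I (n + 1)))) = (\<Sum>j\<le>n. int (hilb j))" for n
    using quot_length_eq[of "Ipow (Suc n)"] Ipow_colength[of n] by simp
  have val: "(\<Sum>j\<le>n. int (hilb j)) = int e * (int n + 1) - ?s" if "n \<ge> r" for n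
  proof -
    have "?s = (\<Sum>j\<le>n. int e - int (hilb j))"
      using that assms by (intro sum.mono_neutral_left) auto
    also have "\<dots> = int e * (int n + 1) - (\<Sum>j\<le>n. int (hilb j))"
      by (simp add: sum_subtractf algebra_simps)
    finally show ?thesis by simp
  qed
  have P: "?P (int e) ?s"
    unfolding q using val by (auto simp: eventually_sequentially)
  have uniq: "e0 = int e \<and> e1 = ?s" if "?P e0 e1" for e0 e1
  proof -
    have "\<forall>\<^sub>F n in sequentially. e0 * (int n + 1) - e1 = int e * (int n + 1) - ?s"
      using eventually_conj[OF that P] by (rule eventually_mono) auto
    then obtain N where N: "\<And>n. n \<ge> N \<Longrightarrow> e0 * (int n + 1) - e1 = int e * (int n + 1) - ?s"
      unfolding eventually_sequentially by blast
    have "e0 = int e" using N[of N] N[of "Suc N"] by (simp add: algebra_simps)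
    then show ?thesis using N[of N] by simp
  qed
  have "hilbert_coeffs R I = (int e, ?s)"
    unfolding hilbert_coeffs_def
  proof (rule the_equality)
    show "case (int e, ?s) of (e0, e1) \<Rightarrow> ?P e0 e1" unfolding prod.case by (rule P)
    fix p assume p: "case p of (e0, e1) \<Rightarrow> ?P e0 e1"
    have "?P (fst p) (snd p)" using p unfolding case_prod_beta .
    from uniq[OF this] show "p = (int e, ?s)" by (simp add: prod_eq_iff)
  qed
  then show "hilbert_e0 R I = int e" "hilbert_e1 R I = ?s"
    by (simp_all add: hilbert_e0_def hilbert_e1_def)
qed

lemma quot_length_I: "quot_length R I = enat (hilb 0)"
  using quot_length_eq[OF I_ideal] hilb_eq[of 0] by simp

text \<open>The hypothesis on \<open>e\<^sub>1\<close> says that the sum over \<open>j \<ge> 1\<close> of \<open>e\<^sub>0 - hilb j\<close> is the largest possible,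
  each term being at most \<open>e\<^sub>0 - 1 - j\<close> by the theorem of Eakin and Sathaye.\<close>

lemma hilb_extremal:
  assumes e3: "3 \<le> hilbert_e0 R I"
    and e1: "hilbert_e1 R I = int (nat (hilbert_e0 R I) choose 2) + 1 - int (the_enat (quot_length R I))"
  shows "\<exists>e x r. 3 \<le> e \<and> reduction x r \<and> hilb r = e \<and> (\<forall>n\<ge>1. hilb n = min (Suc n) e)"
proof -
  obtain x r0 where x0: "reduction x r0" using reduction_exists by blast
  define e where "e = hilb r0"
  \<comment> \<open>The summand \<open>Suc e\<close> makes \<open>r\<close> exceed \<open>e\<close>.
    The truncated difference \<open>e - 1 - j\<close> vanishes from \<open>j = e - 1\<close> on, so
    its sums over \<open>j < r\<close> and \<open>j < e\<close> agree.\<close>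
  define r where "r = r0 + Suc e"
  have x: "reduction x r" using reduction_mono[OF x0] by (simp add: r_def)
  have stab: "hilb k = e" if "k \<ge> r" for k using hilb_stable[OF x0 x0, of k] that by (simp add: e_def r_def)
  have er: "hilb r = e" using stab by simp
  note c = hilbert_coeffs_eq[OF stab]
  have e: "3 \<le> e" using e3 c(1) by simp
  have le: "hilb k \<le> e" for k using hilb_le[OF x] er by simp
  \<comment> \<open>If \<open>hilb j\<close> has not reached \<open>e\<close>, then
    \<open>hilb_ge\<close> at exponent \<open>j - 1\<close> gives \<open>hilb j >= j + 1\<close>;
    otherwise the left side is zero.\<close>
  have bnd: "e - hilb j \<le> e - 1 - j" if "1 \<le> j" for j
  proof (cases "hilb j = e")
    case False
    then have "Suc (Suc (j - 1)) \<le> hilb (Suc (j - 1))" using hilb_ge(1)[OF x, of "j - 1" j] er by simp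
    then show ?thesis using that by simp
  qed simp
  have r: "{..<r} = insert 0 {1..<r}" by (auto simp: r_def)
  have "(\<Sum>j<r. e - 1 - j) = (\<Sum>j<e. e - 1 - j)"
    by (rule sum.mono_neutral_right) (auto simp: r_def)
  also have "\<dots> = (\<Sum>j<e. e - Suc j)" by simp
  also have "\<dots> = \<Sum>{..<e}" by (rule sum.nat_diff_reindex)
  also have "{..<e} = {0..e - 1}" using e by auto
  also have "\<Sum>{0..e - 1} = e choose 2"
    using gauss_sum_nat[of "e - 1"] e by (simp add: choose_two mult.commute)
  \<comment> \<open>The term \<open>e - 1\<close> at \<open>j = 0\<close> is split off because in
    the Hilbert sum its place is taken by \<open>e - hilb 0\<close>, with \<open>hilb 0\<close>
    cancelled by the hypothesis.\<close>
  finally have s1: "(e - 1) + (\<Sum>j\<in>{1..<r}. e - 1 - j) = e choose 2" unfolding r by simp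
  have "(\<Sum>j<r. int e - int (hilb j)) = int (\<Sum>j<r. e - hilb j)"
    using le by (simp add: of_nat_diff)
  then have "int (\<Sum>j<r. e - hilb j) = int (e choose 2) + 1 - int (hilb 0)"
    using e1 c quot_length_I by simp
  then have "(\<Sum>j<r. e - hilb j) + hilb 0 = (e choose 2) + 1" by linarith
  then have "(e - hilb 0) + (\<Sum>j\<in>{1..<r}. e - hilb j) + hilb 0 = (e choose 2) + 1" unfolding r by simp
  then have s2: "e + (\<Sum>j\<in>{1..<r}. e - hilb j) = (e choose 2) + 1" using le[of 0] by simp
  \<comment> \<open>The summand 1 in the hypothesis is the difference between \<open>e\<close> in
    \<open>s2\<close> and \<open>e - 1\<close> in \<open>s1\<close>. Equal sums of termwise
    comparable numbers then agree term by term.\<close>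
  have eq: "(\<Sum>j\<in>{1..<r}. e - hilb j) = (\<Sum>j\<in>{1..<r}. e - 1 - j)" using s1 s2 e by simp
  have "hilb n = min (Suc n) e" if n: "1 \<le> n" for n
  proof (cases "n < r")
    case True
    have "e - hilb n = e - 1 - n"
      using sum_mono_inv[OF eq, of n] bnd True n by simp
    then show ?thesis using le[of n] by (auto simp: min_def)
  next
    case False
    then show ?thesis using stab[of n] by (simp add: r_def min_def)
  qed
  then show ?thesis using e x er by blast
qed

end



section \<open>Ideals with extremal Hilbert function\<close>

locale extremal = m_primary +
  fixes e x r
  assumes e3: "3 \<le> e" and red: "reduction x r" and hilb_r: "hilb r = e"
    and hilb_min: "1 \<le> n \<Longrightarrow> hilb n = min (Suc n) e"
begin

lemma xI: "x \<in> I" using red by (simp add: reduction_def)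

lemma xm: "x \<in> m" using xI I_subset_m by blast

lemma xc [simp]: "x \<in> carrier R" using xI ideal.Icarr[OF I_ideal] by blast

lemma x_nonzerodiv: "nonzerodiv R x" using red by (rule reduction_nonzerodiv)

lemma hilb_pos: "1 \<le> n \<Longrightarrow> 0 < hilb n"
  using hilb_min[of n] e3 by simp

text \<open>Here \<open>e >= 3\<close> is decisive: \<open>hilb 1 = 2\<close> differs from
  \<open>e\<close>, so by \<open>hilb_ge\<close> the length of \<open>I/mI\<close> is at least two.
  As \<open>I^2\<close> lies in \<open>mI\<close> and \<open>I/I^2\<close> has length two, no room
  is left between them.\<close>

lemma mI: "m \<cdot> I = Ipow (Suc (Suc 0))"
proof -
  have mI: "ideal (m \<cdot> I) R" "m \<cdot> I \<subseteq> I"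
    using ideal_prod_is_ideal[OF m_ideal I_ideal] ideal_prod_inter[OF m_ideal I_ideal] by auto
  have h1: "hilb (Suc 0) = 2" using hilb_min[of "Suc 0"] e3 by simp
  have "Ipow (Suc (Suc 0)) \<subseteq> m \<cdot> I"
    using ideal_prod_mono[OF I_subset_m order_refl[of I]] by (simp add: ideal_pow_Suc2[of I "Suc 0"])
  moreover have "enat 2 \<le> ideal_length R (m \<cdot> I) I"
    using hilb_ge(2)[OF red, of 0 "Suc 0"] h1 hilb_r e3 by (simp add: numeral_2_eq_2)
  then have "ideal_length R (Ipow (Suc (Suc 0))) I \<le> ideal_length R (m \<cdot> I) I"
    using hilb_eq[of "Suc 0"] h1 by simp
  ultimately show ?thesis
    using ideal_length_eq_imp[of "Ipow (Suc (Suc 0))" "m \<cdot> I" I] mI ideal_length_mult_m_finite[OF I_ideal] by simp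
qed

lemma min_gens_I: "min_gens R I = 2"
proof -
  have "enat (min_gens R I) = enat (hilb (Suc 0))"
    using min_gens_eq[OF I_ideal] hilb_eq[of "Suc 0"] mI by simp
  then show ?thesis using hilb_min[of "Suc 0"] e3 by simp
qed

lemma m_Ipow: "m \<cdot> Ipow (Suc k) = Ipow (Suc (Suc k))"
proof -
  have "m \<cdot> Ipow (Suc k) = (m \<cdot> I) \<cdot> Ipow k"
    by (simp add: ideal_pow_Suc2 ideal_prod_assoc)
  also have "\<dots> = I \<cdot> (I \<cdot> Ipow k)"
    unfolding mI ideal_pow_Suc2[OF I_ideal, of "Suc 0"] ideal_pow_1[OF I_ideal] by (simp add: ideal_prod_assoc)
  finally show ?thesis by (simp add: ideal_pow_Suc2)
qed

lemma Ipow_neq: "1 \<le> n \<Longrightarrow> Ipow (Suc n) \<noteq> Ipow n"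
proof
  assume n: "1 \<le> n" "Ipow (Suc n) = Ipow n"
  then have "enat (hilb n) = 0" using hilb_eq[of n] by simp
  then show False using hilb_pos[OF n(1)] by (simp add: zero_enat_def)
qed

text \<open>A unit in the closure would give \<open>I^k = I^(k+1)\<close> for some
  \<open>k >= 1\<close>, contradicting \<open>hilb k > 0\<close>. Conversely,
  \<open>mI = I^2\<close> places \<open>m\<close> already in the colon ideal for
  \<open>k = 1\<close>.\<close>

lemma ratliff_rush_eq: "ratliff_rush R I = m"
proof
  show "ratliff_rush R I \<subseteq> m"
  proof
    fix a assume "a \<in> ratliff_rush R I"
    then obtain k where k: "1 \<le> k" "a \<in> carrier R" "\<And>b. b \<in> Ipow k \<Longrightarrow> a \<otimes> b \<in> Ipow (Suc k)"
      by (auto simp: ratliff_rush_def ideal_colon_def)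
    show "a \<in> m"
    proof (rule ccontr)
      assume "a \<notin> m"
      then have "Ipow k \<subseteq> Ipow (Suc k)"
        using mem_if_unit_mult_mem[OF _ k(2), of "Ipow (Suc k)"] k(3) Ipow_carrier by (auto simp: subset_iff)
      then show False using Ipow_neq[OF k(1)] ideal_pow_Suc_subset[OF I_ideal] by blast
    qed
  qed
  show "m \<subseteq> ratliff_rush R I"
  proof
    fix a assume a: "a \<in> m"
    have "a \<in> ideal_colon R (Ipow (1 + 1)) (Ipow 1)"
      using a ideal.Icarr[OF m_ideal a] ideal_prod.prod[OF a, of _ I R] by (simp add: ideal_colon_def mI)
    then show "a \<in> ratliff_rush R I" unfolding ratliff_rush_def by blast
  qed
qed

text \<open>If \<open>x\<close> were in \<open>mI = I^2\<close>, the powers would stop descending,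
  since \<open>I^(r+1) = x I^r\<close> would lie in \<open>I^(r+2)\<close>.\<close>

lemma x_notin: "x \<notin> m \<cdot> I"
proof
  assume "x \<in> m \<cdot> I"
  then have "x \<otimes> b \<in> Ipow (Suc (Suc r))" if "b \<in> Ipow r" for b
    using ideal_pow_mult[OF I_ideal, of x "Suc (Suc 0)" b r] that by (simp add: mI)
  then have "(\<otimes>) x ` Ipow r \<subseteq> Ipow (Suc (Suc r))" by blast
  then have "Ipow (Suc r) \<subseteq> Ipow (Suc (Suc r))" using red by (simp add: reduction_def)
  then show False using Ipow_neq[of "Suc r"] ideal_pow_Suc_subset[OF I_ideal, of "Suc r"] by auto
qed

text \<open>Being outside \<open>mI\<close>, the element \<open>x\<close> is a minimal generator.
  Since \<open>I/mI\<close> has length two, the two strict steps obtained by adding \<open>x\<close>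
  and then \<open>y\<close> exhaust it, and Nakayama lifts this to generators of
  \<open>I\<close>.\<close>

lemma exists_second_generator: "\<exists>y\<in>I. I = PIdl x <+> PIdl y"
proof -
  have mI: "ideal (m \<cdot> I) R" "m \<cdot> I \<subseteq> I"
    using ideal_prod_is_ideal[OF m_ideal I_ideal] ideal_prod_inter[OF m_ideal I_ideal] by auto
  have two: "ideal_length R (m \<cdot> I) I = enat 2" using min_gens_eq[OF I_ideal] min_gens_I by simp
  let ?L = "m \<cdot> I <+> PIdl x"
  have Px: "ideal (PIdl x) R" "PIdl x \<subseteq> I" using cgenideal_ideal cgenideal_minimal[OF I_ideal xI] by auto
  have L: "ideal ?L R" "m \<cdot> I \<subseteq> ?L" "PIdl x \<subseteq> ?L" "?L \<subseteq> I"
    using add_ideals[OF mI(1) Px(1)] ideal_add_upper1[OF mI(1) Px(1)] ideal_add_upper2[OF mI(1) Px(1)]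
      ideal_add_least[OF I_ideal mI(2) Px(2)] by auto
  have "(\<otimes>) x ` m \<subseteq> m \<cdot> I"
    using ideal_prod.prod[OF _ xI, of _ m R] m_comm[OF xc] ideal.Icarr[OF m_ideal] by auto
  then have "ideal_length R (m \<cdot> I) ?L \<le> 1" by (rule ideal_length_insert_le[OF mI(1) xc])
  then have "?L \<noteq> I" using two by (auto simp: one_enat_def)
  then obtain y where y: "y \<in> I" "y \<notin> ?L" using L(4) by blast
  have yc: "y \<in> carrier R" using ideal.Icarr[OF I_ideal y(1)] .
  have Py: "ideal (PIdl y) R" "PIdl y \<subseteq> I" using cgenideal_ideal[OF yc] cgenideal_minimal[OF I_ideal y(1)] by auto
  let ?M = "?L <+> PIdl y"
  have M: "ideal ?M R" "?L \<subseteq> ?M" "PIdl y \<subseteq> ?M" "?M \<subseteq> I"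
    using add_ideals[OF L(1) Py(1)] ideal_add_upper1[OF L(1) Py(1)] ideal_add_upper2[OF L(1) Py(1)]
      ideal_add_least[OF I_ideal L(4) Py(2)] by auto
  have "x \<in> ?L" using L(3) cgenideal_self[OF xc] by blast
  then have "m \<cdot> I \<subset> ?L" using L(2) x_notin by blast
  moreover have "y \<in> ?M" using M(3) cgenideal_self[OF yc] by blast
  then have "?L \<subset> ?M" using M(2) y(2) by blast
  ultimately have "1 + 1 \<le> ideal_length R (m \<cdot> I) ?L + ideal_length R ?L ?M"
    using ideal_length_pos mI(1) L(1) M(1) by (intro add_mono) blast+
  also have "\<dots> = ideal_length R (m \<cdot> I) ?M"
    using ideal_length_add[OF mI(1) L(1) M(1) L(2) M(2)] by simp
  finally have "ideal_length R (m \<cdot> I) I \<le> ideal_length R (m \<cdot> I) ?M"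
    using two by (simp add: one_enat_def numeral_2_eq_2)
  moreover have "ideal_length R (m \<cdot> I) ?M \<noteq> \<infinity>"
    using ideal_length_antimono[OF order_refl M(4), of R "m \<cdot> I"] two enat_finite_le[of _ "enat 2"] by simp
  ultimately have MI: "?M = I"
    using ideal_length_eq_imp'[OF mI(1) M(1) I_ideal _ M(4)] L(2) M(2) by blast
  let ?P = "PIdl x <+> PIdl y"
  have P: "ideal ?P R" "PIdl x \<subseteq> ?P" "PIdl y \<subseteq> ?P" "?P \<subseteq> I"
    using add_ideals[OF Px(1) Py(1)] ideal_add_upper1[OF Px(1) Py(1)] ideal_add_upper2[OF Px(1) Py(1)]
      ideal_add_least[OF I_ideal Px(2) Py(2)] by auto
  have Q: "ideal (?P <+> m \<cdot> I) R" "?P \<subseteq> ?P <+> m \<cdot> I" "m \<cdot> I \<subseteq> ?P <+> m \<cdot> I"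
    using add_ideals[OF P(1) mI(1)] ideal_add_upper1[OF P(1) mI(1)] ideal_add_upper2[OF P(1) mI(1)] by auto
  have "?L \<subseteq> ?P <+> m \<cdot> I" by (rule ideal_add_least[OF Q(1,3) order_trans[OF P(2) Q(2)]])
  then have "?M \<subseteq> ?P <+> m \<cdot> I" by (rule ideal_add_least[OF Q(1) _ order_trans[OF P(3) Q(2)]])
  then have "I \<subseteq> ?P <+> m \<cdot> I" using MI by simp
  then have "I \<subseteq> ?P" by (rule nakayama'[OF I_ideal P(1)])
  then show ?thesis using P(4) y(1) by blast
qed

end

locale extremal_gens = extremal +
  fixes y
  assumes yI: "y \<in> I" and I_gen: "I = PIdl x <+> PIdl y"
begin

lemma yc [simp]: "y \<in> carrier R" using yI ideal.Icarr[OF I_ideal] by blast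

text \<open>Among the monomials of degree \<open>n + 1\<close> in \<open>x\<close> and
  \<open>y\<close>, only \<open>y^(n+1)\<close> is not divisible by \<open>x\<close>. Thus
  \<open>I^(n+1)/xI^n\<close> is cyclic, which is what makes the later arguments with uniserial
  quotients possible.\<close>

lemma Ipow_gen: "Ipow (Suc n) = (\<otimes>) x ` Ipow n <+> PIdl (y [^] Suc n)"
proof (induct n)
  case 0 show ?case using scale_carrier[OF xc] by (simp add: I_gen[symmetric])
next
  case (Suc n)
  let ?K = "(\<otimes>) x ` Ipow (Suc n) <+> PIdl (y [^] Suc (Suc n))"
  have S: "ideal ((\<otimes>) x ` Ipow (Suc n)) R" "ideal (PIdl (y [^] Suc (Suc n))) R"
    using cgenideal_ideal[of "y [^] Suc (Suc n)"] by (simp_all add: scale_ideal)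
  have K: "ideal ?K R" using add_ideals S by blast
  show ?case
  proof
    show "?K \<subseteq> Ipow (Suc (Suc n))"
    proof (rule ideal_add_least)
      show "(\<otimes>) x ` Ipow (Suc n) \<subseteq> Ipow (Suc (Suc n))"
        unfolding ideal_pow_Suc2[OF I_ideal, of "Suc n"] using xI by (auto intro: ideal_prod.prod)
      show "PIdl (y [^] Suc (Suc n)) \<subseteq> Ipow (Suc (Suc n))"
        using ideal_pow_pow_mem[OF I_ideal yI, of "Suc (Suc n)"] by (intro cgenideal_minimal) auto
    qed simp
    show "Ipow (Suc (Suc n)) \<subseteq> ?K"
      unfolding ideal_pow_Suc2[OF I_ideal, of "Suc n"]
    proof (rule ideal_prod_least[OF K])
      fix a b assume a: "a \<in> I" and b: "b \<in> Ipow (Suc n)"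
      from a have "a \<in> PIdl x <+> PIdl y" using I_gen by simp
      then obtain a1 a2 where "a1 \<in> PIdl x" "a2 \<in> PIdl y" and a12: "a = a1 \<oplus> a2" by (rule mem_ideal_addE)
      then obtain u v where uv: "u \<in> carrier R" "v \<in> carrier R" "a1 = u \<otimes> x" "a2 = v \<otimes> y"
        by (auto simp: mem_cgenideal)
      from b have "b \<in> (\<otimes>) x ` Ipow n <+> PIdl (y [^] Suc n)" using Suc by simp
      then obtain b1 b2 where "b1 \<in> (\<otimes>) x ` Ipow n" "b2 \<in> PIdl (y [^] Suc n)" and b12: "b = b1 \<oplus> b2"
        by (rule mem_ideal_addE)
      then obtain c d where cd: "c \<in> Ipow n" "d \<in> carrier R" "b1 = x \<otimes> c" "b2 = d \<otimes> y [^] Suc n"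
        by (auto simp: mem_cgenideal)
      have cc: "c \<in> carrier R" "b \<in> carrier R" using cd(1) b Ipow_carrier by auto
      have "a \<otimes> b = x \<otimes> (u \<otimes> b) \<oplus> (v \<otimes> y) \<otimes> b"
        unfolding a12 uv(3,4) using uv(1,2) cc xc yc by algebra
      also have "(v \<otimes> y) \<otimes> b = x \<otimes> (v \<otimes> (y \<otimes> c)) \<oplus> (v \<otimes> d) \<otimes> y [^] Suc (Suc n)"
        unfolding b12 cd(3,4) using uv(1,2) cc(1) cd(2) by (simp add: r_distr m_ac)
      finally have "a \<otimes> b = x \<otimes> (u \<otimes> b \<oplus> v \<otimes> (y \<otimes> c)) \<oplus> (v \<otimes> d) \<otimes> y [^] Suc (Suc n)"
        using uv(1,2) cc cd(2) by (simp add: r_distr a_assoc)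
      moreover have "y \<otimes> c \<in> Ipow (Suc n)"
        unfolding ideal_pow_Suc2[OF I_ideal, of n] using yI cd(1) by (rule ideal_prod.prod)
      then have "u \<otimes> b \<oplus> v \<otimes> (y \<otimes> c) \<in> Ipow (Suc n)"
        using b uv(1,2) ideal.I_l_closed[of "Ipow (Suc n)" R] by (intro ideal_add_closed) auto
      moreover have "(v \<otimes> d) \<otimes> y [^] Suc (Suc n) \<in> PIdl (y [^] Suc (Suc n))"
        unfolding mem_cgenideal using uv(2) cd(2) by blast
      ultimately show "a \<otimes> b \<in> ?K" unfolding mem_ideal_add by blast
    qed
  qed
qed

lemma y_pow_m: "c \<in> m \<Longrightarrow> c \<otimes> y [^] Suc n \<in> Ipow (Suc (Suc n))"
  using ideal_prod.prod[of c m "y [^] Suc n" "Ipow (Suc n)" R] ideal_pow_pow_mem[OF I_ideal yI, of "Suc n"]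
    m_Ipow[of n] by simp

text \<open>The module \<open>I\<^sup>2/xI\<close> is uniserial, its submodules being generated by powers of \<open>y\<close>; multiplication
  by \<open>x\<close> embeds \<open>m/I\<close> into it.\<close>

lemma m_gen: "m \<subseteq> I \<or> (\<exists>z\<in>m. m = I <+> PIdl z)"
proof -
  let ?xI = "(\<otimes>) x ` I"
  let ?N = "\<lambda>n. ?xI <+> PIdl (y [^] Suc n)"
  have xIi: "ideal ?xI R" by auto
  have yi: "ideal (PIdl (y [^] Suc n)) R" for n using cgenideal_ideal[of "y [^] Suc n"] by simp
  have Ni: "ideal (?N n) R" for n using add_ideals[OF xIi yi] .
  have Nx: "?xI \<subseteq> ?N n" for n using ideal_add_upper1[OF xIi yi] .
  \<comment> \<open>Start of the descending family \<open>?N n = xI + (y^(n+1))\<close>: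
    \<open>xm\<close> lies in \<open>mI = I^2\<close>, which is \<open>?N 1\<close>.\<close>
  have N1: "(\<otimes>) x ` m \<subseteq> ?N 1"
  proof -
    have "(\<otimes>) x ` m \<subseteq> m \<cdot> I"
      using ideal_prod.prod[OF _ xI, of _ m R] m_comm[OF xc] ideal.Icarr[OF m_ideal] by auto
    then show ?thesis using mI Ipow_gen[of "Suc 0"] by simp
  qed
  \<comment> \<open>End of the family: \<open>y^(r+2)\<close> lies in
    \<open>I^(r+2) = x I^(r+1)\<close>, hence in \<open>xI\<close>.\<close>
  have Nlim: "?N (Suc r) = ?xI"
  proof -
    have "y [^] Suc (Suc r) \<in> Ipow (Suc (Suc r))" using ideal_pow_pow_mem[OF I_ideal yI] .
    also have "\<dots> = (\<otimes>) x ` Ipow (Suc r)" using reduction_mono[OF red, of "Suc r"] by (simp add: reduction_def)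
    also have "\<dots> \<subseteq> ?xI" using ideal_pow_antimono[OF I_ideal, of "Suc 0" "Suc r"] by auto
    finally have "PIdl (y [^] Suc (Suc r)) \<subseteq> ?xI" using cgenideal_minimal[OF xIi] by blast
    then have "?N (Suc r) \<subseteq> ?xI" by (intro ideal_add_least[OF xIi]) auto
    then show ?thesis using Nx by blast
  qed
  show ?thesis
  proof (cases "(\<otimes>) x ` m \<subseteq> ?xI")
    case True
    then show ?thesis
      using nonzerodiv_scale_subset_iff[OF x_nonzerodiv ideal_subset[OF m_ideal] ideal_subset[OF I_ideal]] by simp
  next
    case False
    then have "\<not> (\<otimes>) x ` m \<subseteq> ?N (Suc r)" unfolding Nlim .
    \<comment> \<open>The last member of the family that still contains \<open>xm\<close>; such an
      index exists because the family starts above \<open>xm\<close> and ends at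
      \<open>xI\<close>.\<close>
    then have "\<exists>n\<ge>1. (\<otimes>) x ` m \<subseteq> ?N n \<and> \<not> (\<otimes>) x ` m \<subseteq> ?N (Suc n)"
    proof (induct r)
      case 0 then show ?case using N1 by (intro exI[of _ 1]) simp
    next
      case (Suc k)
      show ?case
      proof (cases "(\<otimes>) x ` m \<subseteq> ?N (Suc k)")
        case True then show ?thesis using Suc(2) by (intro exI[of _ "Suc k"] conjI) simp_all
      next
        case False then show ?thesis by (rule Suc(1))
      qed
    qed
    then obtain n where n: "1 \<le> n" "(\<otimes>) x ` m \<subseteq> ?N n" "\<not> (\<otimes>) x ` m \<subseteq> ?N (Suc n)" by blast
    then obtain w where w: "w \<in> m" "x \<otimes> w \<notin> ?N (Suc n)" by blast
    have wc: "w \<in> carrier R" using ideal.Icarr[OF m_ideal w(1)] .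
    have "x \<otimes> w \<in> ?N n" using n(2) w(1) by blast
    then obtain g h where "g \<in> ?xI" "h \<in> PIdl (y [^] Suc n)" and gh: "x \<otimes> w = g \<oplus> h" by (rule mem_ideal_addE)
    then obtain i c where ic: "i \<in> I" "c \<in> carrier R" "g = x \<otimes> i" "h = c \<otimes> y [^] Suc n"
      by (auto simp: mem_cgenideal)
    have icc: "i \<in> carrier R" using ideal.Icarr[OF I_ideal ic(1)] .
    \<comment> \<open>A coefficient in \<open>m\<close> would push \<open>c y^(n+1)\<close> into
      \<open>I^(n+2)\<close>, hence into \<open>?N (Suc n)\<close>, against the choice of
      \<open>w\<close>.\<close>
    have "c \<notin> m"
    proof
      assume "c \<in> m"
      then have "h \<in> Ipow (Suc (Suc n))" using y_pow_m ic(4) by simp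
      also have "\<dots> = (\<otimes>) x ` Ipow (Suc n) <+> PIdl (y [^] Suc (Suc n))" by (rule Ipow_gen)
      also have "\<dots> \<subseteq> ?N (Suc n)"
        using ideal_pow_antimono[OF I_ideal, of "Suc 0" "Suc n"] by (intro ideal_add_mono) auto
      finally have "h \<in> ?N (Suc n)" .
      moreover have "g \<in> ?N (Suc n)" using ic(1,3) Nx[of "Suc n"] by blast
      ultimately have "g \<oplus> h \<in> ?N (Suc n)" by (rule ideal_add_closed[OF Ni, rotated])
      then show False using w(2) unfolding gh by (rule notE[rotated])
    qed
    then obtain b where b: "b \<in> carrier R" "b \<otimes> c = \<one>" using unit_if_notin_m ic(2) by blast
    \<comment> \<open>Subtracting the part in \<open>I\<close> and dividing by the unit
      \<open>c\<close> gives \<open>x z = y^(n+1)\<close>. Hence \<open>xm\<close> lies in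
      \<open>x(I + (z))\<close>, and \<open>x\<close> can be cancelled.\<close>
    define z where "z = b \<otimes> (w \<ominus> i)"
    have zm: "z \<in> m"
      unfolding z_def using ideal_diff_closed[OF m_ideal w(1), of i] ic(1) I_subset_m ideal.I_l_closed[OF m_ideal _ b(1)] by blast
    have zc: "z \<in> carrier R" using ideal.Icarr[OF m_ideal zm] .
    have "x \<otimes> z = b \<otimes> (x \<otimes> w \<ominus> x \<otimes> i)" unfolding z_def using b(1) wc icc xc by algebra
    also have "\<dots> = b \<otimes> ((x \<otimes> i \<oplus> c \<otimes> y [^] Suc n) \<ominus> x \<otimes> i)" unfolding gh ic(3,4) ..
    also have "(x \<otimes> i \<oplus> c \<otimes> y [^] Suc n) \<ominus> x \<otimes> i = c \<otimes> y [^] Suc n"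
    proof -
      have "p \<oplus> q \<ominus> p = q" if "p \<in> carrier R" "q \<in> carrier R" for p q using that by algebra
      then show ?thesis using icc ic(2) by simp
    qed
    also have "b \<otimes> (c \<otimes> y [^] Suc n) = (b \<otimes> c) \<otimes> y [^] Suc n" using b(1) ic(2) by (simp only: m_assoc yc nat_pow_closed)
    also have "\<dots> = y [^] Suc n" using b(2) by simp
    finally have xz: "x \<otimes> z = y [^] Suc n" .
    have Pz: "ideal (PIdl z) R" "PIdl z \<subseteq> m" using cgenideal_ideal[OF zc] cgenideal_minimal[OF m_ideal zm] by auto
    have "m \<subseteq> I <+> PIdl z"
    proof
      fix a assume a: "a \<in> m"
      have ac: "a \<in> carrier R" using ideal.Icarr[OF m_ideal a] .
      have "x \<otimes> a \<in> ?N n" using n(2) a by blast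
      then obtain g h where "g \<in> ?xI" "h \<in> PIdl (y [^] Suc n)" and gh: "x \<otimes> a = g \<oplus> h" by (rule mem_ideal_addE)
      then obtain i d where id: "i \<in> I" "d \<in> carrier R" "g = x \<otimes> i" "h = d \<otimes> y [^] Suc n"
        by (auto simp: mem_cgenideal)
      have icc: "i \<in> carrier R" using ideal.Icarr[OF I_ideal id(1)] .
      have "x \<otimes> a = x \<otimes> (i \<oplus> d \<otimes> z)"
        unfolding gh id(3,4) xz[symmetric] using icc id(2) zc by (simp add: r_distr m_lcomm)
      then have "a = i \<oplus> d \<otimes> z" using nonzerodiv_cancel[OF x_nonzerodiv ac] icc id(2) zc by simp
      moreover have "d \<otimes> z \<in> PIdl z" unfolding mem_cgenideal using id(2) by blast
      ultimately show "a \<in> I <+> PIdl z" unfolding mem_ideal_add using id(1) by blast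
    qed
    then show ?thesis using zm ideal_add_least[OF m_ideal I_subset_m Pz(2)] by blast
  qed
qed

text \<open>From \<open>mI = I^2 = xI + (y^2)\<close>, the coefficients can be taken in
  \<open>I\<close> itself. This is what puts the matrix entries below into \<open>I\<close>.\<close>

lemma mI_repr:
  assumes "a \<in> m \<cdot> I" shows "\<exists>\<alpha>\<in>I. \<exists>\<beta>\<in>I. a = \<alpha> \<otimes> x \<oplus> \<beta> \<otimes> y"
proof -
  have "a \<in> (\<otimes>) x ` I <+> PIdl (y [^] Suc (Suc 0))" using assms mI Ipow_gen[of "Suc 0"] by simp
  then obtain g h where "g \<in> (\<otimes>) x ` I" "h \<in> PIdl (y [^] Suc (Suc 0))" and gh: "a = g \<oplus> h"
    by (rule mem_ideal_addE)
  then obtain i c where ic: "i \<in> I" "c \<in> carrier R" "g = x \<otimes> i" "h = c \<otimes> (y \<otimes> y)"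
    by (auto simp: mem_cgenideal)
  have "a = i \<otimes> x \<oplus> (c \<otimes> y) \<otimes> y"
    unfolding gh ic(3,4) using ic(2) ideal.Icarr[OF I_ideal ic(1)] by (simp add: m_assoc m_comm[of x i])
  moreover have "c \<otimes> y \<in> I" using ideal.I_l_closed[OF I_ideal yI ic(2)] .
  ultimately show ?thesis using ic(1) by blast
qed

text \<open>Cayley-Hamilton for the multiplication by \<open>z\<close> on \<open>I = (x, y)\<close>, whose matrix has entries in \<open>I\<close>.\<close>

lemma square_mem:
  assumes z: "z \<in> m" shows "z \<otimes> z \<in> m \<cdot> I"
proof -
  have zc: "z \<in> carrier R" using ideal.Icarr[OF m_ideal z] .
  have mIi: "ideal (m \<cdot> I) R" using ideal_prod_is_ideal[OF m_ideal I_ideal] .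
  have "z \<otimes> x \<in> m \<cdot> I" "z \<otimes> y \<in> m \<cdot> I" using ideal_prod.prod[OF z] xI yI by auto
  then obtain a b c d where abcd: "a \<in> I" "b \<in> I" "c \<in> I" "d \<in> I"
    "z \<otimes> x = a \<otimes> x \<oplus> b \<otimes> y" "z \<otimes> y = c \<otimes> x \<oplus> d \<otimes> y"
    using mI_repr by meson
  have cc: "a \<in> carrier R" "b \<in> carrier R" "c \<in> carrier R" "d \<in> carrier R"
    using abcd(1-4) ideal.Icarr[OF I_ideal] by auto
  \<comment> \<open>\<open>z\<close> times the trace, minus the determinant, of the matrix with rows
    \<open>(a, b)\<close> and \<open>(c, d)\<close>.\<close>
  let ?t = "z \<otimes> (a \<oplus> d) \<oplus> (b \<otimes> c \<ominus> a \<otimes> d)"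
  have "x \<otimes> (z \<otimes> z) = z \<otimes> (z \<otimes> x)" using zc by (simp add: m_ac)
  also have "\<dots> = z \<otimes> (a \<otimes> x \<oplus> b \<otimes> y)" by (simp only: abcd(5))
  also have "\<dots> = a \<otimes> (z \<otimes> x) \<oplus> b \<otimes> (z \<otimes> y)" using cc zc xc yc by algebra
  also have "\<dots> = a \<otimes> (z \<otimes> x) \<oplus> b \<otimes> (c \<otimes> x \<oplus> d \<otimes> y)" by (simp only: abcd(6))
  \<comment> \<open>The remaining multiple of \<open>y\<close> is removed through
    \<open>b y = z x - a x\<close>. Everything then becomes a multiple of \<open>x\<close>, and
    regularity of \<open>x\<close> yields the characteristic equation itself.\<close>
  also have "\<dots> = a \<otimes> (z \<otimes> x) \<oplus> b \<otimes> c \<otimes> x \<oplus> d \<otimes> ((a \<otimes> x \<oplus> b \<otimes> y) \<ominus> a \<otimes> x)"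
    using cc zc xc yc by algebra
  also have "\<dots> = a \<otimes> (z \<otimes> x) \<oplus> b \<otimes> c \<otimes> x \<oplus> d \<otimes> (z \<otimes> x \<ominus> a \<otimes> x)" by (simp only: abcd(5))
  also have "\<dots> = x \<otimes> ?t" using cc zc xc by algebra
  finally have "z \<otimes> z = ?t" using nonzerodiv_cancel[OF x_nonzerodiv, of "z \<otimes> z" ?t] cc zc by simp
  moreover have "z \<otimes> (a \<oplus> d) \<in> m \<cdot> I" using ideal_prod.prod[OF z] ideal_add_closed[OF I_ideal] abcd by blast
  moreover have "b \<otimes> c \<in> m \<cdot> I" "a \<otimes> d \<in> m \<cdot> I"
    using ideal_prod.prod[of _ m _ I R] abcd I_subset_m by blast+
  ultimately show ?thesis using ideal_add_closed[OF mIi] ideal_diff_closed[OF mIi] by simp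
qed

section \<open>The square of \<open>m\<close>, the length of \<open>m/I\<close> and the generators
  of \<open>m\<close>\<close>

lemma mm: "m \<cdot> m = m \<cdot> I"
proof
  have mIi: "ideal (m \<cdot> I) R" using ideal_prod_is_ideal[OF m_ideal I_ideal] .
  show "m \<cdot> I \<subseteq> m \<cdot> m" by (rule ideal_prod_mono[OF order_refl I_subset_m])
  show "m \<cdot> m \<subseteq> m \<cdot> I"
  proof (cases "m \<subseteq> I")
    case True then show ?thesis by (rule ideal_prod_mono[OF order_refl])
  next
    case False
    then obtain z where z: "z \<in> m" "m = I <+> PIdl z" using m_gen by blast
    have zc: "z \<in> carrier R" using ideal.Icarr[OF m_ideal z(1)] .
    have zm: "a \<otimes> z \<in> m \<cdot> I" if a: "a \<in> m" for a
    proof -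
      from a z(2) have "a \<in> I <+> PIdl z" by simp
      then obtain i d where "i \<in> I" "d \<in> PIdl z" and id: "a = i \<oplus> d" by (rule mem_ideal_addE)
      then obtain c where c: "c \<in> carrier R" "d = c \<otimes> z" and i: "i \<in> I" by (auto simp: mem_cgenideal)
      have ic: "i \<in> carrier R" using ideal.Icarr[OF I_ideal i] .
      have "a \<otimes> z = z \<otimes> i \<oplus> c \<otimes> (z \<otimes> z)" unfolding id c(2) using ic c(1) zc by algebra
      moreover have "z \<otimes> i \<in> m \<cdot> I" using z(1) i by (rule ideal_prod.prod)
      moreover have "c \<otimes> (z \<otimes> z) \<in> m \<cdot> I" using ideal.I_l_closed[OF mIi square_mem[OF z(1)] c(1)] .
      ultimately show ?thesis using ideal_add_closed[OF mIi] by simp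
    qed
    show ?thesis
    proof (rule ideal_prod_least[OF mIi])
      fix a b assume a: "a \<in> m" and b: "b \<in> m"
      have ac: "a \<in> carrier R" using ideal.Icarr[OF m_ideal a] .
      from b z(2) have "b \<in> I <+> PIdl z" by simp
      then obtain i d where "i \<in> I" "d \<in> PIdl z" and id: "b = i \<oplus> d" by (rule mem_ideal_addE)
      then obtain c where c: "c \<in> carrier R" "d = c \<otimes> z" and i: "i \<in> I" by (auto simp: mem_cgenideal)
      have ic: "i \<in> carrier R" using ideal.Icarr[OF I_ideal i] .
      have "a \<otimes> b = a \<otimes> i \<oplus> c \<otimes> (a \<otimes> z)" unfolding id c(2) using ac ic c(1) zc by algebra
      moreover have "a \<otimes> i \<in> m \<cdot> I" using a i by (rule ideal_prod.prod)
      moreover have "c \<otimes> (a \<otimes> z) \<in> m \<cdot> I" using ideal.I_l_closed[OF mIi zm[OF a] c(1)] .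
      ultimately show "a \<otimes> b \<in> m \<cdot> I" using ideal_add_closed[OF mIi] by simp
    qed
  qed
qed

lemma length_m: "ideal_length R m (carrier R) = 1"
proof (rule antisym)
  have P: "ideal (PIdl \<one>) R" using cgenideal_ideal by simp
  have "PIdl \<one> = carrier R" using ideal_eq_carrier[OF P cgenideal_self] by simp
  then have "carrier R \<subseteq> m <+> PIdl \<one>" using ideal_add_upper2[OF m_ideal P] by simp
  then have "m <+> PIdl \<one> = carrier R" using ideal_subset[OF add_ideals[OF m_ideal P]] by blast
  moreover have "(\<otimes>) \<one> ` m \<subseteq> m" using ideal.Icarr[OF m_ideal] by auto
  ultimately show "ideal_length R m (carrier R) \<le> 1" using ideal_length_insert_le[OF m_ideal one_closed] by simp
  show "1 \<le> ideal_length R m (carrier R)"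
    using ideal_length_pos[OF m_ideal oneideal] ideal_subset[OF m_ideal] max.I_notcarr by blast
qed

lemma length_I_m: "ideal_length R I m \<le> 1"
proof (cases "m \<subseteq> I")
  case True then show ?thesis using I_subset_m by simp
next
  case False
  then obtain z where z: "z \<in> m" "m = I <+> PIdl z" using m_gen by blast
  have "(\<otimes>) z ` m \<subseteq> m \<cdot> m" using z(1) by (auto intro: ideal_prod.prod)
  also have "\<dots> \<subseteq> I" unfolding mm using ideal_prod_inter[OF m_ideal I_ideal] by blast
  finally show ?thesis using ideal_length_insert_le[OF I_ideal ideal.Icarr[OF m_ideal z(1)]] z(2) by simp
qed

lemma hilb_0: "enat (hilb 0) = ideal_length R I m + 1"
  using hilb_eq[of 0] ideal_length_add[OF I_ideal m_ideal oneideal I_subset_m ideal_subset[OF m_ideal]] length_m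
  by simp

lemma hilb_0_cases: "hilb 0 = 1 \<and> I = m \<or> hilb 0 = 2 \<and> I \<noteq> m"
proof (cases "I = m")
  case True then show ?thesis using hilb_0 by (simp add: one_enat_def)
next
  case False
  then have "ideal_length R I m = 1"
    using length_I_m ideal_length_pos[OF I_ideal m_ideal] I_subset_m by (metis antisym psubsetI)
  then show ?thesis using hilb_0 False by (simp add: one_enat_def)
qed

text \<open>The length of \<open>R/m^2\<close> is computed twice: as \<open>1\<close> plus the
  number of generators of \<open>m\<close>, and, since \<open>m^2 = I^2\<close>, as
  \<open>hilb 0 + hilb 1\<close> with \<open>hilb 1 = 2\<close>.\<close>

lemma min_gens_m: "min_gens R m = Suc (hilb 0)"
proof -
  have mm': "ideal (m \<cdot> m) R" "m \<cdot> m \<subseteq> m" "m \<cdot> m = Ipow (Suc (Suc 0))"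
    using ideal_prod_is_ideal[OF m_ideal m_ideal] ideal_prod_inter[OF m_ideal m_ideal] mm mI by auto
  have "enat (hilb 0 + hilb (Suc 0)) = ideal_length R (m \<cdot> m) (carrier R)"
    using Ipow_colength[of "Suc 0"] mm'(3) by (simp add: add.commute)
  also have "\<dots> = enat (min_gens R m) + 1"
    using ideal_length_add[OF mm'(1) m_ideal oneideal mm'(2) ideal_subset[OF m_ideal]] length_m
      min_gens_eq[OF m_ideal] by simp
  finally have "hilb 0 + hilb (Suc 0) = min_gens R m + 1" by (simp add: one_enat_def)
  then show ?thesis using hilb_min[of "Suc 0"] e3 by simp
qed

lemma Ipow_eq_mpow: "ideal_pow R m (Suc (Suc k)) = Ipow (Suc (Suc k))"
proof (induct k)
  case 0 show ?case using mm mI by (simp add: ideal_pow_Suc2[of m "Suc 0"])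
next
  case (Suc k) then show ?case using m_Ipow[of "Suc k"] by (simp add: ideal_pow_Suc2[of m "Suc (Suc k)"])
qed

text \<open>For \<open>I = m\<close> the Hilbert function is \<open>min (n + 1) e\<close> also at \<open>n = 0\<close>, and a dimension count shows that the
  initial form of \<open>x\<close> is a nonzerodivisor.\<close>

lemma x_initial_nonzerodiv:
  assumes "hilb 0 = 1" "a \<in> Ipow n" "x \<otimes> a \<in> Ipow (Suc (Suc n))"
  shows "a \<in> Ipow (Suc n)"
proof -
  have hilb: "hilb n = min (Suc n) e" for n using hilb_min[of n] assms(1) e3 by (cases n) auto
  let ?K = "Ipow (Suc (Suc n))"
  let ?S = "(\<otimes>) x ` Ipow n"
  let ?W = "?S <+> ?K"
  let ?L = "{a \<in> Ipow n. x \<otimes> a \<in> ?K}"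
  have Si: "ideal ?S R" "?S \<subseteq> Ipow (Suc n)"
    unfolding ideal_pow_Suc2[OF I_ideal, of n] using xI by (auto intro: ideal_prod.prod)
  have Ki: "ideal ?K R" "?K \<subseteq> Ipow (Suc n)" using ideal_pow_Suc_subset[OF I_ideal, of "Suc n"] by auto
  have W: "ideal ?W R" "?K \<subseteq> ?W" "?S \<subseteq> ?W" "?W \<subseteq> Ipow (Suc n)"
    using add_ideals[OF Si(1) Ki(1)] ideal_add_upper2[OF Si(1) Ki(1)] ideal_add_upper1[OF Si(1) Ki(1)]
      ideal_add_least[OF _ Si(2) Ki(2)] by auto
  have sum: "enat (hilb (Suc n)) = ideal_length R ?K ?W + ideal_length R ?W (Ipow (Suc n))"
    unfolding hilb_eq[symmetric] using ideal_length_add[OF Ki(1) W(1) _ W(2,4)] by simp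
  have ge: "enat (hilb n) \<le> ideal_length R ?K ?W"
  proof (cases "Suc n < e")
    \<comment> \<open>Here \<open>hilb (n + 1) = n + 2\<close>. The cokernel
      \<open>I^(n+1)/(xI^n + I^(n+2))\<close> is generated by \<open>y^(n+1)\<close> and killed by
      \<open>m\<close>, so it has length at most one and at least \<open>n + 1 = hilb n\<close> is
      left for the image.\<close>
    case True
    have Py: "ideal (PIdl (y [^] Suc n)) R" using cgenideal_ideal[of "y [^] Suc n"] by simp
    have WP: "ideal (?W <+> PIdl (y [^] Suc n)) R" using add_ideals[OF W(1) Py] .
    have "Ipow (Suc n) \<subseteq> ?W <+> PIdl (y [^] Suc n)"
      unfolding Ipow_gen[of n] by (rule ideal_add_mono[OF W(3) order_refl])
    then have "ideal_length R ?W (Ipow (Suc n)) \<le> ideal_length R ?W (?W <+> PIdl (y [^] Suc n))"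
      by (rule ideal_length_antimono[OF order_refl])
    also have "\<dots> \<le> 1"
    proof (rule ideal_length_insert_le[OF W(1)])
      show "(\<otimes>) (y [^] Suc n) ` m \<subseteq> ?W"
      proof
        fix b assume "b \<in> (\<otimes>) (y [^] Suc n) ` m"
        then obtain c where c: "c \<in> m" "b = y [^] Suc n \<otimes> c" by blast
        then have "b = c \<otimes> y [^] Suc n" using ideal.Icarr[OF m_ideal c(1)] by (simp only: m_comm yc nat_pow_closed)
        then show "b \<in> ?W" using y_pow_m[OF c(1)] W(2) by auto
      qed
    qed simp
    finally have le1: "ideal_length R ?W (Ipow (Suc n)) \<le> enat 1" by (simp add: one_enat_def)
    have "enat (Suc (Suc n)) = ideal_length R ?K ?W + ideal_length R ?W (Ipow (Suc n))"
      using sum hilb[of "Suc n"] True by simp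
    then show ?thesis using le1 hilb[of n] True
      by (cases "ideal_length R ?K ?W"; cases "ideal_length R ?W (Ipow (Suc n))") auto
  next
    \<comment> \<open>Now \<open>hilb n = e\<close> is also the length of \<open>I^n/xI^n\<close>,
      so the inclusion of \<open>xI^n\<close> in \<open>I^(n+1)\<close> is an equality and
      multiplication by \<open>x\<close> is onto.\<close>
    case False
    have "ideal_length R ?S (Ipow n) = enat e"
      using ideal_length_scale_self[of "Ipow n" x] Ipow_length_finite[OF order_refl, of n] x_nonzerodiv
        reduction_hilb[OF red order_refl] hilb_r by simp
    then have "?S = Ipow (Suc n)"
      using ideal_length_eq_imp[OF Si(1) _ _ Si(2) ideal_pow_Suc_subset[OF I_ideal]] hilb_eq[of n] hilb[of n] False
      by simp
    then have "?W = Ipow (Suc n)" using W(3,4) by blast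
    then show ?thesis using sum hilb[of n] hilb[of "Suc n"] False by simp
  qed
  \<comment> \<open>The image of multiplication by \<open>x\<close> has length at most that of
    \<open>I^n/?L\<close>, where \<open>?L\<close> represents the kernel. As \<open>?L\<close>
    contains \<open>I^(n+1)\<close>, the estimate forces \<open>?L = I^(n+1)\<close>.\<close>
  also have "\<dots> \<le> ideal_length R ?L (Ipow n)"
    by (rule ideal_length_vimage_le[OF Ki(1) _ xc W(2)]) simp
  finally have "ideal_length R (Ipow (Suc n)) (Ipow n) \<le> ideal_length R ?L (Ipow n)" by (simp add: hilb_eq)
  moreover have Li: "ideal ?L R"
    using ideal_zero[OF Ki(1)] ideal_zero[of "Ipow n"] ideal_add_closed[OF Ki(1)] ideal_add_closed[of "Ipow n"]
      ideal.I_l_closed[OF Ki(1)] ideal.I_l_closed[of "Ipow n" R] subsetD[OF Ipow_carrier]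
    by (intro idealI') (auto simp: r_distr m_lcomm[OF xc])
  moreover have "Ipow (Suc n) \<subseteq> ?L"
    using ideal_pow_Suc_subset[OF I_ideal, of n] ideal_prod.prod[OF xI, of _ "Ipow (Suc n)" R]
    by (auto simp: ideal_pow_Suc2[OF I_ideal, of "Suc n"])
  moreover have "ideal_length R ?L (Ipow n) \<noteq> \<infinity>"
    using ideal_length_antimono[OF \<open>Ipow (Suc n) \<subseteq> ?L\<close> order_refl, of R "Ipow n"] hilb_eq[of n]
      enat_finite_le[of _ "enat (hilb n)"] by simp
  ultimately have "Ipow (Suc n) = ?L"
    using ideal_length_eq_imp[of "Ipow (Suc n)" ?L "Ipow n"] by auto
  then show ?thesis using assms(2,3) by blast
qed

end



section \<open>The associated graded ring\<close>

lemma (in ring) finsum_ideal: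
  assumes "ideal K R" "finite A" "\<And>i. i \<in> A \<Longrightarrow> f i \<in> K" shows "finsum R f A \<in> K"
  using assms(2,3)
proof (induct A)
  case empty then show ?case using ideal_zero[OF assms(1)] by simp
next
  case (insert a A)
  have "f \<in> A \<rightarrow> carrier R" "f a \<in> carrier R" using insert ideal.Icarr[OF assms(1)] by auto
  then show ?case using insert ideal_add_closed[OF assms(1)] by simp
qed

lemma (in ring) coset_eq_iff:
  "ideal K R \<Longrightarrow> a \<in> carrier R \<Longrightarrow> b \<in> carrier R \<Longrightarrow> K +> a = K +> b \<longleftrightarrow> a \<ominus> b \<in> K"
  using quotient_eq_iff_same_a_r_cos by blast

lemma (in ring) coset_self: "ideal K R \<Longrightarrow> a \<in> carrier R \<Longrightarrow> a \<in> K +> a"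
  by (simp add: abelian_subgroup.a_rcos_self ideal.is_ideal abelian_subgroupI3 abelian_group_axioms ideal.axioms(1))

lemma (in ring) coset_zero: "ideal K R \<Longrightarrow> K +> \<zero> = K"
  using ideal_subset by simp

lemma (in ring) coset_eq_ideal_iff: "ideal K R \<Longrightarrow> a \<in> carrier R \<Longrightarrow> K +> a = K \<longleftrightarrow> a \<in> K"
  using coset_eq_iff[of K a \<zero>] coset_zero[of K] by (simp add: a_minus_def)

lemma (in ring) mem_coset:
  assumes "ideal K R" "a \<in> carrier R" shows "b \<in> K +> a \<longleftrightarrow> b \<in> carrier R \<and> K +> b = K +> a"
proof
  assume b: "b \<in> K +> a"
  then obtain k where k: "k \<in> K" "b = k \<oplus> a" by (auto simp: a_r_coset_def')
  have kc: "k \<in> carrier R" using ideal.Icarr[OF assms(1) k(1)] .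
  have "b \<ominus> a = k" unfolding k(2) using kc assms(2) by (simp add: a_minus_def a_assoc r_neg)
  then show "b \<in> carrier R \<and> K +> b = K +> a"
    using k kc assms coset_eq_iff[OF assms(1), of b a] by simp
next
  assume "b \<in> carrier R \<and> K +> b = K +> a"
  then show "b \<in> K +> a" using coset_self[OF assms(1), of b] by simp
qed

lemma (in ring) coset_add:
  assumes "ideal K R" "a \<in> carrier R" "b \<in> carrier R" shows "(K +> a) <+> (K +> b) = K +> (a \<oplus> b)"
  using assms by (simp add: abelian_subgroup.a_rcos_sum abelian_subgroupI3 abelian_group_axioms ideal.axioms(1))

locale adic_ring = cring +
  fixes J assumes J_ideal [simp, intro]: "ideal J R"
begin

abbreviation pw where "pw n \<equiv> ideal_pow R J n"
abbreviation G where "G \<equiv> assoc_graded R J"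

lemma pw_carr: "a \<in> pw n \<Longrightarrow> a \<in> carrier R"
  using ideal.Icarr[of "pw n" R] by simp

text \<open>The Rees algebra, as a subring of the polynomial ring. \<open>init\<close> maps it onto
  \<open>G\<close>, and the ring laws of \<open>G\<close> are transported along this map instead of
  being checked on cosets.\<close>

definition rees where "rees = {p \<in> up R. \<forall>n. p n \<in> pw n}"
definition init where "init p = (\<lambda>n. pw (Suc n) +> p n)"
definition homog where "homog d a = (\<lambda>n. pw (Suc n) +> (if n = d then a else \<zero>))"

lemma UP_mult: "p \<in> up R \<Longrightarrow> q \<in> up R \<Longrightarrow> (p \<otimes>\<^bsub>UP R\<^esub> q) n = (\<Oplus>i\<in>{..n}. p i \<otimes> q (n - i))"
  by (simp add: UP_def)

lemma UP_add: "p \<in> up R \<Longrightarrow> q \<in> up R \<Longrightarrow> (p \<oplus>\<^bsub>UP R\<^esub> q) n = p n \<oplus> q n"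
  by (simp add: UP_def)

lemma UP_carrier: "carrier (UP R) = up R"
  by (simp add: UP_def)

lemma UP_coeff: "p \<in> carrier (UP R) \<Longrightarrow> up_ring.coeff (UP R) p n = p n"
  by (simp add: UP_def)

lemma rees_subring: "subring rees (UP R)"
proof -
  interpret P: UP_cring R "UP R" by unfold_locales simp
  show ?thesis
  proof (rule P.P.subringI)
    show "rees \<subseteq> carrier (UP R)" by (auto simp: rees_def UP_carrier)
    have "\<one>\<^bsub>UP R\<^esub> n \<in> pw n" for n using ideal_zero[of "pw n"] by (cases n) (simp_all add: UP_def)
    then show "\<one>\<^bsub>UP R\<^esub> \<in> rees" using P.P.one_closed by (simp add: rees_def UP_carrier)
    fix p assume p: "p \<in> rees"
    then have pc: "p \<in> carrier (UP R)" "\<And>n. p n \<in> pw n" by (auto simp: rees_def UP_carrier)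
    have "(\<ominus>\<^bsub>UP R\<^esub> p) n = \<ominus> p n" for n
      using P.coeff_a_inv[OF pc(1), of n] UP_coeff[OF pc(1)] UP_coeff[OF P.P.a_inv_closed[OF pc(1)]] by metis
    moreover have "\<ominus> p n \<in> pw n" for n using pc(2) by (intro ideal_inv_closed) auto
    ultimately show "\<ominus>\<^bsub>UP R\<^esub> p \<in> rees"
      using P.P.a_inv_closed[OF pc(1)] by (simp add: rees_def UP_carrier)
    fix q assume q: "q \<in> rees"
    then have qc: "q \<in> carrier (UP R)" "\<And>n. q n \<in> pw n" by (auto simp: rees_def UP_carrier)
    have "(p \<otimes>\<^bsub>UP R\<^esub> q) n \<in> pw n" for n
    proof -
      have "p i \<otimes> q (n - i) \<in> pw n" if "i \<in> {..n}" for i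
        using ideal_pow_mult[OF J_ideal pc(2)[of i] qc(2)[of "n - i"]] that by simp
      then have "(\<Oplus>i\<in>{..n}. p i \<otimes> q (n - i)) \<in> pw n" by (intro finsum_ideal) auto
      then show ?thesis using UP_mult[of p q n] pc(1) qc(1) by (simp add: UP_carrier)
    qed
    then show "p \<otimes>\<^bsub>UP R\<^esub> q \<in> rees" using P.P.m_closed[OF pc(1) qc(1)] by (simp add: rees_def UP_carrier)
    have "(p \<oplus>\<^bsub>UP R\<^esub> q) n \<in> pw n" for n
      using UP_add[of p q n] pc(1) qc(1) ideal_add_closed[OF _ pc(2)[of n] qc(2)[of n]] by (simp add: UP_carrier)
    then show "p \<oplus>\<^bsub>UP R\<^esub> q \<in> rees" using P.P.a_closed[OF pc(1) qc(1)] by (simp add: rees_def UP_carrier)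
  qed
qed

lemma graded_mult_coset:
  assumes "a \<in> pw i" "b \<in> pw j"
  shows "graded_mult R J (i + j) (pw (Suc i) +> a) (pw (Suc j) +> b) = pw (Suc (i + j)) +> (a \<otimes> b)"
proof -
  have c: "a \<in> carrier R" "b \<in> carrier R" using assms pw_carr by auto
  have "pw (Suc (i + j)) +> (u \<otimes> v) = pw (Suc (i + j)) +> (a \<otimes> b)"
    if u: "u \<in> pw (Suc i) +> a" and v: "v \<in> pw (Suc j) +> b" for u v
  proof -
    obtain k l where k: "k \<in> pw (Suc i)" "u = k \<oplus> a" and l: "l \<in> pw (Suc j)" "v = l \<oplus> b"
      using u v by (auto simp: a_r_coset_def')
    have kc: "k \<in> carrier R" "l \<in> carrier R" using k l pw_carr by auto
    have "u \<otimes> v \<ominus> a \<otimes> b = (k \<otimes> l \<oplus> k \<otimes> b) \<oplus> a \<otimes> l" unfolding k(2) l(2) using kc c by algebra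
    moreover have "k \<otimes> l \<in> pw (Suc (i + j))"
      using ideal_pow_mult[OF J_ideal k(1) l(1)] ideal_pow_Suc_subset[OF J_ideal, of "Suc (i + j)"] by auto
    moreover have "k \<otimes> b \<in> pw (Suc (i + j))" "a \<otimes> l \<in> pw (Suc (i + j))"
      using ideal_pow_mult[OF J_ideal k(1) assms(2)] ideal_pow_mult[OF J_ideal assms(1) l(1)] by simp_all
    ultimately have "u \<otimes> v \<ominus> a \<otimes> b \<in> pw (Suc (i + j))" by (simp add: ideal_add_closed)
    then show ?thesis using coset_eq_iff[of "pw (Suc (i + j))" "u \<otimes> v" "a \<otimes> b"] k(2) l(2) kc c by simp
  qed
  note eq = this
  have ne: "pw (Suc i) +> a \<noteq> {}" "pw (Suc j) +> b \<noteq> {}"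
    using coset_self[of "pw (Suc i)" a] coset_self[of "pw (Suc j)" b] c by auto
  have "(\<Union>v\<in>pw (Suc j) +> b. pw (Suc (i + j)) +> (u \<otimes> v)) = pw (Suc (i + j)) +> (a \<otimes> b)"
    if "u \<in> pw (Suc i) +> a" for u
    by (rule SUP_eq_const[OF ne(2)]) (rule eq[OF that])
  then have "(\<Union>u\<in>pw (Suc i) +> a. \<Union>v\<in>pw (Suc j) +> b. pw (Suc (i + j)) +> (u \<otimes> v))
      = pw (Suc (i + j)) +> (a \<otimes> b)"
    by (rule SUP_eq_const[OF ne(1)])
  then show ?thesis unfolding graded_mult_def Suc_eq_plus1[symmetric] .
qed

lemma G_carrier_iff:
  "f \<in> carrier G \<longleftrightarrow> (\<forall>n. \<exists>a\<in>pw n. f n = pw (Suc n) +> a) \<and> finite {n. f n \<noteq> pw (Suc n)}"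
  by (auto simp: assoc_graded_def graded_piece_def)

lemma init_carrier:
  assumes "p \<in> rees" shows "init p \<in> carrier G"
proof -
  have p: "p \<in> up R" "\<And>n. p n \<in> pw n" using assms by (auto simp: rees_def)
  then obtain N where "bound \<zero> N p" by blast
  then have N: "\<And>n. N < n \<Longrightarrow> p n = \<zero>" by (simp add: bound.bound)
  have "init p n = pw (Suc n)" if "N < n" for n
    using N[OF that] coset_zero[of "pw (Suc n)"] by (simp add: init_def)
  then have "{n. init p n \<noteq> pw (Suc n)} \<subseteq> {..N}" by (metis (mono_tags, lifting) atMost_iff mem_Collect_eq not_le subsetI)
  then have "finite {n. init p n \<noteq> pw (Suc n)}" using finite_subset by blast
  then show ?thesis unfolding G_carrier_iff using p(2) by (auto simp: init_def)
qed

lemma init_surj: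
  assumes "f \<in> carrier G" shows "\<exists>p\<in>rees. f = init p"
proof -
  have f: "\<exists>a. a \<in> pw n \<and> f n = pw (Suc n) +> a" "finite {n. f n \<noteq> pw (Suc n)}" for n
    using assms by (auto simp: G_carrier_iff)
  \<comment> \<open>Trivial components receive the representative zero, so that the lift has bounded
    support and is a polynomial.\<close>
  define p where "p n = (if f n = pw (Suc n) then \<zero> else SOME a. a \<in> pw n \<and> f n = pw (Suc n) +> a)" for n
  have p: "p n \<in> pw n \<and> f n = pw (Suc n) +> p n" for n
    using someI_ex[OF f(1)[of n]] coset_zero[of "pw (Suc n)"] ideal_zero[of "pw n"] by (simp add: p_def)
  obtain N where N: "\<And>n. f n \<noteq> pw (Suc n) \<Longrightarrow> n \<le> N" using f(2) finite_nat_set_iff_bounded_le by auto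
  have "bound \<zero> N p" using N by (auto simp: p_def bound_def dest: leD)
  moreover have "p n \<in> carrier R" for n using p[of n] pw_carr[of "p n" n] by blast
  ultimately have "p \<in> up R" by (intro mem_upI) auto
  then have "p \<in> rees" using p by (simp add: rees_def)
  moreover have "f = init p" using p by (simp add: init_def fun_eq_iff)
  ultimately show ?thesis by blast
qed

lemma init_mult:
  assumes "p \<in> rees" "q \<in> rees" shows "init (p \<otimes>\<^bsub>UP R\<^esub> q) = init p \<otimes>\<^bsub>G\<^esub> init q"
proof
  fix n
  have p: "p \<in> up R" "\<And>n. p n \<in> pw n" and q: "q \<in> up R" "\<And>n. q n \<in> pw n"
    using assms by (auto simp: rees_def)
  interpret K: ideal "pw (Suc n)" R by simp
  interpret h: ring_hom_ring R "R Quot pw (Suc n)" "(+>) (pw (Suc n))" by (rule K.rcos_ring_hom_ring)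
  have g: "graded_mult R J n (init p i) (init q (n - i)) = pw (Suc n) +> (p i \<otimes> q (n - i))" if "i \<le> n" for i
    using graded_mult_coset[OF p(2)[of i] q(2)[of "n - i"]] that by (simp add: init_def)
  have mem: "(\<lambda>i. p i \<otimes> q (n - i)) \<in> {..n} \<rightarrow> carrier R" using p(2) q(2) pw_carr by blast
  have "(init p \<otimes>\<^bsub>G\<^esub> init q) n
      = finsum (R Quot pw (Suc n)) (\<lambda>i. graded_mult R J n (init p i) (init q (n - i))) {..n}"
    by (simp add: assoc_graded_def)
  also have "\<dots> = finsum (R Quot pw (Suc n)) ((+>) (pw (Suc n)) \<circ> (\<lambda>i. p i \<otimes> q (n - i))) {..n}"
    using mem by (intro h.S.finsum_cong') (auto simp: g Pi_def)
  also have "\<dots> = pw (Suc n) +> (\<Oplus>i\<in>{..n}. p i \<otimes> q (n - i))"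
    using h.hom_finsum[OF mem] by simp
  also have "\<dots> = init (p \<otimes>\<^bsub>UP R\<^esub> q) n" using UP_mult[OF p(1) q(1)] by (simp add: init_def)
  finally show "init (p \<otimes>\<^bsub>UP R\<^esub> q) n = (init p \<otimes>\<^bsub>G\<^esub> init q) n" by simp
qed

lemma init_add:
  assumes "p \<in> rees" "q \<in> rees" shows "init (p \<oplus>\<^bsub>UP R\<^esub> q) = init p \<oplus>\<^bsub>G\<^esub> init q"
proof
  fix n
  have "p \<in> up R" "p n \<in> carrier R" "q \<in> up R" "q n \<in> carrier R"
    using assms by (auto simp: rees_def)
  then show "init (p \<oplus>\<^bsub>UP R\<^esub> q) n = (init p \<oplus>\<^bsub>G\<^esub> init q) n"
    by (simp add: init_def assoc_graded_def UP_add coset_add)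
qed

lemma G_cring: "cring G"
proof -
  interpret P: UP_cring R "UP R" by unfold_locales simp
  let ?S = "UP R\<lparr>carrier := rees\<rparr>"
  interpret S: ring ?S by (rule P.P.subring_is_ring[OF rees_subring])
  have one: "init \<one>\<^bsub>UP R\<^esub> = \<one>\<^bsub>G\<^esub>" by (simp add: init_def UP_def assoc_graded_def fun_eq_iff)
  have zero: "init \<zero>\<^bsub>UP R\<^esub> = \<zero>\<^bsub>G\<^esub>"
    by (simp add: init_def UP_def assoc_graded_def fun_eq_iff coset_zero)
  have hom: "init \<in> ring_hom ?S G"
    by (rule ring_hom_memI) (simp_all add: init_carrier init_mult init_add one)
  have img: "init ` rees = carrier G" using init_carrier init_surj by blast
  have "ring (G\<lparr>carrier := init ` carrier ?S, zero := init \<zero>\<^bsub>?S\<^esub>\<rparr>)"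
    by (rule S.ring_hom_imp_img_ring[OF hom])
  then have "ring G" using img zero by simp
  then interpret G: ring G .
  show ?thesis
  proof (intro cring.intro G.ring_axioms comm_monoid.intro comm_monoid_axioms.intro)
    show "monoid G" by (rule G.monoid_axioms)
    fix f g assume "f \<in> carrier G" "g \<in> carrier G"
    then obtain p q where pq: "p \<in> rees" "q \<in> rees" "f = init p" "g = init q" using init_surj by metis
    have "p \<in> carrier (UP R)" "q \<in> carrier (UP R)" using pq by (auto simp: rees_def UP_carrier)
    then have "p \<otimes>\<^bsub>UP R\<^esub> q = q \<otimes>\<^bsub>UP R\<^esub> p" by (rule P.P.m_comm)
    then show "f \<otimes>\<^bsub>G\<^esub> g = g \<otimes>\<^bsub>G\<^esub> f" using pq init_mult by metis
  qed
qed

sublocale G: cring G by (rule G_cring)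

section \<open>Computing in \<open>G\<close> with representatives of components\<close>

lemma G_zero: "\<zero>\<^bsub>G\<^esub> n = pw (Suc n)"
  by (simp add: assoc_graded_def)

text \<open>Since components are cosets, \<open>a \<in> f n\<close> serves as the relation that
  \<open>a\<close> represents the part of degree \<open>n\<close>; identities in \<open>G\<close>
  are proved by exhibiting a common representative in each degree.\<close>

lemma G_comp:
  assumes "f \<in> carrier G" "a \<in> f n" shows "a \<in> pw n" "f n = pw (Suc n) +> a"
proof -
  obtain b where b: "b \<in> pw n" "f n = pw (Suc n) +> b" using assms(1) by (auto simp: G_carrier_iff)
  have ab: "a \<in> carrier R" "pw (Suc n) +> a = pw (Suc n) +> b"
    using mem_coset[of "pw (Suc n)" b a] assms(2) b pw_carr by auto
  then show "f n = pw (Suc n) +> a" using b(2) by simp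
  have "a \<ominus> b \<in> pw (Suc n)" using coset_eq_iff[of "pw (Suc n)" a b] ab b(1) pw_carr by simp
  then have "a \<ominus> b \<in> pw n" using ideal_pow_Suc_subset[OF J_ideal] by blast
  then have "(a \<ominus> b) \<oplus> b \<in> pw n" using b(1) by (simp add: ideal_add_closed)
  moreover have "(a \<ominus> b) \<oplus> b = a" using ab(1) b(1) pw_carr by (simp add: a_minus_def a_assoc l_neg)
  ultimately show "a \<in> pw n" by simp
qed

lemma G_comp_ex: "f \<in> carrier G \<Longrightarrow> \<exists>a. a \<in> f n"
proof -
  assume "f \<in> carrier G"
  then obtain a where "a \<in> pw n" "f n = pw (Suc n) +> a" by (auto simp: G_carrier_iff)
  then show ?thesis using coset_self[of "pw (Suc n)" a] pw_carr[of a n] by auto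
qed

lemma G_comp_zero_iff: "f \<in> carrier G \<Longrightarrow> a \<in> f n \<Longrightarrow> f n = pw (Suc n) \<longleftrightarrow> a \<in> pw (Suc n)"
  using G_comp[of f a n] coset_eq_ideal_iff[of "pw (Suc n)" a] pw_carr[of a n] by simp

lemma G_comp_add:
  assumes "f \<in> carrier G" "g \<in> carrier G" "a \<in> f n" "b \<in> g n" shows "a \<oplus> b \<in> (f \<oplus>\<^bsub>G\<^esub> g) n"
proof -
  have "(f \<oplus>\<^bsub>G\<^esub> g) n = f n <+> g n" by (simp add: assoc_graded_def)
  then show ?thesis using assms(3,4) by (auto simp: mem_ideal_add)
qed

lemma G_comp_minus:
  assumes "f \<in> carrier G" "g \<in> carrier G" "a \<in> f n" "b \<in> g n" shows "a \<ominus> b \<in> (f \<ominus>\<^bsub>G\<^esub> g) n"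
proof -
  have ng: "\<ominus>\<^bsub>G\<^esub> g \<in> carrier G" using assms by simp
  obtain c where c: "c \<in> (\<ominus>\<^bsub>G\<^esub> g) n" using G_comp_ex[OF ng] by blast
  have cc: "b \<in> carrier R" "c \<in> carrier R" using G_comp(1)[OF assms(2,4)] G_comp(1)[OF ng c] pw_carr by auto
  have "b \<oplus> c \<in> (g \<oplus>\<^bsub>G\<^esub> \<ominus>\<^bsub>G\<^esub> g) n" using G_comp_add[OF assms(2) ng assms(4) c] .
  then have "b \<oplus> c \<in> pw (Suc n)" using assms(2) by (simp add: G.r_neg G_zero)
  then have "\<ominus> (b \<oplus> c) \<in> pw (Suc n)" by (simp add: ideal_inv_closed)
  moreover have "\<ominus> (b \<oplus> c) = \<ominus> b \<ominus> c" using cc by algebra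
  ultimately have "pw (Suc n) +> \<ominus> b = pw (Suc n) +> c" using coset_eq_iff[of "pw (Suc n)" "\<ominus> b" c] cc by simp
  then have "\<ominus> b \<in> (\<ominus>\<^bsub>G\<^esub> g) n" using G_comp(2)[OF ng c] coset_self[of "pw (Suc n)" "\<ominus> b"] cc by simp
  then show ?thesis unfolding a_minus_def using G_comp_add[OF assms(1) ng assms(3)] by blast
qed

lemma G_eqI:
  assumes "f \<in> carrier G" "g \<in> carrier G" "\<And>n. \<exists>a. a \<in> f n \<and> a \<in> g n" shows "f = g"
proof
  fix n
  obtain a where "a \<in> f n" "a \<in> g n" using assms(3) by blast
  then show "f n = g n" using G_comp(2) assms(1,2) by metis
qed

lemma homog_carrier: "a \<in> pw d \<Longrightarrow> homog d a \<in> carrier G"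
proof -
  assume a: "a \<in> pw d"
  have "{n. homog d a n \<noteq> pw (Suc n)} \<subseteq> {d}" by (auto simp: homog_def coset_zero)
  then have "finite {n. homog d a n \<noteq> pw (Suc n)}" using finite_subset by blast
  then show ?thesis unfolding G_carrier_iff using a ideal_zero by (auto simp: homog_def)
qed

lemma homog_comp: "a \<in> pw d \<Longrightarrow> a \<in> homog d a d"
  using coset_self[of "pw (Suc d)" a] pw_carr by (simp add: homog_def)

lemma homog_other: "n \<noteq> d \<Longrightarrow> homog d a n = pw (Suc n)"
  by (simp add: homog_def coset_zero)

text \<open>With a homogeneous factor only one term of the convolution survives. In the later
  sections all products with \<open>T\<close> and with constants are evaluated through this shift of
  degrees.\<close>

lemma homog_mult:
  assumes a: "a \<in> pw d" and f: "f \<in> carrier G"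
  shows "b \<in> f n \<Longrightarrow> a \<otimes> b \<in> (homog d a \<otimes>\<^bsub>G\<^esub> f) (d + n)"
    and "k < d \<Longrightarrow> (homog d a \<otimes>\<^bsub>G\<^esub> f) k = pw (Suc k)"
proof -
  obtain p where p: "p \<in> rees" "f = init p" using init_surj[OF f] by blast
  have pc: "p \<in> up R" "\<And>n. p n \<in> pw n" "\<And>n. p n \<in> carrier R" using p by (auto simp: rees_def)
  have ac: "a \<in> carrier R" using a pw_carr by blast
  let ?q = "\<lambda>n. if n = d then a else \<zero>"
  have "bound \<zero> d ?q" by (auto simp: bound_def)
  then have q: "?q \<in> up R" using ac by (intro mem_upI) auto
  then have qr: "?q \<in> rees" using a ideal_zero by (simp add: rees_def)
  have h: "homog d a = init ?q" by (simp add: homog_def init_def)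
  have m: "(homog d a \<otimes>\<^bsub>G\<^esub> f) k = pw (Suc k) +> (\<Oplus>i\<in>{..k}. ?q i \<otimes> p (k - i))" for k
  proof -
    have "(homog d a \<otimes>\<^bsub>G\<^esub> f) k = init (?q \<otimes>\<^bsub>UP R\<^esub> p) k"
      unfolding h p(2) init_mult[OF qr p(1)] ..
    then show ?thesis unfolding init_def UP_mult[OF q pc(1)] .
  qed
  show "(homog d a \<otimes>\<^bsub>G\<^esub> f) k = pw (Suc k)" if "k < d"
  proof -
    have "(\<Oplus>i\<in>{..k}. ?q i \<otimes> p (k - i)) = (\<Oplus>i\<in>{..k}. \<zero>)"
      using that pc(3) ac by (intro finsum_cong') auto
    then show ?thesis using m coset_zero[of "pw (Suc k)"] by simp
  qed
  show "a \<otimes> b \<in> (homog d a \<otimes>\<^bsub>G\<^esub> f) (d + n)" if b: "b \<in> f n"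
  proof -
    have "(\<Oplus>i\<in>{..d + n}. ?q i \<otimes> p (d + n - i)) = (\<Oplus>i\<in>{..d + n}. if d = i then a \<otimes> p (d + n - i) else \<zero>)"
      using pc(3) ac by (intro finsum_cong') auto
    also have "\<dots> = a \<otimes> p n"
      using add.finprod_singleton[of d "{..d + n}" "\<lambda>i. a \<otimes> p (d + n - i)"] pc(3) ac by simp
    finally have e: "(homog d a \<otimes>\<^bsub>G\<^esub> f) (d + n) = pw (Suc (d + n)) +> (a \<otimes> p n)" using m by simp
    have bc: "b \<in> carrier R" using G_comp(1)[OF f b] pw_carr by blast
    have "pw (Suc n) +> b = pw (Suc n) +> p n" using G_comp(2)[OF f b] p(2) by (simp add: init_def)
    then have "b \<ominus> p n \<in> pw (Suc n)" using coset_eq_iff[of "pw (Suc n)" b "p n"] bc pc(3) by simp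
    then have "a \<otimes> (b \<ominus> p n) \<in> pw (d + Suc n)" by (rule ideal_pow_mult[OF J_ideal a])
    moreover have "a \<otimes> (b \<ominus> p n) = a \<otimes> b \<ominus> a \<otimes> p n"
    proof -
      have "u \<otimes> (v \<ominus> w) = u \<otimes> v \<ominus> u \<otimes> w" if "u \<in> carrier R" "v \<in> carrier R" "w \<in> carrier R" for u v w
        using that by algebra
      then show ?thesis using ac bc pc(3) by simp
    qed
    ultimately have "pw (Suc (d + n)) +> (a \<otimes> b) = pw (Suc (d + n)) +> (a \<otimes> p n)"
      using coset_eq_iff[of "pw (Suc (d + n))" "a \<otimes> b" "a \<otimes> p n"] ac bc pc(3) by simp
    then show ?thesis unfolding e using coset_self[of "pw (Suc (d + n))" "a \<otimes> b"] ac bc by simp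
  qed
qed

text \<open>The class of \<open>z\<close> in degree zero is nonzero and annihilates the maximal
  ideal. The two conditions on products treat the degree zero part, represented in \<open>m\<close>,
  and the positive degrees.\<close>

lemma depth_assoc_graded_0:
  assumes z: "z \<in> carrier R" "z \<notin> J"
    and zm: "\<And>b. b \<in> m \<Longrightarrow> z \<otimes> b \<in> J" "\<And>n b. b \<in> pw (Suc n) \<Longrightarrow> z \<otimes> b \<in> pw (Suc (Suc n))"
  shows "depth G (assoc_graded_max R m J) = 0"
proof (rule G.depth_eq_0)
  have z0: "z \<in> pw 0" using z by simp
  show h: "homog 0 z \<in> carrier G" using homog_carrier[OF z0] .
  have "homog 0 z 0 \<noteq> pw (Suc 0)" using G_comp_zero_iff[OF h homog_comp[OF z0]] z by simp
  then show "homog 0 z \<noteq> \<zero>\<^bsub>G\<^esub>" using G_zero[of 0] by metis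
  fix f assume "f \<in> assoc_graded_max R m J"
  then have f: "f \<in> carrier G" "f 0 \<subseteq> m" by (auto simp: assoc_graded_max_def)
  have "homog 0 z \<otimes>\<^bsub>G\<^esub> f = \<zero>\<^bsub>G\<^esub>"
  proof (rule G_eqI)
    show "homog 0 z \<otimes>\<^bsub>G\<^esub> f \<in> carrier G" using h f by simp
    fix n
    obtain b where b: "b \<in> f n" using G_comp_ex[OF f(1)] by blast
    have "z \<otimes> b \<in> (homog 0 z \<otimes>\<^bsub>G\<^esub> f) n" using homog_mult(1)[OF z0 f(1) b] by simp
    moreover have "z \<otimes> b \<in> pw (Suc n)"
    proof (cases n)
      case 0 then show ?thesis using zm(1) b f(2) by auto
    next
      case (Suc k) then show ?thesis using zm(2) G_comp(1)[OF f(1) b] by simp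
    qed
    ultimately show "\<exists>a. a \<in> (homog 0 z \<otimes>\<^bsub>G\<^esub> f) n \<and> a \<in> \<zero>\<^bsub>G\<^esub> n" by (auto simp: G_zero)
  qed simp
  then show "f \<otimes>\<^bsub>G\<^esub> homog 0 z = \<zero>\<^bsub>G\<^esub>" using G.m_comm f(1) h by simp
qed

end



section \<open>Cohen-Macaulayness of the graded ring of the maximal ideal\<close>

lemma (in ring) diff_diff: "a \<in> carrier R \<Longrightarrow> b \<in> carrier R \<Longrightarrow> a \<ominus> (a \<ominus> b) = b"
  by (simp add: a_minus_def minus_add r_neg2)

lemma (in noetherian_ring) ascending_ideals_stable:
  assumes "\<And>i. ideal (\<Gamma> i) R" "\<And>i::nat. \<Gamma> i \<subseteq> \<Gamma> (Suc i)"
  shows "\<exists>j. \<forall>i\<ge>j. \<Gamma> i = \<Gamma> j"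
proof -
  have mono: "\<Gamma> i \<subseteq> \<Gamma> k" if "i \<le> k" for i k by (rule lift_Suc_mono_le[where f = \<Gamma>, OF assms(2) that])
  have "subset.chain {I. ideal I R} (range \<Gamma>)"
    unfolding pred_on.chain_def using assms(1) mono nat_le_linear by blast
  then have "\<Union>(range \<Gamma>) \<in> range \<Gamma>" by (intro ideal_chain_is_trivial) auto
  then obtain j where j: "\<Union>(range \<Gamma>) = \<Gamma> j" by blast
  have "\<Gamma> i = \<Gamma> j" if "j \<le> i" for i using mono[OF that] j by blast
  then show ?thesis by blast
qed

text \<open>If the chain \<open>tower s\<close> stabilises then \<open>h\<close> is integral over \<open>K\<close> modulo \<open>Q\<close>, and a monic equation of
  minimal degree has a nonzero constant term.\<close>

primrec tower :: "('a, 'b) ring_scheme \<Rightarrow> 'a set \<Rightarrow> 'a set \<Rightarrow> 'a \<Rightarrow> nat \<Rightarrow> 'a set" where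
  "tower R Q K h 0 = Q"
| "tower R Q K h (Suc s) = {p \<oplus>\<^bsub>R\<^esub> h \<otimes>\<^bsub>R\<^esub> q \<oplus>\<^bsub>R\<^esub> c | p q c. p \<in> K \<and> q \<in> tower R Q K h s \<and> c \<in> Q}"

context cring
begin

context
  fixes Q K h
  assumes Q: "ideal Q R" and K: "K \<subseteq> carrier R" "\<zero> \<in> K" and h: "h \<in> carrier R"
begin

lemma Qc: "c \<in> Q \<Longrightarrow> c \<in> carrier R"
  by (rule ideal.Icarr[OF Q])

lemma tower_carrier: "tower R Q K h s \<subseteq> carrier R"
proof (induct s)
  case 0 show ?case using ideal_subset[OF Q] by simp
next
  case (Suc s) then show ?case using K h Qc by auto
qed

lemma tower_add_Q: "a \<in> tower R Q K h s \<Longrightarrow> b \<in> Q \<Longrightarrow> a \<oplus> b \<in> tower R Q K h s"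
proof (cases s)
  case 0
  assume "a \<in> tower R Q K h s" "b \<in> Q" then show ?thesis using 0 ideal_add_closed[OF Q] by simp
next
  case (Suc k)
  assume a: "a \<in> tower R Q K h s" and b: "b \<in> Q"
  then obtain p q c where pqc: "p \<in> K" "q \<in> tower R Q K h k" "c \<in> Q" "a = p \<oplus> h \<otimes> q \<oplus> c" using Suc by auto
  have cc: "p \<in> carrier R" "q \<in> carrier R" "c \<in> carrier R" "b \<in> carrier R"
    using pqc K tower_carrier[of k] b Qc by auto
  have "a \<oplus> b = p \<oplus> h \<otimes> q \<oplus> (c \<oplus> b)" unfolding pqc(4) using cc h by (simp add: a_assoc)
  moreover have "c \<oplus> b \<in> Q" using ideal_add_closed[OF Q pqc(3) b] .
  ultimately show ?thesis using pqc Suc by auto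
qed

lemma tower_Q: "Q \<subseteq> tower R Q K h s"
proof (induct s)
  case (Suc s)
  show ?case
  proof
    fix c assume c: "c \<in> Q"
    have "c = \<zero> \<oplus> h \<otimes> \<zero> \<oplus> c" using h Qc[OF c] by simp
    moreover have "\<zero> \<in> tower R Q K h s" using Suc ideal_zero[OF Q] by blast
    ultimately show "c \<in> tower R Q K h (Suc s)" using K(2) c by auto
  qed
qed simp

lemma tower_mono: "tower R Q K h s \<subseteq> tower R Q K h (Suc s)"
proof (induct s)
  case 0 show ?case using tower_Q[of 1] by simp
next
  case (Suc s) then show ?case by auto
qed

lemma tower_mono': "i \<le> j \<Longrightarrow> tower R Q K h i \<subseteq> tower R Q K h j"
  by (rule lift_Suc_mono_le[where f = "tower R Q K h", OF tower_mono])

lemma tower_add: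
  assumes K_add: "\<And>p q. p \<in> K \<Longrightarrow> q \<in> K \<Longrightarrow> p \<oplus> q \<in> K"
  shows "a \<in> tower R Q K h s \<Longrightarrow> b \<in> tower R Q K h s \<Longrightarrow> a \<oplus> b \<in> tower R Q K h s"
proof (induct s arbitrary: a b)
  case 0 then show ?case using ideal_add_closed[OF Q] by simp
next
  case (Suc s)
  obtain p q c where 1: "p \<in> K" "q \<in> tower R Q K h s" "c \<in> Q" "a = p \<oplus> h \<otimes> q \<oplus> c" using Suc(2) by auto
  obtain p' q' c' where 2: "p' \<in> K" "q' \<in> tower R Q K h s" "c' \<in> Q" "b = p' \<oplus> h \<otimes> q' \<oplus> c'"
    using Suc(3) by auto
  have cc: "p \<in> carrier R" "q \<in> carrier R" "c \<in> carrier R" "p' \<in> carrier R" "q' \<in> carrier R" "c' \<in> carrier R"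
    using 1(1-3) 2(1-3) K(1) tower_carrier[of s] Qc by auto
  have "a \<oplus> b = (p \<oplus> p') \<oplus> h \<otimes> (q \<oplus> q') \<oplus> (c \<oplus> c')" unfolding 1(4) 2(4) using cc h by algebra
  moreover have "p \<oplus> p' \<in> K" "q \<oplus> q' \<in> tower R Q K h s" "c \<oplus> c' \<in> Q"
    using K_add[OF 1(1) 2(1)] Suc(1)[OF 1(2) 2(2)] ideal_add_closed[OF Q 1(3) 2(3)] .
  ultimately show ?case by auto
qed

lemma tower_mult:
  assumes t: "t \<in> carrier R" and K_t: "\<And>p. p \<in> K \<Longrightarrow> t \<otimes> p \<in> K"
  shows "a \<in> tower R Q K h s \<Longrightarrow> t \<otimes> a \<in> tower R Q K h s"
proof (induct s arbitrary: a)
  case 0 then show ?case using ideal.I_l_closed[OF Q _ t] by simp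
next
  case (Suc s)
  obtain p q c where 1: "p \<in> K" "q \<in> tower R Q K h s" "c \<in> Q" "a = p \<oplus> h \<otimes> q \<oplus> c" using Suc(2) by auto
  have cc: "p \<in> carrier R" "q \<in> carrier R" "c \<in> carrier R"
    using 1(1-3) K(1) tower_carrier[of s] Qc by auto
  have "t \<otimes> a = (t \<otimes> p) \<oplus> h \<otimes> (t \<otimes> q) \<oplus> (t \<otimes> c)" unfolding 1(4) using cc h t by algebra
  moreover have "t \<otimes> p \<in> K" "t \<otimes> q \<in> tower R Q K h s" "t \<otimes> c \<in> Q"
    using K_t[OF 1(1)] Suc(1)[OF 1(2)] ideal.I_l_closed[OF Q 1(3) t] .
  ultimately show ?case by auto
qed

lemma tower_stable:
  assumes prime: "primeideal Q R" and hQ: "h \<notin> Q" and K1: "\<one> \<in> K"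
    and stable: "tower R Q K h (Suc s) \<subseteq> tower R Q K h s"
  shows "\<exists>p\<in>K. p \<notin> Q \<and> (\<exists>u\<in>carrier R. h \<otimes> u \<ominus> p \<in> Q)"
proof -
  interpret Q: primeideal Q R by (rule prime)
  have pow: "h [^] k \<in> tower R Q K h (Suc k)" for k :: nat
  proof (induct k)
    case 0
    have "\<one> = \<one> \<oplus> h \<otimes> \<zero> \<oplus> \<zero>" using h by simp
    then show ?case unfolding tower.simps nat_pow_0 using K1 ideal_zero[OF Q] by blast
  next
    case (Suc k)
    have "h [^] Suc k = \<zero> \<oplus> h \<otimes> h [^] k \<oplus> \<zero>" using h by (simp add: m_comm)
    then show ?case using Suc K(2) ideal_zero[OF Q] by (subst tower.simps) blast
  qed
  \<comment> \<open>\<open>tower R Q K h n\<close> is \<open>K + hK + ... + h^(n-1)K + Q\<close>, so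
    \<open>n\<close> is the least degree of a monic equation for \<open>h\<close> over
    \<open>K\<close> modulo \<open>Q\<close>. Stability provides one of degree
    \<open>s\<close>.\<close>
  define n where "n = (LEAST n. h [^] n \<in> tower R Q K h n)"
  have n: "h [^] n \<in> tower R Q K h n"
    unfolding n_def by (rule LeastI[of _ s]) (use pow stable in blast)
  have least: "h [^] k \<notin> tower R Q K h k" if "k < n" for k
    using not_less_Least[OF that[unfolded n_def]] .
  have "\<one> \<notin> Q" using ideal_eq_carrier[OF Q] Q.I_notcarr by auto
  then have "n \<noteq> 0" using n by (cases n) auto
  then obtain k where k: "n = Suc k" by (cases n) auto
  obtain p q c where 1: "p \<in> K" "q \<in> tower R Q K h k" "c \<in> Q" "h [^] Suc k = p \<oplus> h \<otimes> q \<oplus> c"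
    using n unfolding k tower.simps by blast
  have cc: "p \<in> carrier R" "q \<in> carrier R" "c \<in> carrier R" "h [^] k \<in> carrier R"
    using 1(1-3) K(1) tower_carrier[of k] Qc h by auto
  let ?u = "h [^] k \<ominus> q"
  have "h \<otimes> ?u \<ominus> p = h [^] Suc k \<ominus> h \<otimes> q \<ominus> p" using cc h by (simp, algebra)
  also have "\<dots> = (p \<oplus> h \<otimes> q \<oplus> c) \<ominus> h \<otimes> q \<ominus> p" by (simp only: 1(4))
  also have "\<dots> = c" using cc h by algebra
  finally have e: "h \<otimes> ?u \<ominus> p = c" .
  \<comment> \<open>If the constant term were in \<open>Q\<close>, the factor \<open>h\<close>,
    which is outside the prime \<open>Q\<close>, could be cancelled, leaving a monic equation of
    degree \<open>k = n - 1\<close>.\<close>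
  have "p \<notin> Q"
  proof
    assume p: "p \<in> Q"
    have "h \<otimes> ?u = (h \<otimes> ?u \<ominus> p) \<oplus> p" using cc h by algebra
    then have "h \<otimes> ?u \<in> Q" using e 1(3) p ideal_add_closed[OF Q] by simp
    then have "?u \<in> Q" using Q.I_prime[of h ?u] h cc hQ by auto
    then have "q \<oplus> ?u \<in> tower R Q K h k" by (rule tower_add_Q[OF 1(2)])
    moreover have "q \<oplus> ?u = h [^] k" using cc by algebra
    ultimately show False using least[of k] k by simp
  qed
  then show ?thesis using 1(1,3) e cc by (intro bexI[of _ p] conjI bexI[of _ ?u]) auto
qed

end

end

text \<open>All that the proof of Cohen-Macaulayness retains of the case \<open>I = m\<close>:
  multiplication by \<open>x\<close> is onto in high degrees, and its initial form is
  regular.\<close>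

locale graded_regular = noetherian_local_ring +
  fixes x r
  assumes xm: "x \<in> m"
    and m_pow_x: "r \<le> n \<Longrightarrow> ideal_pow R m (Suc n) = (\<otimes>) x ` ideal_pow R m n"
    and x_regular: "a \<in> ideal_pow R m n \<Longrightarrow> x \<otimes> a \<in> ideal_pow R m (Suc (Suc n)) \<Longrightarrow> a \<in> ideal_pow R m (Suc n)"
begin

sublocale adic_ring R m by (rule adic_ring.intro[OF is_cring adic_ring_axioms.intro[OF m_ideal]])

abbreviation T where "T \<equiv> homog (Suc 0) x"
abbreviation const where "const \<equiv> homog 0"

lemma xc [simp]: "x \<in> carrier R" using xm ideal.Icarr[OF m_ideal] by blast

lemma T_carrier [simp]: "T \<in> carrier G" using homog_carrier[of x "Suc 0"] xm by simp

lemma const_carrier [simp]: "c \<in> carrier R \<Longrightarrow> const c \<in> carrier G" using homog_carrier[of c 0] by simp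

lemma zero_comp_iff: "f \<in> carrier G \<Longrightarrow> f n = pw (Suc n) \<longleftrightarrow> \<zero> \<in> f n"
  using G_comp_zero_iff[of f \<zero> n] ideal_zero[of "pw (Suc n)"] by auto

lemma const_mult: "c \<in> carrier R \<Longrightarrow> f \<in> carrier G \<Longrightarrow> b \<in> f n \<Longrightarrow> c \<otimes> b \<in> (const c \<otimes>\<^bsub>G\<^esub> f) n"
  using homog_mult(1)[of c 0 f b n] by simp

lemma T_mult: "f \<in> carrier G \<Longrightarrow> b \<in> f n \<Longrightarrow> x \<otimes> b \<in> (T \<otimes>\<^bsub>G\<^esub> f) (Suc n)"
  using homog_mult(1)[of x "Suc 0" f b n] xm by simp

lemma T_mult_0: "f \<in> carrier G \<Longrightarrow> (T \<otimes>\<^bsub>G\<^esub> f) 0 = pw (Suc 0)"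
  using homog_mult(2)[of x "Suc 0" f 0] xm by simp

lemma const_one: "const \<one> = \<one>\<^bsub>G\<^esub>"
  by (simp add: homog_def assoc_graded_def)

lemma const_const: "b \<in> carrier R \<Longrightarrow> c \<in> carrier R \<Longrightarrow> const b \<otimes>\<^bsub>G\<^esub> const c = const (b \<otimes> c)"
proof (rule G_eqI)
  assume bc: "b \<in> carrier R" "c \<in> carrier R"
  fix n
  show "\<exists>a. a \<in> (const b \<otimes>\<^bsub>G\<^esub> const c) n \<and> a \<in> const (b \<otimes> c) n"
  proof (cases "n = 0")
    case True
    then show ?thesis
      using const_mult[OF bc(1) const_carrier[OF bc(2)], of c 0] homog_comp[of c 0] homog_comp[of "b \<otimes> c" 0] bc by auto
  next
    case False
    then have "\<zero> \<in> const c n" "\<zero> \<in> const (b \<otimes> c) n" using homog_other[of n 0] ideal_zero by auto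
    then show ?thesis using const_mult[OF bc(1) const_carrier[OF bc(2)], of \<zero> n] bc by auto
  qed
qed simp_all

lemma const_minus_one:
  assumes f: "f \<in> carrier G" shows "const (\<ominus> \<one>) \<otimes>\<^bsub>G\<^esub> f = \<ominus>\<^bsub>G\<^esub> f"
proof (rule G_eqI)
  fix n
  obtain b where b: "b \<in> f n" using G_comp_ex[OF f] by blast
  have bc: "b \<in> carrier R" using G_comp(1)[OF f b] pw_carr by blast
  have "\<zero> \<ominus> b \<in> (\<zero>\<^bsub>G\<^esub> \<ominus>\<^bsub>G\<^esub> f) n"
    using G_comp_minus[OF G.zero_closed f _ b, of \<zero>] ideal_zero[of "pw (Suc n)"] by (simp add: G_zero)
  then have "\<ominus> b \<in> (\<ominus>\<^bsub>G\<^esub> f) n" using f bc by (simp add: a_minus_def)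
  moreover have "\<ominus> \<one> \<otimes> b \<in> (const (\<ominus> \<one>) \<otimes>\<^bsub>G\<^esub> f) n" by (rule const_mult[OF _ f b]) simp
  ultimately show "\<exists>a. a \<in> (const (\<ominus> \<one>) \<otimes>\<^bsub>G\<^esub> f) n \<and> a \<in> (\<ominus>\<^bsub>G\<^esub> f) n"
    using bc by (auto simp: l_minus)
qed (use f in simp_all)

text \<open>As in the basis theorem of Hilbert, submodules of \<open>G\<close> over the residue field are compared through their
  leading coefficients, which form an ideal of \<open>R\<close> in each degree.\<close>

definition lead where "lead N n = \<Union>{f n | f. f \<in> N \<and> (\<forall>k>n. f k = pw (Suc k))}"

lemma mem_lead: "a \<in> lead N n \<longleftrightarrow> (\<exists>f\<in>N. a \<in> f n \<and> (\<forall>k>n. f k = pw (Suc k)))"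
  by (auto simp: lead_def)

lemma lead_mono: "N \<subseteq> N' \<Longrightarrow> lead N n \<subseteq> lead N' n"
  by (auto simp: lead_def)

text \<open>Submodules over the local ring; together with \<open>tclosed\<close>, submodules over
  the polynomial ring in \<open>T\<close>. Ideals of \<open>G\<close> would be too narrow a class,
  since the members of a tower need not be ideals.\<close>

definition gsub where "gsub N \<longleftrightarrow> N \<subseteq> carrier G \<and> \<zero>\<^bsub>G\<^esub> \<in> N \<and> (\<forall>f\<in>N. \<forall>g\<in>N. f \<oplus>\<^bsub>G\<^esub> g \<in> N)
  \<and> (\<forall>c\<in>carrier R. \<forall>f\<in>N. const c \<otimes>\<^bsub>G\<^esub> f \<in> N)"

definition tclosed where "tclosed N \<longleftrightarrow> (\<forall>f\<in>N. T \<otimes>\<^bsub>G\<^esub> f \<in> N)"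

lemma gsubD:
  assumes "gsub N"
  shows "N \<subseteq> carrier G" "\<zero>\<^bsub>G\<^esub> \<in> N" "f \<in> N \<Longrightarrow> g \<in> N \<Longrightarrow> f \<oplus>\<^bsub>G\<^esub> g \<in> N"
    "c \<in> carrier R \<Longrightarrow> f \<in> N \<Longrightarrow> const c \<otimes>\<^bsub>G\<^esub> f \<in> N"
  using assms unfolding gsub_def by auto

lemma gsub_minus:
  assumes "gsub N" "f \<in> N" "g \<in> N" shows "f \<ominus>\<^bsub>G\<^esub> g \<in> N"
proof -
  have g: "g \<in> carrier G" using gsubD(1)[OF assms(1)] assms(3) by blast
  have "const (\<ominus> \<one>) \<otimes>\<^bsub>G\<^esub> g \<in> N" using gsubD(4)[OF assms(1) _ assms(3)] by simp
  then have "\<ominus>\<^bsub>G\<^esub> g \<in> N" using const_minus_one[OF g] by simp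
  then show ?thesis unfolding a_minus_def using gsubD(3)[OF assms(1,2)] by blast
qed

lemma ideal_gsub: "ideal N G \<Longrightarrow> gsub N"
  unfolding gsub_def
  using G.ideal_subset G.ideal_zero G.ideal_add_closed ideal.I_l_closed const_carrier by metis

lemma ideal_tclosed: "ideal N G \<Longrightarrow> tclosed N"
  unfolding tclosed_def using ideal.I_l_closed T_carrier by metis

lemma lead_subset: "gsub N \<Longrightarrow> lead N n \<subseteq> pw n"
proof
  fix a assume N: "gsub N" and "a \<in> lead N n"
  then obtain f where f: "f \<in> N" "a \<in> f n" by (auto simp: mem_lead)
  then show "a \<in> pw n" using G_comp(1)[of f a n] gsubD(1)[OF N] by blast
qed

lemma lead_supset: "gsub N \<Longrightarrow> pw (Suc n) \<subseteq> lead N n"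
  using gsubD(2)[of N] unfolding subset_iff mem_lead by (intro allI impI bexI[of _ "\<zero>\<^bsub>G\<^esub>"]) (auto simp: G_zero)

lemma lead_ideal:
  assumes N: "gsub N" shows "ideal (lead N n) R"
proof (rule idealI')
  have Nc: "f \<in> carrier G" if "f \<in> N" for f using gsubD(1)[OF N] that by blast
  show "lead N n \<subseteq> carrier R" using lead_subset[OF N] pw_carr by blast
  show "\<zero> \<in> lead N n" using lead_supset[OF N] ideal_zero[of "pw (Suc n)"] by auto
  show "a \<oplus> b \<in> lead N n" if ab: "a \<in> lead N n" "b \<in> lead N n" for a b
  proof -
    obtain f where f: "f \<in> N" "a \<in> f n" "\<And>k. k > n \<Longrightarrow> f k = pw (Suc k)" using ab(1) by (auto simp: mem_lead)
    obtain g where g: "g \<in> N" "b \<in> g n" "\<And>k. k > n \<Longrightarrow> g k = pw (Suc k)" using ab(2) by (auto simp: mem_lead)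
    have fg: "f \<oplus>\<^bsub>G\<^esub> g \<in> N" by (rule gsubD(3)[OF N f(1) g(1)])
    have "(f \<oplus>\<^bsub>G\<^esub> g) k = pw (Suc k)" if k: "k > n" for k
    proof -
      have "\<zero> \<in> f k" "\<zero> \<in> g k" using f(3)[OF k] g(3)[OF k] ideal_zero by auto
      then have "\<zero> \<oplus> \<zero> \<in> (f \<oplus>\<^bsub>G\<^esub> g) k" by (rule G_comp_add[OF Nc[OF f(1)] Nc[OF g(1)]])
      then show ?thesis using zero_comp_iff[OF Nc[OF fg]] by simp
    qed
    moreover have "a \<oplus> b \<in> (f \<oplus>\<^bsub>G\<^esub> g) n" by (rule G_comp_add[OF Nc[OF f(1)] Nc[OF g(1)] f(2) g(2)])
    ultimately show ?thesis unfolding mem_lead using fg by blast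
  qed
  show "c \<otimes> a \<in> lead N n" if ac: "a \<in> lead N n" "c \<in> carrier R" for a c
  proof -
    obtain f where f: "f \<in> N" "a \<in> f n" "\<And>k. k > n \<Longrightarrow> f k = pw (Suc k)" using ac(1) by (auto simp: mem_lead)
    have cf: "const c \<otimes>\<^bsub>G\<^esub> f \<in> N" by (rule gsubD(4)[OF N ac(2) f(1)])
    have "(const c \<otimes>\<^bsub>G\<^esub> f) k = pw (Suc k)" if k: "k > n" for k
    proof -
      have "\<zero> \<in> f k" using f(3)[OF k] ideal_zero by auto
      then have "c \<otimes> \<zero> \<in> (const c \<otimes>\<^bsub>G\<^esub> f) k" by (rule const_mult[OF ac(2) Nc[OF f(1)]])
      then show ?thesis using zero_comp_iff[OF Nc[OF cf]] ac(2) by simp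
    qed
    moreover have "c \<otimes> a \<in> (const c \<otimes>\<^bsub>G\<^esub> f) n" by (rule const_mult[OF ac(2) Nc[OF f(1)] f(2)])
    ultimately show ?thesis unfolding mem_lead using cf by blast
  qed
qed

lemma G_bounded: "f \<in> carrier G \<Longrightarrow> \<exists>M. \<forall>k\<ge>M. f k = pw (Suc k)"
proof -
  assume "f \<in> carrier G"
  then have "finite {n. f n \<noteq> pw (Suc n)}" by (simp add: G_carrier_iff)
  then obtain M where "\<forall>n\<in>{n. f n \<noteq> pw (Suc n)}. n \<le> M" using finite_nat_set_iff_bounded_le by blast
  then have "f k = pw (Suc k)" if "k \<ge> Suc M" for k using that by (metis (mono_tags) mem_Collect_eq not_less_eq_eq)
  then show ?thesis by blast
qed

text \<open>An element of \<open>N'\<close> loses its top component after subtracting an element of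
  \<open>N\<close> with the same leading coefficient, so induction on the degree brings it into
  \<open>N\<close>.\<close>

lemma lead_compare:
  assumes N: "gsub N" and N': "gsub N'" and sub: "N \<subseteq> N'" and lead: "\<And>n. lead N' n \<subseteq> lead N n"
  shows "N' \<subseteq> N"
proof
  have c: "f \<in> carrier G" if "f \<in> N'" for f using gsubD(1)[OF N'] that by blast
  have main: "f \<in> N" if "f \<in> N'" "\<And>k. k \<ge> M \<Longrightarrow> f k = pw (Suc k)" for f M
    using that
  proof (induct M arbitrary: f)
    case 0
    have "f = \<zero>\<^bsub>G\<^esub>" using 0(2) by (simp add: fun_eq_iff G_zero)
    then show ?case using gsubD(2)[OF N] by simp
  next
    case (Suc M)
    obtain a where a: "a \<in> f M" using G_comp_ex[OF c[OF Suc(2)]] by blast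
    have "a \<in> lead N' M" unfolding mem_lead using Suc(2,3) a by (intro bexI[of _ f]) auto
    then have "a \<in> lead N M" using lead by blast
    then obtain g where g: "g \<in> N" "a \<in> g M" "\<And>k. k > M \<Longrightarrow> g k = pw (Suc k)" by (auto simp: mem_lead)
    have g': "g \<in> N'" using g(1) sub by blast
    have fg: "f \<ominus>\<^bsub>G\<^esub> g \<in> N'" by (rule gsub_minus[OF N' Suc(2) g'])
    have "(f \<ominus>\<^bsub>G\<^esub> g) k = pw (Suc k)" if k: "k \<ge> M" for k
    proof -
      have "\<exists>b. b \<in> f k \<and> b \<in> g k"
      proof (cases "k = M")
        case False
        then have "f k = pw (Suc k)" "g k = pw (Suc k)" using Suc(3)[of k] g(3)[of k] k by auto
        then show ?thesis using ideal_zero[of "pw (Suc k)"] by auto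
      qed (use a g(2) in blast)
      then obtain b where b: "b \<in> f k" "b \<in> g k" by blast
      have "b \<in> carrier R" using G_comp(1)[OF c[OF Suc(2)] b(1)] pw_carr by blast
      then have "\<zero> \<in> (f \<ominus>\<^bsub>G\<^esub> g) k" using G_comp_minus[OF c[OF Suc(2)] c[OF g'] b] by (simp add: a_minus_def r_neg)
      then show ?thesis using zero_comp_iff[OF c[OF fg]] by simp
    qed
    then have "f \<ominus>\<^bsub>G\<^esub> g \<in> N" by (rule Suc(1)[OF fg])
    then have "(f \<ominus>\<^bsub>G\<^esub> g) \<oplus>\<^bsub>G\<^esub> g \<in> N" using gsubD(3)[OF N] g(1) by blast
    moreover have "(f \<ominus>\<^bsub>G\<^esub> g) \<oplus>\<^bsub>G\<^esub> g = f"
      using c[OF Suc(2)] c[OF g'] by (simp add: a_minus_def G.a_assoc G.l_neg)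
    ultimately show ?case by simp
  qed
  fix f assume "f \<in> N'"
  then show "f \<in> N" using G_bounded[OF c] main by blast
qed

text \<open>In each single degree the leading ideals of the chain attain their union, since the
  local ring is noetherian. Finitely many degrees are handled by one member of the chain, and
  \<open>step\<close> carries the agreement from degree \<open>M\<close> upwards.\<close>

lemma gsub_chain:
  assumes ne: "C \<noteq> {}" and gs: "\<And>N. N \<in> C \<Longrightarrow> gsub N" and U: "gsub (\<Union>C)"
    and chain: "\<And>N N'. N \<in> C \<Longrightarrow> N' \<in> C \<Longrightarrow> N \<subseteq> N' \<or> N' \<subseteq> N"
    and step: "\<And>n N. M \<le> n \<Longrightarrow> N \<in> C \<Longrightarrow> lead (\<Union>C) n \<subseteq> lead N n \<Longrightarrow> lead (\<Union>C) (Suc n) \<subseteq> lead N (Suc n)"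
  shows "\<Union>C \<in> C"
proof -
  have one: "\<exists>N\<in>C. lead (\<Union>C) n \<subseteq> lead N n" for n
  proof -
    let ?D = "(\<lambda>N. lead N n) ` C"
    have "subset.chain {I. ideal I R} ?D"
      unfolding pred_on.chain_def
    proof (intro conjI ballI)
      show "?D \<subseteq> {I. ideal I R}" using lead_ideal gs by auto
      fix a b assume "a \<in> ?D" "b \<in> ?D"
      then obtain N N' where N: "N \<in> C" "N' \<in> C" "a = lead N n" "b = lead N' n" by blast
      have "a \<subseteq> b \<or> b \<subseteq> a"
        using chain[OF N(1,2)] lead_mono[of N N' n] lead_mono[of N' N n] unfolding N(3,4) by blast
      then show "(\<subset>)\<^sup>=\<^sup>= a b \<or> (\<subset>)\<^sup>=\<^sup>= b a" by auto
    qed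
    then have "\<Union>?D \<in> ?D" by (intro ideal_chain_is_trivial) (use ne in auto)
    then obtain N where N: "N \<in> C" "\<Union>?D = lead N n" by blast
    have "lead (\<Union>C) n \<subseteq> \<Union>?D" unfolding subset_iff Union_iff by (auto simp: mem_lead)
    then show ?thesis using N by auto
  qed
  have "\<exists>N\<in>C. \<forall>n\<le>k. lead (\<Union>C) n \<subseteq> lead N n" for k
  proof (induct k)
    case 0 then show ?case using one[of 0] by auto
  next
    case (Suc k)
    obtain N where N: "N \<in> C" "\<And>n. n \<le> k \<Longrightarrow> lead (\<Union>C) n \<subseteq> lead N n" using Suc by blast
    obtain N' where N': "N' \<in> C" "lead (\<Union>C) (Suc k) \<subseteq> lead N' (Suc k)" using one by blast
    show ?case
    proof (cases "N \<subseteq> N'")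
      case True
      have "lead (\<Union>C) n \<subseteq> lead N' n" if "n \<le> Suc k" for n
        using N(2)[of n] lead_mono[OF True, of n] N'(2) that by (cases "n = Suc k") auto
      then show ?thesis using N'(1) by blast
    next
      case False
      then have "N' \<subseteq> N" using chain[OF N(1) N'(1)] by blast
      then have "lead (\<Union>C) n \<subseteq> lead N n" if "n \<le> Suc k" for n
        using N(2)[of n] lead_mono[of N' N n] N'(2) that by (cases "n = Suc k") auto
      then show ?thesis using N(1) by blast
    qed
  qed
  then obtain N where N: "N \<in> C" "\<And>n. n \<le> M \<Longrightarrow> lead (\<Union>C) n \<subseteq> lead N n" by blast
  have above: "lead (\<Union>C) (M + i) \<subseteq> lead N (M + i)" for i
  proof (induct i)
    case 0 then show ?case using N(2)[of M] by simp
  next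
    case (Suc i) then show ?case using step[of "M + i", OF _ N(1)] by simp
  qed
  have "lead (\<Union>C) n \<subseteq> lead N n" for n
    using N(2)[of n] above[of "n - M"] by (cases "n \<le> M") simp_all
  then have "\<Union>C \<subseteq> N" using N(1) by (intro lead_compare[OF gs U]) auto
  then have "\<Union>C = N" using N(1) by blast
  then show ?thesis using N(1) by simp
qed

lemma gsub_Union:
  assumes ne: "C \<noteq> {}" and gs: "\<And>N. N \<in> C \<Longrightarrow> gsub N"
    and chain: "\<And>N N'. N \<in> C \<Longrightarrow> N' \<in> C \<Longrightarrow> N \<subseteq> N' \<or> N' \<subseteq> N"
  shows "gsub (\<Union>C)"
  unfolding gsub_def
proof (intro conjI ballI)
  show "\<Union>C \<subseteq> carrier G" using gsubD(1)[OF gs] by blast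
  obtain N where "N \<in> C" using ne by blast
  then show "\<zero>\<^bsub>G\<^esub> \<in> \<Union>C" using gsubD(2)[OF gs] by blast
  fix f assume "f \<in> \<Union>C"
  then obtain N where N: "N \<in> C" "f \<in> N" by blast
  show "const c \<otimes>\<^bsub>G\<^esub> f \<in> \<Union>C" if "c \<in> carrier R" for c using gsubD(4)[OF gs[OF N(1)] that N(2)] N(1) by blast
  fix g assume "g \<in> \<Union>C"
  then obtain N' where N': "N' \<in> C" "g \<in> N'" by blast
  show "f \<oplus>\<^bsub>G\<^esub> g \<in> \<Union>C"
    using chain[OF N(1) N'(1)] gsubD(3)[OF gs[OF N(1)]] gsubD(3)[OF gs[OF N'(1)]] N N' by (meson UnionI subsetD)
qed

lemma scale_lead:
  assumes N: "gsub N" "tclosed N" shows "(\<otimes>) x ` lead N n \<subseteq> lead N (Suc n)"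
proof
  fix b assume "b \<in> (\<otimes>) x ` lead N n"
  then obtain a f where f: "b = x \<otimes> a" "f \<in> N" "a \<in> f n" "\<And>k. k > n \<Longrightarrow> f k = pw (Suc k)"
    by (auto simp: mem_lead)
  have fc: "f \<in> carrier G" using f(2) gsubD(1)[OF N(1)] by blast
  have Tf: "T \<otimes>\<^bsub>G\<^esub> f \<in> N" using N(2) f(2) by (simp add: tclosed_def)
  have "(T \<otimes>\<^bsub>G\<^esub> f) k = pw (Suc k)" if k: "k > Suc n" for k
  proof -
    obtain j where j: "k = Suc j" "j > n" using k by (cases k) auto
    have "\<zero> \<in> f j" using f(4)[OF j(2)] ideal_zero by auto
    then have "x \<otimes> \<zero> \<in> (T \<otimes>\<^bsub>G\<^esub> f) k" unfolding j(1) by (rule T_mult[OF fc])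
    then show ?thesis using zero_comp_iff[of "T \<otimes>\<^bsub>G\<^esub> f" k] fc by simp
  qed
  moreover have "x \<otimes> a \<in> (T \<otimes>\<^bsub>G\<^esub> f) (Suc n)" by (rule T_mult[OF fc f(3)])
  ultimately show "b \<in> lead N (Suc n)" unfolding mem_lead f(1) using Tf by blast
qed

lemma pw_x_pow: "r \<le> j \<Longrightarrow> pw (i + j) = (\<otimes>) (x [^] i) ` pw j"
proof (induct i)
  case 0
  have "(\<otimes>) \<one> ` pw j = pw j" using pw_carr[of _ j] by (auto simp: image_iff)
  then show ?case by simp
next
  case (Suc i)
  have "pw (Suc i + j) = (\<otimes>) x ` (\<otimes>) (x [^] i) ` pw j" using m_pow_x[of "i + j"] Suc by simp
  also have "\<dots> = (\<otimes>) (x \<otimes> x [^] i) ` pw j" using scale_scale[of "pw j" x "x [^] i"] ideal_subset[of "pw j"] by simp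
  also have "x \<otimes> x [^] i = x [^] Suc i" by (simp add: m_comm)
  finally show ?case .
qed

text \<open>From degree \<open>r\<close> on, \<open>m^(i+r) = x^i m^r\<close>, so the leading ideals
  can be pulled back into the fixed ideal \<open>m^r\<close>. There they form the ascending chain of
  the \<open>\<Gamma> i\<close>, whose stabilisation says that no new leading coefficients appear
  except multiples by \<open>x\<close>.\<close>

lemma lead_stable:
  assumes N: "gsub N" "tclosed N"
  shows "\<exists>M. \<forall>n\<ge>M. lead N (Suc n) \<subseteq> (\<otimes>) x ` lead N n"
proof -
  define \<Gamma> where "\<Gamma> i = {a \<in> pw r. x [^] i \<otimes> a \<in> lead N (i + r)}" for i
  note L = lead_ideal[OF N(1)]
  have "ideal (\<Gamma> i) R" for i
  proof (rule idealI')
    note c = pw_carr[of _ r]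
    show "\<Gamma> i \<subseteq> carrier R" using c by (auto simp: \<Gamma>_def)
    show "\<zero> \<in> \<Gamma> i" using ideal_zero[of "pw r"] ideal_zero[OF L, of "i + r"] by (simp add: \<Gamma>_def)
    show "a \<oplus> b \<in> \<Gamma> i" if "a \<in> \<Gamma> i" "b \<in> \<Gamma> i" for a b
      using that c ideal_add_closed[of "pw r" a b] ideal_add_closed[OF L] by (simp add: \<Gamma>_def r_distr)
    show "b \<otimes> a \<in> \<Gamma> i" if "a \<in> \<Gamma> i" "b \<in> carrier R" for a b
      using that c ideal.I_l_closed[of "pw r" R a b] ideal.I_l_closed[OF L] by (simp add: \<Gamma>_def m_lcomm[of _ b])
  qed
  moreover have "\<Gamma> i \<subseteq> \<Gamma> (Suc i)" for i
  proof
    fix a assume a: "a \<in> \<Gamma> i"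
    then have "x \<otimes> (x [^] i \<otimes> a) \<in> lead N (Suc (i + r))" using scale_lead[OF N] by (auto simp: \<Gamma>_def)
    moreover have "a \<in> carrier R" using a pw_carr[of a r] by (simp add: \<Gamma>_def)
    then have "x \<otimes> (x [^] i \<otimes> a) = x [^] Suc i \<otimes> a" by (simp add: m_assoc m_lcomm)
    ultimately show "a \<in> \<Gamma> (Suc i)" using a by (simp add: \<Gamma>_def)
  qed
  ultimately obtain j where j: "\<And>i. i \<ge> j \<Longrightarrow> \<Gamma> i = \<Gamma> j" using ascending_ideals_stable[of \<Gamma>] by blast
  have "lead N (Suc n) \<subseteq> (\<otimes>) x ` lead N n" if n: "n \<ge> j + r" for n
  proof
    obtain i where i: "n = i + r" "i \<ge> j" using n by (metis add_le_cancel_right le_add_diff_inverse2 le_trans le_add2)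
    fix b assume b: "b \<in> lead N (Suc n)"
    then have "b \<in> pw (Suc i + r)" using lead_subset[OF N(1)] i(1) by auto
    then obtain a where a: "a \<in> pw r" "b = x [^] Suc i \<otimes> a" using pw_x_pow[of r "Suc i"] by auto
    have ac: "a \<in> carrier R" using a(1) pw_carr by blast
    have "a \<in> \<Gamma> (Suc i)" using a b i(1) by (simp add: \<Gamma>_def)
    then have "a \<in> \<Gamma> i" using j[of "Suc i"] j[of i] i(2) by simp
    then have "x [^] i \<otimes> a \<in> lead N n" using i(1) by (simp add: \<Gamma>_def)
    moreover have "b = x \<otimes> (x [^] i \<otimes> a)" using a(2) ac by (simp add: m_assoc m_lcomm)
    ultimately show "b \<in> (\<otimes>) x ` lead N n" by blast
  qed
  then show ?thesis by blast
qed

text \<open>The ascending chain condition for submodules over the polynomial ring in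
  \<open>T\<close>. It gives both the noetherian property of \<open>G\<close> and the stabilisation
  of towers over \<open>polys\<close>.\<close>

lemma tclosed_chain:
  assumes ne: "C \<noteq> {}" and gs: "\<And>N. N \<in> C \<Longrightarrow> gsub N" and t: "\<And>N. N \<in> C \<Longrightarrow> tclosed N"
    and chain: "\<And>N N'. N \<in> C \<Longrightarrow> N' \<in> C \<Longrightarrow> N \<subseteq> N' \<or> N' \<subseteq> N"
  shows "\<Union>C \<in> C"
proof -
  have U: "gsub (\<Union>C)" by (rule gsub_Union[OF ne gs chain])
  have "tclosed (\<Union>C)" using t unfolding tclosed_def by blast
  then obtain M where M: "\<And>n. n \<ge> M \<Longrightarrow> lead (\<Union>C) (Suc n) \<subseteq> (\<otimes>) x ` lead (\<Union>C) n"
    using lead_stable[OF U] by blast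
  show ?thesis
  proof (rule gsub_chain[OF ne gs U chain])
    fix n N assume "M \<le> n" and N: "N \<in> C" and le: "lead (\<Union>C) n \<subseteq> lead N n"
    then have "lead (\<Union>C) (Suc n) \<subseteq> (\<otimes>) x ` lead (\<Union>C) n" using M by blast
    also have "\<dots> \<subseteq> (\<otimes>) x ` lead N n" using le by (rule image_mono)
    also have "\<dots> \<subseteq> lead N (Suc n)" by (rule scale_lead[OF gs[OF N] t[OF N]])
    finally show "lead (\<Union>C) (Suc n) \<subseteq> lead N (Suc n)" .
  qed
qed

lemma G_noetherian: "noetherian_ring G"
proof (rule G.trivial_ideal_chain_imp_noetherian)
  fix C assume C: "C \<noteq> {}" "subset.chain {I. ideal I G} C"
  then have i: "\<And>N. N \<in> C \<Longrightarrow> ideal N G" and c: "\<And>N N'. N \<in> C \<Longrightarrow> N' \<in> C \<Longrightarrow> N \<subseteq> N' \<or> N' \<subseteq> N"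
    unfolding pred_on.chain_def by auto
  show "\<Union>C \<in> C" by (rule tclosed_chain[OF C(1) ideal_gsub[OF i] ideal_tclosed[OF i] c])
qed

section \<open>Integral dependence in \<open>G\<close> over constants and over polynomials in
  \<open>T\<close>\<close>

lemma tower_gsub:
  assumes "ideal Q G" "gsub K" "h \<in> carrier G" shows "gsub (tower G Q K h s)"
proof -
  note a = assms(1) gsubD(1)[OF assms(2)] gsubD(2)[OF assms(2)] assms(3)
  have "\<zero>\<^bsub>G\<^esub> \<in> tower G Q K h s" using G.tower_Q[OF a] G.ideal_zero[OF assms(1)] by blast
  moreover have "f \<oplus>\<^bsub>G\<^esub> g \<in> tower G Q K h s" if "f \<in> tower G Q K h s" "g \<in> tower G Q K h s" for f g
    using G.tower_add[OF a gsubD(3)[OF assms(2)] that] by blast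
  moreover have "const c \<otimes>\<^bsub>G\<^esub> f \<in> tower G Q K h s" if "c \<in> carrier R" "f \<in> tower G Q K h s" for c f
    using G.tower_mult[OF a const_carrier[OF that(1)] gsubD(4)[OF assms(2) that(1)] that(2)] by blast
  ultimately show ?thesis unfolding gsub_def using G.tower_carrier[OF a] by blast
qed

lemma tower_tclosed:
  assumes "ideal Q G" "gsub K" "tclosed K" "h \<in> carrier G" shows "tclosed (tower G Q K h s)"
proof -
  note a = assms(1) gsubD(1)[OF assms(2)] gsubD(2)[OF assms(2)] assms(4)
  show ?thesis unfolding tclosed_def
    using G.tower_mult[OF a T_carrier] assms(3) unfolding tclosed_def by blast
qed

text \<open>The polynomial ring generated by \<open>T\<close> over the residue field.\<close>

definition polys where "polys = {f \<in> carrier G. \<forall>n. \<exists>c\<in>carrier R. c \<otimes> x [^] n \<in> f n}"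

lemma polys_gsub: "gsub polys"
  unfolding gsub_def
proof (intro conjI ballI)
  show "polys \<subseteq> carrier G" by (auto simp: polys_def)
  have "\<zero> \<otimes> x [^] n \<in> \<zero>\<^bsub>G\<^esub> n" for n using ideal_zero[of "pw (Suc n)"] by (simp add: G_zero)
  then show "\<zero>\<^bsub>G\<^esub> \<in> polys" unfolding polys_def using zero_closed by blast
  fix f assume f: "f \<in> polys"
  show "f \<oplus>\<^bsub>G\<^esub> g \<in> polys" if g: "g \<in> polys" for g
  proof -
    have fg: "f \<in> carrier G" "g \<in> carrier G" using f g by (auto simp: polys_def)
    have "\<exists>c\<in>carrier R. c \<otimes> x [^] n \<in> (f \<oplus>\<^bsub>G\<^esub> g) n" for n
    proof -
      obtain a b where ab: "a \<in> carrier R" "b \<in> carrier R" "a \<otimes> x [^] n \<in> f n" "b \<otimes> x [^] n \<in> g n"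
        using f g unfolding polys_def by blast
      have "(a \<oplus> b) \<otimes> x [^] n \<in> (f \<oplus>\<^bsub>G\<^esub> g) n" using G_comp_add[OF fg ab(3,4)] ab(1,2) by (simp add: l_distr)
      then show ?thesis using ab by blast
    qed
    then show ?thesis using fg by (simp add: polys_def)
  qed
  show "const c \<otimes>\<^bsub>G\<^esub> f \<in> polys" if c: "c \<in> carrier R" for c
  proof -
    have fc: "f \<in> carrier G" using f by (simp add: polys_def)
    have "\<exists>d\<in>carrier R. d \<otimes> x [^] n \<in> (const c \<otimes>\<^bsub>G\<^esub> f) n" for n
    proof -
      obtain a where a: "a \<in> carrier R" "a \<otimes> x [^] n \<in> f n" using f unfolding polys_def by blast
      have "(c \<otimes> a) \<otimes> x [^] n \<in> (const c \<otimes>\<^bsub>G\<^esub> f) n" using const_mult[OF c fc a(2)] a(1) c by (simp add: m_assoc)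
      then show ?thesis using a c by blast
    qed
    then show ?thesis using fc c by (simp add: polys_def)
  qed
qed

lemma polys_tclosed: "tclosed polys"
  unfolding tclosed_def
proof
  fix f assume f: "f \<in> polys"
  then have fc: "f \<in> carrier G" by (simp add: polys_def)
  have "\<exists>c\<in>carrier R. c \<otimes> x [^] n \<in> (T \<otimes>\<^bsub>G\<^esub> f) n" for n
  proof (cases n)
    case 0
    have "\<zero> \<otimes> x [^] (0::nat) \<in> (T \<otimes>\<^bsub>G\<^esub> f) 0" using T_mult_0[OF fc] ideal_zero[OF m_ideal] by simp
    then show ?thesis using 0 zero_closed by blast
  next
    case (Suc k)
    obtain a where a: "a \<in> carrier R" "a \<otimes> x [^] k \<in> f k" using f unfolding polys_def by blast
    have "x \<otimes> (a \<otimes> x [^] k) \<in> (T \<otimes>\<^bsub>G\<^esub> f) n" unfolding Suc by (rule T_mult[OF fc a(2)])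
    moreover have "x \<otimes> (a \<otimes> x [^] k) = a \<otimes> x [^] n" using a(1) Suc by (simp add: m_lcomm m_comm)
    ultimately show ?thesis using a(1) by auto
  qed
  then show "T \<otimes>\<^bsub>G\<^esub> f \<in> polys" using fc by (simp add: polys_def)
qed

lemma const_polys: "c \<in> carrier R \<Longrightarrow> const c \<in> polys"
proof -
  assume c: "c \<in> carrier R"
  have "\<exists>d\<in>carrier R. d \<otimes> x [^] n \<in> const c n" for n
  proof (cases n)
    case 0
    have "c \<otimes> x [^] n \<in> const c n" using homog_comp[of c 0] c 0 by simp
    then show ?thesis using c by blast
  next
    case (Suc k)
    have "\<zero> \<otimes> x [^] n \<in> const c n" using homog_other[of n 0 c] ideal_zero[of "pw (Suc n)"] Suc by simp
    then show ?thesis using zero_closed by blast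
  qed
  then show ?thesis using c by (simp add: polys_def)
qed

text \<open>The top coefficient of \<open>p\<close> is a unit times \<open>T^l\<close>, because a
  coefficient in \<open>m\<close> would vanish. Multiplying \<open>p\<close> by homogeneous elements
  of degree \<open>n - l\<close> and using \<open>m^n = x^l m^(n-l)\<close> reaches every leading
  coefficient of large degree \<open>n\<close>.\<close>

lemma lead_full:
  assumes Q: "ideal Q G" and p: "p \<in> polys" "p \<in> Q" "p \<noteq> \<zero>\<^bsub>G\<^esub>"
  shows "\<exists>M. \<forall>n\<ge>M. lead Q n = pw n"
proof -
  have pc: "p \<in> carrier G" using p(1) by (simp add: polys_def)
  let ?S = "{n. p n \<noteq> pw (Suc n)}"
  have fin: "finite ?S" using pc by (simp add: G_carrier_iff)
  have "?S \<noteq> {}" using p(3) by (auto simp: fun_eq_iff G_zero)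
  define l where "l = Max ?S"
  have l: "p l \<noteq> pw (Suc l)" using Max_in[OF fin \<open>?S \<noteq> {}\<close>] by (simp add: l_def)
  have above: "p k = pw (Suc k)" if "k > l" for k
  proof (rule ccontr)
    assume "p k \<noteq> pw (Suc k)"
    then have "k \<le> l" unfolding l_def using Max_ge[OF fin] by blast
    then show False using that by simp
  qed
  obtain c where c: "c \<in> carrier R" "c \<otimes> x [^] l \<in> p l" using p(1) unfolding polys_def by blast
  have xl: "x [^] l \<in> pw l" by (rule ideal_pow_pow_mem[OF m_ideal xm])
  have "c \<notin> m"
  proof
    assume "c \<in> m"
    then have "c \<otimes> x [^] l \<in> pw (Suc l)"
      unfolding ideal_pow_Suc2[OF m_ideal] using xl by (rule ideal_prod.prod)
    then show False using l G_comp_zero_iff[OF pc c(2)] by simp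
  qed
  have "lead Q n = pw n" if n: "n \<ge> l + r" for n
  proof
    show "lead Q n \<subseteq> pw n" by (rule lead_subset[OF ideal_gsub[OF Q]])
    show "pw n \<subseteq> lead Q n"
    proof
      fix a assume a: "a \<in> pw n"
      have nl: "l + (n - l) = n" "n - l + l = n" "r \<le> n - l" using n by auto
      then obtain b where b: "b \<in> pw (n - l)" "a = x [^] l \<otimes> b" using a pw_x_pow[of "n - l" l] by auto
      have bc: "b \<in> carrier R" using b(1) pw_carr by blast
      have ac: "a \<in> carrier R" using a pw_carr by blast
      let ?f = "homog (n - l) b \<otimes>\<^bsub>G\<^esub> p"
      have f: "?f \<in> Q" using ideal.I_l_closed[OF Q p(2) homog_carrier[OF b(1)]] .
      have "b \<otimes> (c \<otimes> x [^] l) \<in> ?f n" using homog_mult(1)[OF b(1) pc c(2)] nl by simp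
      moreover have "b \<otimes> (c \<otimes> x [^] l) = c \<otimes> a" using b(2) bc c(1) by (simp add: m_ac)
      moreover have "?f k = pw (Suc k)" if k: "k > n" for k
      proof -
        have k': "k = n - l + (k - (n - l))" "k - (n - l) > l" using k nl by auto
        have "\<zero> \<in> p (k - (n - l))" using above[OF k'(2)] ideal_zero by auto
        then have "b \<otimes> \<zero> \<in> ?f (n - l + (k - (n - l)))" by (rule homog_mult(1)[OF b(1) pc])
        then show ?thesis
          using zero_comp_iff[of ?f k] k'(1) bc pc homog_carrier[OF b(1)] by simp
      qed
      ultimately have "c \<otimes> a \<in> lead Q n" unfolding mem_lead using f by auto
      then show "a \<in> lead Q n"
        using mem_if_unit_mult_mem[OF lead_ideal[OF ideal_gsub[OF Q]] c(1) \<open>c \<notin> m\<close> ac] by blast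
    qed
  qed
  then show ?thesis by blast
qed

text \<open>Two rounds of integral dependence. An element \<open>h\<close> of \<open>Q\<close>
  outside \<open>P\<close> is integral over \<open>polys\<close> modulo \<open>P\<close>, and the
  constant term of a minimal equation is a nonzero polynomial in \<open>Q\<close>. Then
  \<open>Q\<close> is everything in high degrees, so any \<open>g\<close> outside \<open>Q\<close>
  is integral over the constants modulo \<open>Q\<close> and becomes invertible there.\<close>

lemma prime_above_prime_maximal:
  assumes P: "primeideal P G" and Q: "primeideal Q G" and PQ: "P \<subset> Q"
  shows "maximalideal Q G"
proof -
  interpret P: primeideal P G by fact
  interpret Q: primeideal Q G by fact
  have Pi: "ideal P G" and Qi: "ideal Q G" by unfold_locales
  obtain h where h: "h \<in> Q" "h \<notin> P" using PQ by blast
  have hc: "h \<in> carrier G" using Q.Icarr[OF h(1)] .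
  note a = Pi gsubD(1)[OF polys_gsub] gsubD(2)[OF polys_gsub] hc
  have "\<Union>(range (tower G P polys h)) \<in> range (tower G P polys h)"
  proof (rule tclosed_chain)
    show "gsub N" "tclosed N" if "N \<in> range (tower G P polys h)" for N
      using that tower_gsub[OF Pi polys_gsub hc] tower_tclosed[OF Pi polys_gsub polys_tclosed hc] by auto
    show "N \<subseteq> N' \<or> N' \<subseteq> N" if "N \<in> range (tower G P polys h)" "N' \<in> range (tower G P polys h)" for N N'
    proof -
      from that obtain i j where "N = tower G P polys h i" "N' = tower G P polys h j" by blast
      then show ?thesis using G.tower_mono'[OF a, of i j] G.tower_mono'[OF a, of j i] nat_le_linear[of i j] by blast
    qed
  qed simp
  then obtain s where "\<Union>(range (tower G P polys h)) = tower G P polys h s" by blast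
  then have stable: "tower G P polys h (Suc s) \<subseteq> tower G P polys h s" by blast
  have one: "\<one>\<^bsub>G\<^esub> \<in> polys" using const_polys[OF one_closed] const_one by simp
  from G.tower_stable[OF a P h(2) one stable] obtain p u where p: "p \<in> polys" "p \<notin> P" "u \<in> carrier G" "h \<otimes>\<^bsub>G\<^esub> u \<ominus>\<^bsub>G\<^esub> p \<in> P"
    by blast
  have pc: "p \<in> carrier G" using p(1) by (simp add: polys_def)
  have "h \<otimes>\<^bsub>G\<^esub> u \<ominus>\<^bsub>G\<^esub> (h \<otimes>\<^bsub>G\<^esub> u \<ominus>\<^bsub>G\<^esub> p) \<in> Q"
    using p(4) PQ Q.I_r_closed[OF h(1) p(3)] G.ideal_diff_closed[OF Qi] by blast
  moreover have "h \<otimes>\<^bsub>G\<^esub> u \<ominus>\<^bsub>G\<^esub> (h \<otimes>\<^bsub>G\<^esub> u \<ominus>\<^bsub>G\<^esub> p) = p"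
    using hc p(3) pc by (intro G.diff_diff) auto
  ultimately have pQ: "p \<in> Q" by simp
  have "p \<noteq> \<zero>\<^bsub>G\<^esub>" using p(2) G.ideal_zero[OF Pi] by blast
  then obtain M where M: "\<And>n. n \<ge> M \<Longrightarrow> lead Q n = pw n" using lead_full[OF Qi p(1) pQ] by blast
  show ?thesis
  proof (rule maximalidealI[OF Qi Q.I_notcarr])
    fix N assume N: "ideal N G" "Q \<subseteq> N" "N \<subseteq> carrier G"
    show "N = Q \<or> N = carrier G"
    proof (cases "N = Q")
      case False
      then obtain g where g: "g \<in> N" "g \<notin> Q" using N(2) by blast
      have gc: "g \<in> carrier G" using g(1) N(3) by blast
      \<comment> \<open>The copy of the residue field in degree zero: constants from
        \<open>m\<close> are zero in \<open>G\<close>, and all others are units.\<close>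
      let ?K = "const ` carrier R"
      have const_zero: "const c = \<zero>\<^bsub>G\<^esub>" if "c \<in> m" for c
      proof (rule G_eqI)
        have cc: "c \<in> carrier R" using ideal.Icarr[OF m_ideal that] .
        then show "const c \<in> carrier G" by simp
        fix n show "\<exists>a. a \<in> const c n \<and> a \<in> \<zero>\<^bsub>G\<^esub> n"
          using homog_comp[of c 0] homog_other[of n 0 c] that cc ideal_zero[of "pw (Suc n)"]
          by (cases "n = 0") (auto simp: G_zero)
      qed simp
      have const_add: "const b \<oplus>\<^bsub>G\<^esub> const c = const (b \<oplus> c)" if "b \<in> carrier R" "c \<in> carrier R" for b c
      proof (rule G_eqI)
        fix n show "\<exists>a. a \<in> (const b \<oplus>\<^bsub>G\<^esub> const c) n \<and> a \<in> const (b \<oplus> c) n"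
        proof (cases "n = 0")
          case True
          then show ?thesis
            using G_comp_add[of "const b" "const c" b 0 c] homog_comp[of b 0] homog_comp[of c 0]
              homog_comp[of "b \<oplus> c" 0] that by auto
        next
          case False
          have 0: "\<zero> \<in> const d n" for d using homog_other[OF False] ideal_zero by auto
          have "\<zero> \<oplus> \<zero> \<in> (const b \<oplus>\<^bsub>G\<^esub> const c) n"
            using that by (intro G_comp_add 0) simp_all
          then show ?thesis using 0[of "b \<oplus> c"] by auto
        qed
      qed (use that in simp_all)
      have K: "gsub ?K"
        unfolding gsub_def
      proof (intro conjI ballI)
        show "?K \<subseteq> carrier G" by auto
        show "\<zero>\<^bsub>G\<^esub> \<in> ?K" using const_zero[of \<zero>] ideal_zero[OF m_ideal] by (metis imageI zero_closed)
        show "f \<oplus>\<^bsub>G\<^esub> f' \<in> ?K" if "f \<in> ?K" "f' \<in> ?K" for f f' using that const_add by auto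
        show "const c \<otimes>\<^bsub>G\<^esub> f \<in> ?K" if "c \<in> carrier R" "f \<in> ?K" for c f using that const_const by auto
      qed
      note b = Qi gsubD(1)[OF K] gsubD(2)[OF K] gc
      have tg: "gsub (tower G Q ?K g s)" for s by (rule tower_gsub[OF Qi K gc])
      let ?C = "range (tower G Q ?K g)"
      have chain: "N \<subseteq> N' \<or> N' \<subseteq> N" if "N \<in> ?C" "N' \<in> ?C" for N N'
      proof -
        from that obtain i j where "N = tower G Q ?K g i" "N' = tower G Q ?K g j" by blast
        then show ?thesis using G.tower_mono'[OF b, of i j] G.tower_mono'[OF b, of j i] nat_le_linear[of i j] by blast
      qed
      have U: "gsub (\<Union>?C)" by (rule gsub_Union) (use tg chain in auto)
      have "\<Union>?C \<in> ?C"
      \<comment> \<open>This tower need not be closed under \<open>T\<close>. It stabilises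
        nevertheless, because all its members contain \<open>Q\<close>, whose leading ideals are
        already the full powers of \<open>m\<close> from degree \<open>M\<close> on.\<close>
      proof (rule gsub_chain[where M = M])
        fix n N assume n: "M \<le> n" and NC: "N \<in> ?C"
        have "lead (\<Union>?C) (Suc n) \<subseteq> pw (Suc n)" by (rule lead_subset[OF U])
        also have "\<dots> = lead Q (Suc n)" using M[of "Suc n"] n by simp
        also have "\<dots> \<subseteq> lead N (Suc n)" using NC G.tower_Q[OF b] by (intro lead_mono) auto
        finally show "lead (\<Union>?C) (Suc n) \<subseteq> lead N (Suc n)" .
      qed (use U tg chain in auto)
      then obtain s where "\<Union>?C = tower G Q ?K g s" by blast
      then have stable: "tower G Q ?K g (Suc s) \<subseteq> tower G Q ?K g s" by blast
      have one: "\<one>\<^bsub>G\<^esub> \<in> ?K" using const_one by (metis imageI one_closed)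
      from G.tower_stable[OF b Q g(2) one stable] obtain q u where q: "q \<in> ?K" "q \<notin> Q" "u \<in> carrier G" "g \<otimes>\<^bsub>G\<^esub> u \<ominus>\<^bsub>G\<^esub> q \<in> Q"
        by blast
      then obtain c where c: "c \<in> carrier R" "q = const c" by blast
      have "c \<notin> m" using q(2) c(2) const_zero[of c] G.ideal_zero[OF Qi] by auto
      then obtain d where d: "d \<in> carrier R" "d \<otimes> c = \<one>" using unit_if_notin_m c(1) by blast
      have qc: "q \<in> carrier G" using c by simp
      have "g \<otimes>\<^bsub>G\<^esub> u \<ominus>\<^bsub>G\<^esub> (g \<otimes>\<^bsub>G\<^esub> u \<ominus>\<^bsub>G\<^esub> q) \<in> N"
        using q(4) N(2) ideal.I_r_closed[OF N(1) g(1) q(3)] G.ideal_diff_closed[OF N(1)] by blast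
      moreover have "g \<otimes>\<^bsub>G\<^esub> u \<ominus>\<^bsub>G\<^esub> (g \<otimes>\<^bsub>G\<^esub> u \<ominus>\<^bsub>G\<^esub> q) = q"
        using gc q(3) qc by (intro G.diff_diff) auto
      ultimately have "q \<in> N" by simp
      then have "const d \<otimes>\<^bsub>G\<^esub> q \<in> N" using ideal.I_l_closed[OF N(1)] d(1) by simp
      then have "\<one>\<^bsub>G\<^esub> \<in> N" using const_const[OF d(1) c(1)] c(2) d(2) const_one by simp
      then show ?thesis using G.ideal_eq_carrier[OF N(1)] by blast
    qed simp
  qed
qed

section \<open>Nonzerodivisors in the maximal ideals of \<open>G\<close>\<close>

lemma T_nonzerodiv: "nonzerodiv G T"
  unfolding nonzerodiv_def
proof (intro conjI ballI impI T_carrier)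
  fix f assume f: "f \<in> carrier G" "T \<otimes>\<^bsub>G\<^esub> f = \<zero>\<^bsub>G\<^esub>"
  have "f n = pw (Suc n)" for n
  proof -
    obtain a where a: "a \<in> f n" using G_comp_ex[OF f(1)] by blast
    have "x \<otimes> a \<in> pw (Suc (Suc n))" using T_mult[OF f(1) a] f(2) by (simp add: G_zero)
    then have "a \<in> pw (Suc n)" by (rule x_regular[OF G_comp(1)[OF f(1) a]])
    then show ?thesis using G_comp_zero_iff[OF f(1) a] by simp
  qed
  then show "f = \<zero>\<^bsub>G\<^esub>" by (simp add: fun_eq_iff G_zero)
qed

lemma T_pow_mult_low: "f \<in> carrier G \<Longrightarrow> k < j \<Longrightarrow> (T [^]\<^bsub>G\<^esub> (j::nat) \<otimes>\<^bsub>G\<^esub> f) k = pw (Suc k)"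
proof (induct j arbitrary: k)
  case (Suc j)
  let ?g = "T [^]\<^bsub>G\<^esub> j \<otimes>\<^bsub>G\<^esub> f"
  have g: "?g \<in> carrier G" using Suc by simp
  have e: "T [^]\<^bsub>G\<^esub> Suc j \<otimes>\<^bsub>G\<^esub> f = T \<otimes>\<^bsub>G\<^esub> ?g" using Suc(2) by (simp add: G.m_assoc G.m_lcomm)
  show ?case
  proof (cases k)
    case 0 then show ?thesis unfolding e using T_mult_0[OF g] by simp
  next
    case (Suc i)
    then have "?g i = pw (Suc i)" using Suc.hyps[OF Suc.prems(1), of i] Suc.prems(2) by simp
    then have "\<zero> \<in> ?g i" using ideal_zero by auto
    then have "x \<otimes> \<zero> \<in> (T \<otimes>\<^bsub>G\<^esub> ?g) k" unfolding Suc by (rule T_mult[OF g])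
    then show ?thesis unfolding e using zero_comp_iff[of "T \<otimes>\<^bsub>G\<^esub> ?g" k] g by simp
  qed
qed simp

text \<open>A maximal ideal not containing \<open>T\<close> contains some \<open>1 - g T\<close>, which is a nonzerodivisor because its
  lowest component is \<open>1\<close>.\<close>

lemma maximalideal_nonzerodiv:
  assumes P: "maximalideal P G" shows "\<exists>f\<in>P. nonzerodiv G f"
proof (cases "T \<in> P")
  case True then show ?thesis using T_nonzerodiv by blast
next
  case False
  interpret P: maximalideal P G by fact
  have Pi: "ideal P G" by unfold_locales
  have TI: "ideal (PIdl\<^bsub>G\<^esub> T) G" using G.cgenideal_ideal by simp
  let ?N = "P <+>\<^bsub>G\<^esub> PIdl\<^bsub>G\<^esub> T"
  have N: "ideal ?N G" "P \<subseteq> ?N" "PIdl\<^bsub>G\<^esub> T \<subseteq> ?N"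
    using G.add_ideals[OF Pi TI] G.ideal_add_upper1[OF Pi TI] G.ideal_add_upper2[OF Pi TI] .
  have "T \<in> ?N" using N(3) G.cgenideal_self[OF T_carrier] by blast
  then have "?N = carrier G" using P.I_maximal[OF N(1,2)] G.ideal_subset[OF N(1)] False by blast
  then have "\<one>\<^bsub>G\<^esub> \<in> ?N" by simp
  then obtain p t where pt: "p \<in> P" "t \<in> PIdl\<^bsub>G\<^esub> T" "\<one>\<^bsub>G\<^esub> = p \<oplus>\<^bsub>G\<^esub> t" by (rule G.mem_ideal_addE)
  then obtain g where g: "g \<in> carrier G" "t = g \<otimes>\<^bsub>G\<^esub> T" by (auto simp: G.mem_cgenideal)
  have pc: "p \<in> carrier G" using P.Icarr[OF pt(1)] .
  have "nonzerodiv G p"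
    unfolding nonzerodiv_def
  proof (intro conjI ballI impI pc)
    fix f assume f: "f \<in> carrier G" "p \<otimes>\<^bsub>G\<^esub> f = \<zero>\<^bsub>G\<^esub>"
    have "f = (p \<oplus>\<^bsub>G\<^esub> t) \<otimes>\<^bsub>G\<^esub> f" unfolding pt(3)[symmetric] using f(1) by simp
    also have "\<dots> = t \<otimes>\<^bsub>G\<^esub> f" using f g pc by (simp add: G.l_distr)
    finally have e: "f = T \<otimes>\<^bsub>G\<^esub> (g \<otimes>\<^bsub>G\<^esub> f)" using g f(1) by (simp add: G.m_assoc G.m_lcomm)
    \<comment> \<open>The relation \<open>f = T g f\<close> is iterated. A multiple of
      \<open>T^(n+1)\<close> has no component in degree \<open>n\<close>, so every component of
      \<open>f\<close> vanishes.\<close>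
    have "\<exists>w\<in>carrier G. f = T [^]\<^bsub>G\<^esub> (j::nat) \<otimes>\<^bsub>G\<^esub> w" for j
    proof (induct j)
      case 0 then show ?case using f(1) by (intro bexI[of _ f]) simp_all
    next
      case (Suc j)
      then obtain w where w: "w \<in> carrier G" "f = T [^]\<^bsub>G\<^esub> j \<otimes>\<^bsub>G\<^esub> w" by blast
      have "f = T \<otimes>\<^bsub>G\<^esub> (g \<otimes>\<^bsub>G\<^esub> (T [^]\<^bsub>G\<^esub> j \<otimes>\<^bsub>G\<^esub> w))" unfolding w(2)[symmetric] by (rule e)
      also have "\<dots> = T [^]\<^bsub>G\<^esub> Suc j \<otimes>\<^bsub>G\<^esub> (g \<otimes>\<^bsub>G\<^esub> w)"
        using w(1) g(1) G.nat_pow_closed[OF T_carrier, of j] by (simp add: G.m_ac)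
      finally show ?case using g(1) w(1) by (intro bexI[of _ "g \<otimes>\<^bsub>G\<^esub> w"]) simp_all
    qed
    note pow = this
    have "f n = pw (Suc n)" for n
    proof -
      obtain w where w: "w \<in> carrier G" "f = T [^]\<^bsub>G\<^esub> Suc n \<otimes>\<^bsub>G\<^esub> w" using pow[of "Suc n"] by blast
      show ?thesis unfolding w(2) by (rule T_pow_mult_low[OF w(1)]) simp
    qed
    then show "f = \<zero>\<^bsub>G\<^esub>" by (simp add: fun_eq_iff G_zero)
  qed
  then show ?thesis using pt(1) by blast
qed

lemma G_cohen_macaulay: "cohen_macaulay_ring G"
proof (intro cohen_macaulay_ring.intro cohen_macaulay_ring_axioms.intro G_cring G_noetherian)
  fix P assume P: "maximalideal P G"
  interpret P: maximalideal P G by fact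
  have Pi: "ideal P G" by unfold_locales
  have prime: "primeideal P G" by (rule G.maximalideal_prime[OF P])
  have "height G P \<le> 1"
    unfolding height_def
  proof (rule Sup_least)
    fix e assume "e \<in> {enat n |n. \<exists>Q. (\<forall>i\<le>n. primeideal (Q i) G) \<and> (\<forall>i<n. Q i \<subset> Q (Suc i)) \<and> Q n = P}"
    then obtain n Q where Q: "e = enat n" "\<And>i. i \<le> n \<Longrightarrow> primeideal (Q i) G" "\<And>i. i < n \<Longrightarrow> Q i \<subset> Q (Suc i)" by blast
    have "\<not> 1 < n"
    proof
      assume n: "1 < n"
      have "maximalideal (Q 1) G" using prime_above_prime_maximal[OF Q(2)[of 0] Q(2)[of 1]] Q(3)[of 0] n by simp
      moreover have Q2: "ideal (Q 2) G" "carrier G \<noteq> Q 2" using Q(2)[of 2] n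
        by (simp_all add: primeideal.axioms(1) primeideal.I_notcarr)
      moreover have "Q 1 \<subset> Q 2" using Q(3)[of 1] n by (simp add: numeral_2_eq_2)
      ultimately show False using maximalideal.I_maximal[of "Q 1" G "Q 2"] G.ideal_subset[OF Q2(1)] by blast
    qed
    then show "e \<le> 1" using Q(1) by (simp add: one_enat_def)
  qed
  also obtain f where "f \<in> P" "nonzerodiv G f" using maximalideal_nonzerodiv[OF P] by blast
  then have "1 \<le> depth G P" using G.nonzerodiv_depth Pi P.I_notcarr by blast
  finally have "height G P \<le> depth G P" .
  then show "depth G P = height G P" using G.depth_le_height[OF prime] by simp
qed

end

theorem proposition4p2:
  fixes A :: "('a, 'b) ring_scheme" and m I :: "'a set"
  assumes "local_ring A m" and "cohen_macaulay_ring A" and "krull_dim A = 1"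
    and "infinite (carrier (A Quot m))"
    and "primaryideal I A" and "radical A I = m"
    and "hilbert_e0 A I \<ge> 3"
    and "hilbert_e1 A I = int (nat (hilbert_e0 A I) choose 2) + 1 - int (the_enat (quot_length A I))"
  shows "(ratliff_rush A I = m \<and> ideal_pow A I 2 = m \<cdot>\<^bsub>A\<^esub> I \<and> min_gens A I = 2) \<and>
    min_gens A m \<in> {2, 3} \<and>
    (min_gens A m = 2 \<longrightarrow> I = m \<and> cohen_macaulay_ring (assoc_graded A m)) \<and>
    (min_gens A m = 3 \<longrightarrow>
      (\<forall>n\<ge>2. ideal_pow A I n = ideal_pow A m n) \<and> quot_length A I = 2 \<and>
      depth (assoc_graded A I) (assoc_graded_max A m I) = 0)"
proof -
  interpret L: local_ring A m by fact
  interpret CM: cohen_macaulay_ring A by fact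
  interpret N: noetherian_local_ring A m
    by (rule noetherian_local_ring.intro[OF L.local_ring_axioms CM.noetherian_ring_axioms])
  interpret I: primaryideal I A by fact
  have I: "ideal I A" by (rule I.is_ideal)
  have depth: "depth A m = height A m" by (rule CM.depth_eq_height[OF L.maximal])
  interpret M: m_primary A m I
  proof (intro m_primary.intro m_primary_axioms.intro N.noetherian_local_ring_axioms)
    show "I \<subseteq> m" using L.ideal_subset_m[OF I] I.Q_notcarr by blast
  qed (fact | rule I N.radical_pow[OF I] N.exists_parameter[OF _ depth])+
  obtain e x r where e: "3 \<le> e" "M.reduction x r" "M.hilb r = e" "\<forall>n\<ge>1. M.hilb n = min (Suc n) e"
    using M.hilb_extremal assms(7,8) by blast
  interpret E: extremal A m I e x r by unfold_locales (use e in auto)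
  obtain y where y: "y \<in> I" "I = PIdl\<^bsub>A\<^esub> x <+>\<^bsub>A\<^esub> PIdl\<^bsub>A\<^esub> y" using E.exists_second_generator by blast
  interpret E: extremal_gens A m I e x r y by unfold_locales (use y in auto)
  have sq: "ideal_pow A I 2 = m \<cdot>\<^bsub>A\<^esub> I" using E.mI by (simp add: numeral_2_eq_2)
  have case2: "I = m \<and> cohen_macaulay_ring (assoc_graded A m)" if "min_gens A m = 2"
  proof -
    have h: "M.hilb 0 = 1" using that E.min_gens_m by simp
    then have Im: "I = m" using E.hilb_0_cases by simp
    interpret G: graded_regular A m x r
    proof (intro graded_regular.intro graded_regular_axioms.intro N.noetherian_local_ring_axioms E.xm)
      show "ideal_pow A m (Suc n) = (\<otimes>\<^bsub>A\<^esub>) x ` ideal_pow A m n" if "r \<le> n" for n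
      proof -
        have "(\<otimes>\<^bsub>A\<^esub>) x ` ideal_pow A I n = ideal_pow A I (Suc n)"
          using M.reduction_mono[OF e(2) that] unfolding M.reduction_def by blast
        then show ?thesis using Im by simp
      qed
      show "a \<in> ideal_pow A m (Suc n)"
        if "a \<in> ideal_pow A m n" "x \<otimes>\<^bsub>A\<^esub> a \<in> ideal_pow A m (Suc (Suc n))" for a n
        using E.x_initial_nonzerodiv[OF h, of a n] that Im by simp
    qed
    show ?thesis using Im G.G_cohen_macaulay by blast
  qed
  have case3: "(\<forall>n\<ge>2. ideal_pow A I n = ideal_pow A m n) \<and> quot_length A I = 2 \<and>
      depth (assoc_graded A I) (assoc_graded_max A m I) = 0" if "min_gens A m = 3"
  proof (intro conjI allI impI)
    have h: "M.hilb 0 = 2" using that E.min_gens_m by simp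
    then show "quot_length A I = 2" using M.quot_length_I by (simp add: numeral_eq_enat)
    show "ideal_pow A I n = ideal_pow A m n" if "2 \<le> n" for n
    proof -
      have "Suc (Suc (n - 2)) = n" using that by simp
      then show ?thesis using E.Ipow_eq_mpow[of "n - 2"] by simp
    qed
    \<comment> \<open>The class of \<open>z\<close> in degree zero is the annihilated element:
      \<open>zm\<close> lies in \<open>m^2 = mI\<close>, hence in \<open>I\<close>, and
      \<open>z I^(n+1)\<close> lies in \<open>m I^(n+1) = I^(n+2)\<close>.\<close>
    obtain z where z: "z \<in> m" "z \<notin> I" using E.hilb_0_cases h M.I_subset_m by auto
    interpret G: adic_ring A I by (rule adic_ring.intro[OF L.is_cring adic_ring_axioms.intro[OF I]])
    show "depth (assoc_graded A I) (assoc_graded_max A m I) = 0"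
    proof (rule G.depth_assoc_graded_0[of z])
      show "z \<in> carrier A" "z \<notin> I" using ideal.Icarr[OF L.m_ideal z(1)] z(2) .
      show "z \<otimes>\<^bsub>A\<^esub> b \<in> I" if "b \<in> m" for b
        using ideal_prod.prod[OF z(1) that, of A] L.ideal_prod_inter[OF L.m_ideal I] unfolding E.mm by blast
      show "z \<otimes>\<^bsub>A\<^esub> b \<in> ideal_pow A I (Suc (Suc n))" if "b \<in> ideal_pow A I (Suc n)" for b n
        unfolding E.m_Ipow[symmetric] using z(1) that by (rule ideal_prod.prod)
    qed
  qed
  have "min_gens A m \<in> {2, 3}" using E.hilb_0_cases E.min_gens_m by auto
  then show ?thesis
    by (intro conjI E.ratliff_rush_eq sq E.min_gens_I) (rule impI case2 case3 | assumption)+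
qed


end
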